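(* Let $A$ be the stiffness matrix of the P1 finite element approximation on a simplicial mesh $\mathcal{T}_h$ of $\Omega\subset\mathbb{R}^d$ of the eigenvalue problem $-\nabla\cdot(\mathbb{D}\nabla u)+b\cdot\nabla u+cu=\lambda u$ in $\Omega$, $u=0$ on $\partial\Omega$. If the mesh is interiorly connected and satisfies $$0<\alpha^K_{\max,\mathbb{D}^{-1}}<\arccos\left(\frac{h_K}{\lambda_{\min}(\mathbb{D}_K)}\cdot\frac{\|b\|_{L^\infty(K)}}{d+1}+\frac{h_K^2}{\lambda_{\min}(\mathbb{D}_K)}\cdot\frac{\|c\|_{L^\infty(K)}}{(d+1)(d+2)}\right)\qquad\text{for all }K\in\mathcal{T}_h, \quad ( * )$$ then $A$ is an irreducible $M$-matrix. In two dimensions ($d=2$), the condition $( * )$ can be replaced by the following Delaunay-type condition (that is, if the mesh is interiorly connected and satisfies this condition, then $A$ is an irreducible $M$-matrix): for every internal edge $e_{jk}$ connecting the $j$-th and $k$-th vertices, $$0<\frac12\left[\alpha^{K}_{jk,\mathbb{D}^{-1}}+\alpha^{K'}_{jk,\mathbb{D}^{-1}}+\operatorname{arccot}\left(\sqrt{\frac{\det(\mathbb{D}_{K'})}{\det(\mathbb{D}_K)}}\cot(\alpha^{K'}_{jk,\mathbb{D}^{-1}})-\frac{2\,\Theta(K,K')}{\sqrt{\det(\mathbb{D}_K)}}\right)+\operatorname{arccot}\left(\sqrt{\frac{\det(\mathbb{D}_K)}{\det(\mathbb{D}_{K'})}}\cot(\alpha^{K}_{jk,\mathbb{D}^{-1}})-\frac{2\,\Theta(K,K')}{\sqrt{\det(\mathbb{D}_{K'})}}\right)\right]<\pi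 ,$$ where $K$ and $K'$ are the two elements sharing the common edge $e_{jk}$, $\alpha^{K}_{jk,\mathbb{D}^{-1}}$ and $\alpha^{K'}_{jk,\mathbb{D}^{-1}}$ are the angles (in the metric $\mathbb{D}^{-1}$) in $K$ and $K'$ that face the edge $e_{jk}$, and (with $d=2$) $$\Theta(K,K')=\frac{h_K\|b\|_{L^\infty(K)}}{d+1}+\frac{h_K^2\|c\|_{L^\infty(K)}}{(d+1)(d+2)}+\frac{h_{K'}\|b\|_{L^\infty(K')}}{d+1}+\frac{h_{K'}^2\|c\|_{L^\infty(K')}}{(d+1)(d+2)} .$$
   Context: Let $\Omega\subset\mathbb{R}^d$ ($d\ge1$) be a polyhedron, and let $\mathbb{D}:\Omega\to\mathbb{R}^{d\times d}$, $b:\Omega\to\mathbb{R}^d$, $c:\Omega\to\mathbb{R}$ be given sufficiently smooth functions. Assume $\mathbb{D}(x)$ is symmetric and strictly positive definite on $\Omega$, and $c(x)-\frac12\nabla\cdot b(x)\ge0$ for all $x\in\Omega$. Let $\mathcal{T}_h$ be a simplicial mesh of $\Omega$ (from an affine family of simplicial meshes) with vertices ordered so that the first $N_v$ are the interior vertices (those not on $\partial\Omega$). Let $\phi_k$ be the P1 (continuous, piecewise linear, nodal) basis function associated with the $k$-th vertex; the finite element space is $V^h=\operatorname{span}\{\phi_1,\dots,\phi_{N_v}\}\subset H_0^1(\Omega)$. The stiffness matrix is, for $j,k=1,\dots,N_v$, $$A_{jk}=\sum_{K\in\mathcal{T}_h}\int_K\big((\nabla\phi_j)^T\mathbb{D}_K\nabla\phi_k+\phi_j\,(b\cdot\nabla\phi_k)+c\,\phi_j\phi_k\big)\,dx,\qquad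 \mathbb{D}_K=\frac1{|K|}\int_K\mathbb{D}(x)\,dx .$$ For an element $K$: $h_K$ is its diameter (largest Euclidean edge length); $\lambda_{\min}(\mathbb{D}_K)$ is the smallest eigenvalue of $\mathbb{D}_K$; $S_j^K$ is the face of $K$ not containing its $j$-th vertex; $q_j^K$ is the inner normal to $S_j^K$. The dihedral angle in the metric $\mathbb{D}^{-1}$ between the faces $S_j^K$ and $S_k^K$ ($j\ne k$) is the angle $\alpha^K_{jk,\mathbb{D}^{-1}}\in[0,\pi]$ with $$\cos\big(\alpha^K_{jk,\mathbb{D}^{-1}}\big)=-\frac{(q_j^K)^T\mathbb{D}_K q_k^K}{\sqrt{(q_j^K)^T\mathbb{D}_K q_j^K\cdot(q_k^K)^T\mathbb{D}_K q_k^K}},$$ and $\alpha^K_{\max,\mathbb{D}^{-1}}=\max_{j\ne k,\ j,k=1,\dots,d+1}\alpha^K_{jk,\mathbb{D}^{-1}}$. In 2D, the angle of $K$ facing the edge $e_{jk}$ with end vertices $j,k$ is $\alpha^K_{jk,\mathbb{D}^{-1}}$, the angle between the faces opposite to vertices $j$ and $k$. The function $\operatorname{arccot}$ takes values in $(0,\pi)$; an inequality involving $\arccos$ presupposes that its argument lies in $[-1,1]$. An internal edge in 2D is an edge shared by two elements. A mesh is called interiorly connected if any two interior vertices of the mesh are connected by a sequence of interior edges, i.e. by a path of mesh edges whose endpoints are all interior vertices. An $M$-matrix means a nonsingular $M$-matrix: a real square matrix with nonpositive off-diagonal entries that is invertible with entrywise nonnegative inverse. *)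

theory Defs
  imports
    "HOL-Analysis.Analysis"
    "HOL-Probability.Essential_Supremum"
    "Jordan_Normal_Form.Matrix"
begin

text \<open>
  Fields on \<open>\<real>\<^sup>d\<close> use the Cartesian types of HOL-Analysis, with \<open>d = CARD('d)\<close>.  The stiffness
  matrix, whose size is the number of interior vertices, is a matrix in the sense of
  Jordan-Normal-Form, so all matrix indices start at 0.
\<close>

no_notation scalar_prod (infix \<open>\<bullet>\<close> 70)


section \<open>The domain and the coefficients\<close>

text \<open>
  A polyhedron in the sense of numerical analysis: open and bounded, not necessarily convex (unlike
  the library's \<^const>\<open>polyhedron\<close>).  The condition \<open>interior (closure \<Omega>) = \<Omega>\<close> makes
  \<open>\<Omega>\<close> open and excludes slits.
\<close>

definition polyhedral_domain :: "(real^'d) set \<Rightarrow> bool" where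
  "polyhedral_domain \<Omega> \<longleftrightarrow>
     \<Omega> \<noteq> {} \<and> interior (closure \<Omega>) = \<Omega> \<and>
     (\<exists>\<P>. finite \<P> \<and> (\<forall>P\<in>\<P>. polytope P) \<and> closure \<Omega> = \<Union>\<P>)"

text \<open>Continuously differentiable in \<open>\<Omega>\<close>, with a derivative that extends continuously to the closure.\<close>

definition C1_upto_boundary :: "(real^'d) set \<Rightarrow> (real^'d \<Rightarrow> real^'d) \<Rightarrow> bool" where
  "C1_upto_boundary \<Omega> f \<longleftrightarrow>
     continuous_on (closure \<Omega>) f \<and>
     (\<exists>f' :: real^'d \<Rightarrow> (real^'d) \<Rightarrow>\<^sub>L (real^'d).
        continuous_on (closure \<Omega>) f' \<and>
        (\<forall>x\<in>\<Omega>. (f has_derivative blinfun_apply (f' x)) (at x)))"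

definition sym_pos_def :: "real^'d^'d \<Rightarrow> bool" where
  "sym_pos_def M \<longleftrightarrow> Finite_Cartesian_Product.transpose M = M \<and> (\<forall>v. v \<noteq> 0 \<longrightarrow> 0 < v \<bullet> (M *v v))"

definition divergence :: "(real^'d \<Rightarrow> real^'d) \<Rightarrow> real^'d \<Rightarrow> real" where
  "divergence f x = Determinants.trace (jacobian f (at x))"

definition gradient :: "(real^'d \<Rightarrow> real) \<Rightarrow> real^'d \<Rightarrow> real^'d" where
  "gradient f x = (THE g. GDERIV f x :> g)"

definition Linf_norm :: "(real^'d) set \<Rightarrow> (real^'d \<Rightarrow> 'a::real_normed_vector) \<Rightarrow> real" where
  "Linf_norm K f = real_of_ereal (esssup (lebesgue_on K) (\<lambda>x. ereal (norm (f x))))"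

definition lambda_min :: "real^'d^'d \<Rightarrow> real" where
  "lambda_min M = Min {l. \<exists>v. v \<noteq> 0 \<and> M *v v = l *\<^sub>R v}"

definition arccot :: "real \<Rightarrow> real" where
  "arccot y = (THE t. 0 < t \<and> t < pi \<and> cot t = y)"


section \<open>Simplicial meshes\<close>

text \<open>Elements are closed simplices; \<^const>\<open>triangulation\<close> gives finiteness and conformity.\<close>

definition simplicial_mesh :: "(real^'d) set \<Rightarrow> (real^'d) set set \<Rightarrow> bool" where
  "simplicial_mesh \<Omega> \<T> \<longleftrightarrow>
     triangulation \<T> \<and> (\<forall>K\<in>\<T>. int CARD('d) simplex K) \<and> \<Union>\<T> = closure \<Omega>"

definition vertices_of :: "(real^'d) set \<Rightarrow> (real^'d) set" where
  "vertices_of K = {v. v extreme_point_of K}"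

definition mesh_vertices :: "(real^'d) set set \<Rightarrow> (real^'d) set" where
  "mesh_vertices \<T> = (\<Union>K\<in>\<T>. vertices_of K)"

text \<open>
  An enumeration \<open>x 0, \<dots>, x (N - 1)\<close> of the vertices in which exactly the first \<open>Nv\<close> ones are
  interior, i.e. do not lie on the boundary of \<open>\<Omega>\<close>.
\<close>

definition vertex_ordering ::
  "(real^'d) set \<Rightarrow> (real^'d) set set \<Rightarrow> nat \<Rightarrow> nat \<Rightarrow> (nat \<Rightarrow> real^'d) \<Rightarrow> bool" where
  "vertex_ordering \<Omega> \<T> N Nv x \<longleftrightarrow>
     Nv \<le> N \<and> bij_betw x {..<N} (mesh_vertices \<T>) \<and>
     (\<forall>k<N. k < Nv \<longleftrightarrow> x k \<notin> frontier \<Omega>)"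

text \<open>Any two distinct vertices of a simplex are the end points of an edge of it.\<close>

definition interior_edges :: "(real^'d) set \<Rightarrow> (real^'d) set set \<Rightarrow> ((real^'d) \<times> (real^'d)) set" where
  "interior_edges \<Omega> \<T> =
     {(u, v). u \<noteq> v \<and> u \<notin> frontier \<Omega> \<and> v \<notin> frontier \<Omega> \<and>
              (\<exists>K\<in>\<T>. u \<in> vertices_of K \<and> v \<in> vertices_of K)}"

definition interiorly_connected :: "(real^'d) set \<Rightarrow> (real^'d) set set \<Rightarrow> bool" where
  "interiorly_connected \<Omega> \<T> \<longleftrightarrow>
     (\<forall>u \<in> mesh_vertices \<T> - frontier \<Omega>. \<forall>v \<in> mesh_vertices \<T> - frontier \<Omega>.
        (u, v) \<in> (interior_edges \<Omega> \<T>)\<^sup>*)"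

definition opposite_face :: "(real^'d) set \<Rightarrow> real^'d \<Rightarrow> (real^'d) set" where
  "opposite_face K v = convex hull (vertices_of K - {v})"

text \<open>Normalised to length 1; the angles below do not depend on the length.\<close>

definition inner_normal :: "(real^'d) set \<Rightarrow> real^'d \<Rightarrow> real^'d" where
  "inner_normal K v =
     (THE q. norm q = 1 \<and>
             (\<forall>y\<in>opposite_face K v. \<forall>z\<in>opposite_face K v. q \<bullet> (y - z) = 0) \<and>
             (\<forall>y\<in>opposite_face K v. 0 < q \<bullet> (v - y)))"

text \<open>
  The average of the diffusion matrix over an element, and the dihedral angle, in the metric given by
  the inverse of this average, between the faces opposite to the vertices \<open>u\<close> and \<open>v\<close>.
\<close>

definition elt_mean :: "(real^'d \<Rightarrow> real^'d^'d) \<Rightarrow> (real^'d) set \<Rightarrow> real^'d^'d" where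
  "elt_mean D K = (1 / measure lebesgue K) *\<^sub>R integral K D"

definition dihedral_angle ::
  "(real^'d \<Rightarrow> real^'d^'d) \<Rightarrow> (real^'d) set \<Rightarrow> real^'d \<Rightarrow> real^'d \<Rightarrow> real" where
  "dihedral_angle D K u v =
     (let M = elt_mean D K; p = inner_normal K u; q = inner_normal K v
      in arccos (- (p \<bullet> (M *v q)) / sqrt ((p \<bullet> (M *v p)) * (q \<bullet> (M *v q)))))"

definition max_dihedral_angle :: "(real^'d \<Rightarrow> real^'d^'d) \<Rightarrow> (real^'d) set \<Rightarrow> real" where
  "max_dihedral_angle D K =
     Max {dihedral_angle D K u v | u v. u \<in> vertices_of K \<and> v \<in> vertices_of K \<and> u \<noteq> v}"


section \<open>The P1 stiffness matrix\<close>

text \<open>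
  The conditions determine \<open>f\<close> on the closure of the domain, which is all that the stiffness matrix
  depends on.
\<close>

definition P1_basis_function :: "(real^'d) set set \<Rightarrow> real^'d \<Rightarrow> (real^'d \<Rightarrow> real) \<Rightarrow> bool" where
  "P1_basis_function \<T> v f \<longleftrightarrow>
     continuous_on (\<Union>\<T>) f \<and>
     (\<forall>K\<in>\<T>. \<exists>a \<beta>. \<forall>y\<in>K. f y = a \<bullet> y + \<beta>) \<and>
     (\<forall>w\<in>mesh_vertices \<T>. f w = (if w = v then 1 else 0))"

text \<open>
  The gradients are meaningful in the interior of each element; the element boundaries are null sets
  and do not affect the integrals.
\<close>

definition stiffness_matrix ::
  "(real^'d) set set \<Rightarrow> (real^'d \<Rightarrow> real^'d^'d) \<Rightarrow> (real^'d \<Rightarrow> real^'d) \<Rightarrow> (real^'d \<Rightarrow> real) \<Rightarrow>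
   nat \<Rightarrow> (nat \<Rightarrow> real^'d \<Rightarrow> real) \<Rightarrow> real Matrix.mat" where
  "stiffness_matrix \<T> D b c n \<phi> =
     Matrix.mat n n (\<lambda>(j, k).
       \<Sum>K\<in>\<T>. integral K (\<lambda>y.
         gradient (\<phi> j) y \<bullet> (elt_mean D K *v gradient (\<phi> k) y) +
         \<phi> j y * (b y \<bullet> gradient (\<phi> k) y) +
         c y * \<phi> j y * \<phi> k y))"


section \<open>Irreducible M-matrices\<close>

definition M_matrix :: "real Matrix.mat \<Rightarrow> bool" where
  "M_matrix A \<longleftrightarrow>
     square_mat A \<and>
     (\<forall>i<dim_row A. \<forall>j<dim_col A. i \<noteq> j \<longrightarrow> A $$ (i, j) \<le> 0) \<and>
     (\<exists>B. inverts_mat A B \<and> inverts_mat B A \<and>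
          (\<forall>i<dim_row B. \<forall>j<dim_col B. 0 \<le> B $$ (i, j)))"

text \<open>
  No simultaneous permutation of rows and columns brings the matrix to block triangular form with
  two nonempty square diagonal blocks; \<open>S\<close> is the set of indices of the rows of the zero block.
\<close>

definition irreducible_matrix :: "real Matrix.mat \<Rightarrow> bool" where
  "irreducible_matrix A \<longleftrightarrow>
     square_mat A \<and>
     \<not> (\<exists>S. S \<noteq> {} \<and> S \<subset> {..<dim_row A} \<and>
            (\<forall>i\<in>S. \<forall>j\<in>{..<dim_row A} - S. A $$ (i, j) = 0))"


section \<open>The mesh conditions\<close>

definition aniso_angle_bound ::
  "(real^'d \<Rightarrow> real^'d^'d) \<Rightarrow> (real^'d \<Rightarrow> real^'d) \<Rightarrow> (real^'d \<Rightarrow> real) \<Rightarrow> (real^'d) set \<Rightarrow> real" where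
  "aniso_angle_bound D b c K =
     (let d = real CARD('d); h = diameter K; l = lambda_min (elt_mean D K)
      in h / l * (Linf_norm K b / (d + 1)) + h\<^sup>2 / l * (Linf_norm K c / ((d + 1) * (d + 2))))"

text \<open>\<^const>\<open>arccos\<close> is unspecified outside \<open>[-1, 1]\<close>, whence the explicit restriction of its argument.\<close>

definition aniso_nonobtuse_mesh ::
  "(real^'d) set set \<Rightarrow> (real^'d \<Rightarrow> real^'d^'d) \<Rightarrow> (real^'d \<Rightarrow> real^'d) \<Rightarrow> (real^'d \<Rightarrow> real) \<Rightarrow> bool" where
  "aniso_nonobtuse_mesh \<T> D b c \<longleftrightarrow>
     (\<forall>K\<in>\<T>. aniso_angle_bound D b c K \<in> {-1..1} \<and>
            0 < max_dihedral_angle D K \<and>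
            max_dihedral_angle D K < arccos (aniso_angle_bound D b c K))"

definition Theta ::
  "(real^'d \<Rightarrow> real^'d) \<Rightarrow> (real^'d \<Rightarrow> real) \<Rightarrow> (real^'d) set \<Rightarrow> (real^'d) set \<Rightarrow> real" where
  "Theta b c K K' =
     (let d = real CARD('d); h = diameter K; h' = diameter K'
      in h * Linf_norm K b / (d + 1) + h\<^sup>2 * Linf_norm K c / ((d + 1) * (d + 2)) +
         h' * Linf_norm K' b / (d + 1) + h'\<^sup>2 * Linf_norm K' c / ((d + 1) * (d + 2)))"

definition delaunay_quantity ::
  "(real^'d \<Rightarrow> real^'d^'d) \<Rightarrow> (real^'d \<Rightarrow> real^'d) \<Rightarrow> (real^'d \<Rightarrow> real) \<Rightarrow>
   (real^'d) set \<Rightarrow> (real^'d) set \<Rightarrow> real^'d \<Rightarrow> real^'d \<Rightarrow> real" where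
  "delaunay_quantity D b c K K' u v =
     (let \<alpha> = dihedral_angle D K u v; \<alpha>' = dihedral_angle D K' u v;
          \<delta> = Determinants.det (elt_mean D K); \<delta>' = Determinants.det (elt_mean D K')
      in 1 / 2 * (\<alpha> + \<alpha>' +
           arccot (sqrt (\<delta>' / \<delta>) * cot \<alpha>' - 2 * Theta b c K K' / sqrt \<delta>) +
           arccot (sqrt (\<delta> / \<delta>') * cot \<alpha> - 2 * Theta b c K K' / sqrt \<delta>')))"

text \<open>
  To be used in dimension two.  An internal edge is given by its end points \<open>u\<close>, \<open>v\<close> and the two
  elements sharing it; \<^const>\<open>dihedral_angle\<close> at \<open>u\<close>, \<open>v\<close> is then the angle facing the edge.
\<close>

definition aniso_delaunay_mesh ::
  "(real^'d) set set \<Rightarrow> (real^'d \<Rightarrow> real^'d^'d) \<Rightarrow> (real^'d \<Rightarrow> real^'d) \<Rightarrow> (real^'d \<Rightarrow> real) \<Rightarrow> bool" where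
  "aniso_delaunay_mesh \<T> D b c \<longleftrightarrow>
     (\<forall>K\<in>\<T>. \<forall>K'\<in>\<T>. \<forall>u v.
        K \<noteq> K' \<and> u \<noteq> v \<and> {u, v} \<subseteq> vertices_of K \<inter> vertices_of K' \<longrightarrow>
        0 < delaunay_quantity D b c K K' u v \<and> delaunay_quantity D b c K K' u v < pi)"

end

theory Submission
  imports Defs "Jordan_Normal_Form.Determinant"
begin

text \<open>
  Why the theorem holds.  On an element \<open>K\<close> the basis functions are the barycentric coordinates of
  \<open>K\<close>, whose gradients \<open>g\<^sub>j\<close> are constant and whose integrals are \<open>|K| / (d + 1)\<close>, or
  \<open>|K| / ((d + 1) (d + 2))\<close> for the product of two of them.  For two distinct vertices of \<open>K\<close> the
  contribution of \<open>K\<close> to \<open>A\<^sub>j\<^sub>k\<close> is therefore at most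
  \<open>|K| (g\<^sub>j \<bullet> D\<^sub>K g\<^sub>k + \<parallel>b\<parallel> |g\<^sub>k| / (d + 1) + \<parallel>c\<parallel> / ((d + 1) (d + 2)))\<close>
  (\<open>element_contribution_bound\<close>).  The gradient \<open>g\<^sub>j\<close> is an inner normal, so its product with \<open>g\<^sub>k\<close>
  is minus the cosine of the dihedral angle times the two lengths in the metric of \<open>D\<^sub>K\<close>.  These
  lengths are at least \<open>sqrt (\<lambda>\<^sub>m\<^sub>i\<^sub>n) / h\<^sub>K\<close>, so that the nonobtuse angle condition makes
  the diffusion term beat the other two (\<open>nonobtuse_contribution_neg\<close>).

  In the plane \<open>|K| g\<^sub>j \<bullet> D\<^sub>K g\<^sub>k = - 1/2 sqrt (det D\<^sub>K) cot \<alpha>\<close>, and an edge joining two interior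
  vertices lies in exactly two triangles (\<open>interior_edge_two_elements\<close>).  Since \<open>arccot\<close> is
  decreasing and \<open>arccot (- cot \<alpha>) = pi - \<alpha>\<close>, the Delaunay-type condition forces the two cotangent
  terms together to exceed \<open>\<Theta>\<close>, so that the two contributions have a negative sum
  (\<open>delaunay_edge_neg\<close>).

  In both cases \<open>A\<^sub>j\<^sub>k\<close> with \<open>j \<noteq> k\<close> is negative when \<open>j\<close>, \<open>k\<close> span an edge and zero otherwise, so
  that interior connectedness of the mesh becomes irreducibility of \<open>A\<close>.  As \<open>c\<close> may be negative, the
  \<open>M\<close>-matrix property does not come from the row sums but from positive definiteness: a matrix with
  nonpositive off-diagonal entries and positive definite quadratic form has a nonnegative inverse
  (\<open>Z_matrix_pos_def_imp_M_matrix\<close>).  Positive definiteness is coercivity of the bilinear form: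
  \<open>\<integral> u (b \<bullet> \<nabla>u) = - 1/2 \<integral> (div b) u\<^sup>2\<close> for the finite element functions \<open>u\<close>, which vanish on the
  boundary.

  This integration by parts is valid on a polyhedron of arbitrary shape for the following reason.
  Extended by zero, \<open>u\<^sup>2 b\<close> is Lipschitz with bounded support, being Lipschitz on each of finitely many
  closed pieces (\<open>lipschitz_on_closed_pieces\<close>); by translation invariance of Lebesgue measure its
  difference quotients have integral zero, and so have its partial derivatives, by dominated convergence
  (\<open>integral_directional_derivative_compact_support\<close>).  The same gluing of Lipschitz pieces, with
  constant zero, shows that \<open>u = 0\<close> if all its gradients vanish.  That \<open>u\<close> vanishes on the boundary
  is a property of conforming meshes: a point where the basis function of an interior vertex is
  positive is itself interior (\<open>basis_support_interior\<close>).
\<close>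

(* Throughout, the inner product and component notation refer to Cartesian vectors. *)
no_notation scalar_prod (infix \<open>\<bullet>\<close> 70)
no_notation vec_index (infixl \<open>$\<close> 100)

section \<open>Inverse positivity of matrices with nonpositive off-diagonal entries\<close>

lemma mult_mat_vec_index_sum:
  assumes "A \<in> carrier_mat n n" "v \<in> carrier_vec n" "i < n"
  shows "vec_index (A *\<^sub>v v) i = (\<Sum>j<n. A $$ (i, j) * vec_index v j)"
  using assms by (auto simp: scalar_prod_def lessThan_atLeast0 intro!: sum.cong)

text \<open>
  Let \<open>m\<close> be the negative part of \<open>x\<close>.  Where \<open>m\<close> is nonzero it equals \<open>- x\<close>, and elsewhere the signs of
  the off-diagonal entries help, so \<open>0 \<le> m \<bullet> A x \<le> - m \<bullet> A m\<close>; definiteness gives \<open>m = 0\<close>.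
\<close>

lemma Z_matrix_pos_def_inverse_positive:
  fixes a :: "nat \<Rightarrow> nat \<Rightarrow> real"
  assumes offdiag: "\<And>i j. i < n \<Longrightarrow> j < n \<Longrightarrow> i \<noteq> j \<Longrightarrow> a i j \<le> 0"
    and pos: "\<And>v. \<exists>i<n. v i \<noteq> 0 \<Longrightarrow> 0 < (\<Sum>i<n. \<Sum>j<n. v i * a i j * v j)"
    and image: "\<And>i. i < n \<Longrightarrow> 0 \<le> (\<Sum>j<n. a i j * x j)"
    and "k < n"
  shows "0 \<le> x k"
proof (rule ccontr)
  assume "\<not> 0 \<le> x k"
  define m where "m i = max 0 (- x i)" for i
  have "0 < (\<Sum>i<n. \<Sum>j<n. m i * a i j * m j)"
  proof (rule pos)
    have "m k \<noteq> 0" using \<open>\<not> 0 \<le> x k\<close> by (simp add: m_def)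
    then show "\<exists>i<n. m i \<noteq> 0" using \<open>k < n\<close> by blast
  qed
  moreover have "0 \<le> (\<Sum>i<n. m i * (\<Sum>j<n. a i j * x j))"
  proof (rule sum_nonneg)
    fix i assume "i \<in> {..<n}"
    then show "0 \<le> m i * (\<Sum>j<n. a i j * x j)"
      using image[of i] by (simp add: m_def)
  qed
  moreover have "(\<Sum>i<n. m i * (\<Sum>j<n. a i j * x j)) \<le> (\<Sum>i<n. \<Sum>j<n. - (m i * a i j * m j))"
    unfolding sum_distrib_left
  proof (intro sum_mono)
    fix i j assume "i \<in> {..<n}" "j \<in> {..<n}"
    show "m i * (a i j * x j) \<le> - (m i * a i j * m j)"
    proof (cases "i = j")
      case True
      moreover have "m i * x i = - (m i * m i)" by (cases "0 \<le> x i") (auto simp: m_def)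
      ultimately show ?thesis by (metis eq_refl mult.assoc mult.commute mult_minus_right)
    next
      case False
      then have "a i j \<le> 0" using offdiag \<open>i \<in> {..<n}\<close> \<open>j \<in> {..<n}\<close> by auto
      moreover have "0 \<le> x j + m j" by (simp add: m_def)
      ultimately have "a i j * (x j + m j) \<le> 0" by (rule mult_nonpos_nonneg)
      moreover have "0 \<le> m i" by (simp add: m_def)
      ultimately have "m i * (a i j * (x j + m j)) \<le> 0" by (simp only: mult_nonneg_nonpos)
      then show ?thesis by (simp add: distrib_left mult.assoc)
    qed
  qed
  ultimately show False unfolding sum_negf by linarith
qed

text \<open>
  A definite form has trivial kernel, hence there is an inverse; its columns are preimages of the unit
  vectors, which are nonnegative.
\<close>

lemma Z_matrix_pos_def_imp_M_matrix:
  fixes A :: "real Matrix.mat"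
  assumes A: "A \<in> carrier_mat n n"
    and offdiag: "\<And>i j. i < n \<Longrightarrow> j < n \<Longrightarrow> i \<noteq> j \<Longrightarrow> A $$ (i, j) \<le> 0"
    and pos: "\<And>v. \<exists>i<n. v i \<noteq> 0 \<Longrightarrow> 0 < (\<Sum>i<n. \<Sum>j<n. v i * A $$ (i, j) * v j)"
  shows "M_matrix A"
proof -
  have "Determinant.det A \<noteq> 0"
  proof
    assume "Determinant.det A = 0"
    then obtain v where v: "v \<in> carrier_vec n" "v \<noteq> 0\<^sub>v n" "A *\<^sub>v v = 0\<^sub>v n"
      using det_0_iff_vec_prod_zero_field[OF A] by auto
    have row: "(\<Sum>j<n. A $$ (i, j) * vec_index v j) = 0" if "i < n" for i
      using mult_mat_vec_index_sum[OF A v(1) that] v(3) that by simp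
    have "\<exists>i<n. vec_index v i \<noteq> 0" using v(1,2) by (auto simp: Matrix.vec_eq_iff)
    then have "0 < (\<Sum>i<n. \<Sum>j<n. vec_index v i * A $$ (i, j) * vec_index v j)" by (rule pos)
    also have "\<dots> = (\<Sum>i<n. vec_index v i * (\<Sum>j<n. A $$ (i, j) * vec_index v j))"
      by (simp add: sum_distrib_left mult.assoc)
    also have "\<dots> = 0" by (simp add: row)
    finally show False by simp
  qed
  then have "A \<in> Units (ring_mat TYPE(real) n ())" by (rule det_non_zero_imp_unit[OF A])
  then obtain B where B: "B \<in> carrier_mat n n" "A * B = 1\<^sub>m n" "B * A = 1\<^sub>m n"
    by (auto simp: Units_def ring_mat_def)
  have "0 \<le> B $$ (i, j)" if "i < n" "j < n" for i j
  proof (rule Z_matrix_pos_def_inverse_positive[of n "\<lambda>i j. A $$ (i, j)" "\<lambda>i. B $$ (i, j)"])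
    fix k assume "k < n"
    have "(\<Sum>l<n. A $$ (k, l) * B $$ (l, j)) = (A * B) $$ (k, j)"
      using A B(1) \<open>k < n\<close> \<open>j < n\<close> by (auto simp: scalar_prod_def lessThan_atLeast0 intro!: sum.cong)
    then show "0 \<le> (\<Sum>l<n. A $$ (k, l) * B $$ (l, j))" using B(2) \<open>k < n\<close> \<open>j < n\<close> by simp
  qed (use offdiag pos that in auto)
  then show ?thesis
    using A B offdiag unfolding M_matrix_def inverts_mat_def by auto
qed

section \<open>Integrals of derivatives of compactly supported Lipschitz functions\<close>

text \<open>
  A segment meets the pieces in finitely many closed sets of parameters, which reduces the claim to
  functions of one real variable.  Asking for closed rather than convex pieces admits the complement of
  a domain as one of them.
\<close>

lemma lipschitz_on_closed_pieces:
  fixes f :: "'a::real_normed_vector \<Rightarrow> 'b::metric_space"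
  assumes lip: "\<And>S. S \<in> \<S> \<Longrightarrow> L-lipschitz_on S f" and closed: "\<And>S. S \<in> \<S> \<Longrightarrow> closed S"
    and "finite \<S>" "\<Union>\<S> = UNIV" "0 \<le> L"
  shows "L-lipschitz_on UNIV f"
proof (rule lipschitz_onI)
  fix x y :: 'a
  define p where "p t = x + t *\<^sub>R (y - x)" for t :: real
  have p: "(norm (y - x))-lipschitz_on U p" for U
    by (rule lipschitz_onI) (auto simp: p_def dist_norm mult.commute simp flip: scaleR_diff_left)
  have "(L * norm (y - x))-lipschitz_on {0..1} (f \<circ> p)"
  proof (rule lipschitz_on_closed_Union[where I=\<S> and U="\<lambda>S. p -` S"])
    show "(L * norm (y - x))-lipschitz_on (p -` S) (f \<circ> p)" if "S \<in> \<S>" for S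
      by (rule lipschitz_on_compose[OF p lipschitz_on_subset[OF lip[OF that]]]) auto
    show "closed (p -` S)" if "S \<in> \<S>" for S
      unfolding p_def by (intro closed_vimage closed that continuous_intros)
    show "{0..1} \<subseteq> (\<Union>S\<in>\<S>. p -` S)" using \<open>\<Union>\<S> = UNIV\<close> by blast
  qed (use assms in auto)
  then have "dist ((f \<circ> p) 0) ((f \<circ> p) 1) \<le> L * norm (y - x) * dist (0::real) 1"
    by (rule lipschitz_onD) auto
  then show "dist (f x) (f y) \<le> L * dist x y" by (simp add: p_def dist_norm norm_minus_commute)
qed fact

text \<open>
  The difference quotients of \<open>f\<close> have integral zero because Lebesgue measure is translation invariant.
  The Lipschitz constant and the bounded support provide a dominating function, and the integrals
  converge to that of the derivative.
\<close>

lemma integral_directional_derivative_compact_support: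
  fixes f :: "'a::euclidean_space \<Rightarrow> real"
  assumes lip: "L-lipschitz_on UNIV f" and supp: "\<And>x. R < norm x \<Longrightarrow> f x = 0"
    and "negligible N"
    and deriv: "\<And>x. x \<notin> N \<Longrightarrow> ((\<lambda>t. (f (x + t *\<^sub>R e) - f x) / t) \<longlongrightarrow> f' x) (at 0)"
  shows "(f' has_integral 0) UNIV"
proof -
  have "0 \<le> L" using lip lipschitz_on_nonneg by blast
  define s :: "nat \<Rightarrow> real" where "s n = 1 / real (Suc n)" for n
  define g where "g n x = (f (x + s n *\<^sub>R e) - f x) / s n" for n x
  have s: "0 < s n" "s n \<le> 1" for n by (auto simp: s_def)
  have "integrable lborel (\<lambda>x. indicator (cball 0 R) x *\<^sub>R f x)"
    by (intro borel_integrable_compact compact_cball)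
       (rule continuous_on_subset[OF lipschitz_on_continuous_on[OF lip]], simp)
  also have "(\<lambda>x. indicator (cball 0 R) x *\<^sub>R f x) = f"
    using supp by (auto simp: indicator_def fun_eq_iff)
  finally have f: "integrable lborel f" .
  have shift: "integrable lborel (\<lambda>x. f (x + c))" "(\<integral>x. f (x + c) \<partial>lborel) = (\<integral>x. f x \<partial>lborel)" for c
  proof -
    have meas: "f \<in> borel_measurable borel" using f by auto
    have "integrable (distr lborel borel ((+) c)) f" using f by (simp add: lborel_distr_plus)
    then show "integrable lborel (\<lambda>x. f (x + c))"
      using meas by (subst (asm) integrable_distr_eq) (auto simp: add.commute)
    have "(\<integral>x. f x \<partial>lborel) = (\<integral>x. f x \<partial>distr lborel borel ((+) c))" by (simp add: lborel_distr_plus)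
    also have "\<dots> = (\<integral>x. f (x + c) \<partial>lborel)"
      using meas by (subst integral_distr) (auto simp: add.commute)
    finally show "(\<integral>x. f (x + c) \<partial>lborel) = (\<integral>x. f x \<partial>lborel)" by simp
  qed
  have "integrable lborel (g n)" "(\<integral>x. g n x \<partial>lborel) = 0" for n
    unfolding g_def using f shift by auto
  then have "(g n has_integral 0) UNIV" for n
    using has_integral_integral_lborel[of "g n"] by simp
  then have g: "(g n has_integral 0) (- N)" for n
    by (rule has_integral_spike_set_eq[THEN iffD1, rotated 2]) (auto intro: negligible_subset[OF \<open>negligible N\<close>])
  let ?h = "\<lambda>x. indicator (cball 0 (R + norm e)) x *\<^sub>R (L * norm e)"
  have "integrable lborel ?h"
    by (intro borel_integrable_compact compact_cball) auto
  then have "?h integrable_on UNIV" using integrable_on_lborel by blast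
  then have h: "?h integrable_on - N"
    by (rule integrable_spike_set) (auto intro: negligible_subset[OF \<open>negligible N\<close>])
  have le: "norm (g n x) \<le> ?h x" for n x
  proof (cases "norm x \<le> R + norm e")
    case True
    have "\<bar>f (x + s n *\<^sub>R e) - f x\<bar> \<le> L * dist (x + s n *\<^sub>R e) x"
      using lipschitz_onD[OF lip, of "x + s n *\<^sub>R e" x] by (simp add: dist_real_def)
    also have "\<dots> = s n * (L * norm e)" using s[of n] by (simp add: dist_norm)
    finally show ?thesis using True s[of n] by (simp add: g_def abs_divide divide_le_eq ac_simps)
  next
    case False
    have "norm x \<le> norm (x + s n *\<^sub>R e) + norm (s n *\<^sub>R e)"
      by (metis norm_triangle_sub add_diff_cancel_left' norm_minus_commute norm_triangle_ineq4 add_diff_cancel_right')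
    also have "norm (s n *\<^sub>R e) \<le> norm e" using s[of n] by (simp add: mult_left_le_one_le)
    finally have "R < norm (x + s n *\<^sub>R e)" using False by linarith
    moreover have "R < norm x" using False norm_ge_zero[of e] by linarith
    ultimately show ?thesis using \<open>0 \<le> L\<close> by (simp add: g_def supp)
  qed
  have "filterlim s (at 0) sequentially"
    unfolding filterlim_at s_def using LIMSEQ_inverse_real_of_nat by (auto simp: divide_inverse)
  then have lim: "(\<lambda>n. g n x) \<longlonglongrightarrow> f' x" if "x \<in> - N" for x
    unfolding g_def using filterlim_compose[OF deriv, of x s] that by auto
  have "f' integrable_on - N" "(\<lambda>n. integral (- N) (g n)) \<longlonglongrightarrow> integral (- N) f'"
    using dominated_convergence[of g "- N" ?h f'] g h le lim by (auto simp: integrable_on_def)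
  moreover have "integral (- N) (g n) = 0" for n using g by (rule integral_unique)
  ultimately have "(f' has_integral 0) (- N)"
    by (simp add: LIMSEQ_const_iff has_integral_integrable_integral)
  then show ?thesis
    by (rule has_integral_spike_set_eq[THEN iffD1, rotated 2]) (auto intro: negligible_subset[OF \<open>negligible N\<close>])
qed

section \<open>Barycentric coordinates and their integrals\<close>

lemma set_integrable_continuous_compact:
  fixes f :: "'a::euclidean_space \<Rightarrow> 'b::euclidean_space"
  assumes "compact S" "continuous_on S f"
  shows "set_integrable lborel S f"
  unfolding set_integrable_def by (rule borel_integrable_compact[OF assms])

lemma integrable_on_continuous_compact:
  fixes f :: "'a::euclidean_space \<Rightarrow> 'b::euclidean_space"
  assumes "compact S" "continuous_on S f"
  shows "f integrable_on S"
  using set_borel_integral_eq_integral(1)[OF set_integrable_continuous_compact[OF assms]] .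

lemma continuous_on_compact_norm_bound:
  fixes f :: "'a::metric_space \<Rightarrow> 'b::real_normed_vector"
  assumes "compact S" "continuous_on S f"
  obtains L where "\<And>y. y \<in> S \<Longrightarrow> norm (f y) \<le> L"
  using compact_imp_bounded[OF compact_continuous_image[OF assms(2,1)]] by (auto simp: bounded_iff)

text \<open>
  The gradients and constants of the barycentric coordinates are parameters, determined by the nodal
  conditions, because the basis functions of a mesh will supply them.
\<close>

locale barycentric =
  fixes C :: "'a::euclidean_space set" and g :: "'a \<Rightarrow> 'a" and \<beta> :: "'a \<Rightarrow> real"
  assumes indep: "\<not> affine_dependent C" and card_C: "card C = Suc DIM('a)"
    and nodal: "\<And>v w. v \<in> C \<Longrightarrow> w \<in> C \<Longrightarrow> g v \<bullet> w + \<beta> v = (if w = v then 1 else 0)"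
begin

definition bary :: "'a \<Rightarrow> 'a \<Rightarrow> real" where
  "bary v y = g v \<bullet> y + \<beta> v"

lemma finite_C: "finite C"
  using card_C card.infinite by fastforce

lemma bary_nodal: "v \<in> C \<Longrightarrow> w \<in> C \<Longrightarrow> bary v w = (if w = v then 1 else 0)"
  by (simp add: bary_def nodal)

lemma bary_affine: "bary v (x + t *\<^sub>R (y - x)) = bary v x + t * (bary v y - bary v x)"
  by (simp add: bary_def algebra_simps)

lemma bary_diff: "bary v x - bary v y = g v \<bullet> (x - y)"
  by (simp add: bary_def algebra_simps)

lemma bary_continuous [continuous_intros]: "continuous_on S (bary v)"
  unfolding bary_def by (intro continuous_intros)

lemma bary_measurable [measurable]: "bary v \<in> borel_measurable borel"
  by (rule borel_measurable_continuous_onI[OF bary_continuous])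

text \<open>
  Affine combinations are the barycentric expansion: an affine function commutes with them, and the
  nodal values pick out one coefficient.
\<close>

lemma bary_coeff:
  assumes "v \<in> C" "sum u C = 1" "(\<Sum>w\<in>C. u w *\<^sub>R w) = y"
  shows "bary v y = u v"
proof -
  have "bary v y = (\<Sum>w\<in>C. u w * bary v w)"
    using assms(2) by (simp add: bary_def assms(3)[symmetric] inner_sum_right distrib_left
      sum.distrib flip: sum_distrib_right)
  also have "\<dots> = (\<Sum>w\<in>C. if w = v then u w else 0)"
    using assms(1) by (intro sum.cong) (auto simp: bary_nodal)
  finally show ?thesis using assms(1) finite_C by simp
qed

lemma bary_representation: "(\<Sum>v\<in>C. bary v y) = 1" "(\<Sum>v\<in>C. bary v y *\<^sub>R v) = y"
proof -
  have "y \<in> affine hull C" using affine_independent_span_eq[OF indep card_C] by simp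
  then obtain u where u: "sum u C = 1" "(\<Sum>w\<in>C. u w *\<^sub>R w) = y"
    using affine_hull_finite[OF finite_C] by auto
  then show "(\<Sum>v\<in>C. bary v y) = 1" "(\<Sum>v\<in>C. bary v y *\<^sub>R v) = y"
    using bary_coeff[OF _ u] by simp_all
qed

lemma affine_function_expansion: "a \<bullet> y + b = (\<Sum>v\<in>C. bary v y * (a \<bullet> v + b))"
proof -
  have "(\<Sum>v\<in>C. bary v y * (a \<bullet> v + b)) = a \<bullet> (\<Sum>v\<in>C. bary v y *\<^sub>R v) + (\<Sum>v\<in>C. bary v y) * b"
    by (simp add: inner_sum_right distrib_left sum.distrib sum_distrib_right)
  then show ?thesis by (simp add: bary_representation)
qed

lemma simplex_eq: "convex hull C = {y. \<forall>v\<in>C. 0 \<le> bary v y}"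
proof (intro Set.set_eqI iffI)
  fix y assume "y \<in> convex hull C"
  then obtain u where u: "\<forall>w\<in>C. 0 \<le> u w" "sum u C = 1" "(\<Sum>w\<in>C. u w *\<^sub>R w) = y"
    by (auto simp: convex_hull_finite[OF finite_C])
  then show "y \<in> {y. \<forall>v\<in>C. 0 \<le> bary v y}" using bary_coeff[OF _ u(2,3)] by simp
next
  fix y assume "y \<in> {y. \<forall>v\<in>C. 0 \<le> bary v y}"
  then show "y \<in> convex hull C"
    using bary_representation[of y] by (auto simp: convex_hull_finite[OF finite_C] intro!: exI[of _ "\<lambda>v. bary v y"])
qed

lemma compact_simplex: "compact (convex hull C)"
  by (rule finite_imp_compact_convex_hull[OF finite_C])

lemma interior_simplex: "{y. \<forall>v\<in>C. 0 < bary v y} \<subseteq> interior (convex hull C)"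
proof (rule interior_maximal)
  show "{y. \<forall>v\<in>C. 0 < bary v y} \<subseteq> convex hull C" by (auto simp: simplex_eq less_imp_le)
  have "{y. \<forall>v\<in>C. 0 < bary v y} = (\<Inter>v\<in>C. {y. 0 < bary v y})" by auto
  also have "open \<dots>"
    by (intro open_INT finite_C ballI open_Collect_less continuous_intros)
  finally show "open {y. \<forall>v\<in>C. 0 < bary v y}" .
qed

lemma interior_simplex_nonempty: "interior (convex hull C) \<noteq> {}"
proof -
  have "bary v ((1 / card C) *\<^sub>R (\<Sum>w\<in>C. w)) = 1 / card C" if "v \<in> C" for v
    using that finite_C card_C
    by (intro bary_coeff[of v "\<lambda>_. 1 / card C"]) (auto simp: scaleR_sum_right)
  then have "(1 / card C) *\<^sub>R (\<Sum>w\<in>C. w) \<in> {y. \<forall>v\<in>C. 0 < bary v y}"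
    using card_C by simp
  then show ?thesis using interior_simplex by blast
qed

lemma measure_simplex_pos: "0 < measure lebesgue (convex hull C)"
proof -
  have "\<not> negligible (convex hull C)"
    using open_not_negligible[OF open_interior interior_simplex_nonempty]
      negligible_subset interior_subset by blast
  moreover have "convex hull C \<in> lmeasurable"
    by (rule lmeasurable_compact[OF compact_simplex])
  ultimately show ?thesis
    by (metis less_eq_real_def measure_nonneg negligible_iff_measure)
qed

lemma g_nonzero: assumes "v \<in> C" shows "g v \<noteq> 0"
proof
  assume "g v = 0"
  have "card (C - {v}) \<noteq> 0"
    using card_C assms DIM_positive[where 'a='a] by (simp add: card_Diff_singleton)
  then obtain w where "w \<in> C" "w \<noteq> v" by (metis card.empty DiffE all_not_in_conv insertI1)
  then show False using nodal[of v w] nodal[of v v] assms \<open>g v = 0\<close> by auto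
qed

text \<open>
  The part of a simplex cut off near the vertex \<open>v\<close> by a parallel to the opposite face is a homothetic
  copy of the simplex.
\<close>

lemma homothety_in_simplex:
  assumes v: "v \<in> C" and "0 < r" "r \<le> 1"
  shows "v + r *\<^sub>R (y - v) \<in> convex hull C \<and> 1 - r \<le> bary v (v + r *\<^sub>R (y - v)) \<longleftrightarrow> y \<in> convex hull C"
proof -
  have b: "bary w (v + r *\<^sub>R (y - v)) = (if w = v then 1 - r + r * bary v y else r * bary w y)"
    if "w \<in> C" for w
    using that v by (simp only: bary_affine) (auto simp: bary_nodal algebra_simps)
  show ?thesis (is "?l \<longleftrightarrow> ?r")
  proof
    assume ?l
    then have "0 \<le> bary w y" if "w \<in> C" for w
      using b[OF that] b[OF v] that \<open>0 < r\<close>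
      by (cases "w = v") (auto simp: simplex_eq zero_le_mult_iff)
    then show ?r by (simp add: simplex_eq)
  next
    assume ?r
    then show ?l using b v assms by (auto simp: simplex_eq)
  qed
qed

text \<open>
  Layer cake formula for the factor \<open>bary v\<close>: the layer \<open>{bary v \<ge> s}\<close> is the homothetic copy of the
  simplex of ratio \<open>1 - s\<close>, on which \<open>f\<close> integrates to \<open>(1 - s) ^ (d + m)\<close> times its integral over the
  whole simplex.  The degrees \<open>m = 0\<close> and \<open>m = 1\<close> give the integrals of one barycentric coordinate and of the product of two.
\<close>

lemma nn_integral_bary_mult_homogeneous:
  assumes v: "v \<in> C" and f [measurable]: "f \<in> borel_measurable borel"
    and nonneg: "\<And>y. y \<in> convex hull C \<Longrightarrow> 0 \<le> f y"
    and hom: "\<And>r y. 0 < r \<Longrightarrow> r \<le> 1 \<Longrightarrow> y \<in> convex hull C \<Longrightarrow> f (v + r *\<^sub>R (y - v)) = r ^ m * f y"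
  shows "(\<integral>\<^sup>+y. ennreal (bary v y * f y) * indicator (convex hull C) y \<partial>lborel) =
     ennreal (1 / real (DIM('a) + m + 1)) * (\<integral>\<^sup>+y. ennreal (f y) * indicator (convex hull C) y \<partial>lborel)"
    (is "?L = _ * ?F")
proof -
  let ?K = "convex hull C" and ?n = "DIM('a) + m"
  have K [measurable]: "?K \<in> sets borel" using compact_simplex by (simp add: borel_compact)
  have le1: "bary v y \<le> 1" if "y \<in> ?K" for y
  proof -
    have "bary v y \<le> (\<Sum>w\<in>C. bary w y)"
      using that v finite_C by (intro member_le_sum) (auto simp: simplex_eq)
    then show ?thesis by (simp add: bary_representation)
  qed
  \<comment> \<open>The layers \<open>s = 0\<close> and \<open>s = 1\<close> form a null set and are left out.\<close>
  have slice: "(\<integral>\<^sup>+y. ennreal (f y) * indicator ?K y * indicator {0<..bary v y} s \<partial>lborel)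
      = ennreal ((1 - s) ^ ?n) * indicator {0..1} s * ?F" if "s \<noteq> 0" "s \<noteq> 1" for s :: real
  proof (cases "0 < s \<and> s < 1")
    case True
    let ?r = "1 - s" and ?H = "\<lambda>y. ennreal (f y) * indicator ?K y * indicator {0<..bary v y} s"
    have r: "0 < ?r" "?r \<le> 1" using True by auto
    have lborel_eq: "lborel = density (distr lborel borel (\<lambda>x. (v - ?r *\<^sub>R v) + ?r *\<^sub>R x)) (\<lambda>_. \<bar>?r\<bar> ^ DIM('a))"
      using r by (intro lborel_affine) auto
    have [measurable]: "(\<lambda>y. indicator {0<..bary v y} s :: ennreal) \<in> borel_measurable borel"
      by (simp add: indicator_def)
    have "(\<integral>\<^sup>+y. ?H y \<partial>lborel) = (\<integral>\<^sup>+x. \<bar>?r\<bar> ^ DIM('a) * ?H ((v - ?r *\<^sub>R v) + ?r *\<^sub>R x) \<partial>lborel)"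
      by (subst lborel_eq) (simp add: nn_integral_density nn_integral_distr)
    also have "\<dots> = (\<integral>\<^sup>+x. ennreal (?r ^ ?n) * (ennreal (f x) * indicator ?K x) \<partial>lborel)"
    proof (rule nn_integral_cong)
      fix x
      have eq: "(v - ?r *\<^sub>R v) + ?r *\<^sub>R x = v + ?r *\<^sub>R (x - v)" by (simp add: algebra_simps)
      show "\<bar>?r\<bar> ^ DIM('a) * ?H ((v - ?r *\<^sub>R v) + ?r *\<^sub>R x) = ennreal (?r ^ ?n) * (ennreal (f x) * indicator ?K x)"
      proof (cases "x \<in> ?K")
        case x: True
        then have *: "v + ?r *\<^sub>R (x - v) \<in> ?K" "s \<le> bary v (v + ?r *\<^sub>R (x - v))"
          using homothety_in_simplex[OF v r, of x] by auto
        have "\<bar>?r\<bar> ^ DIM('a) * ?H ((v - ?r *\<^sub>R v) + ?r *\<^sub>R x) = ennreal (?r ^ DIM('a)) * ennreal (?r ^ m * f x)"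
          unfolding eq using * True hom[OF r x] by simp
        also have "\<dots> = ennreal (?r ^ ?n) * ennreal (f x)"
          using r nonneg[OF x] by (simp add: ennreal_mult[symmetric] power_add mult.assoc)
        finally show ?thesis using x by simp
      next
        case False
        then have "\<not> (v + ?r *\<^sub>R (x - v) \<in> ?K \<and> s \<le> bary v (v + ?r *\<^sub>R (x - v)))"
          using homothety_in_simplex[OF v r, of x] by auto
        then show ?thesis unfolding eq using False by (auto simp: indicator_def)
      qed
    qed
    also have "\<dots> = ennreal (?r ^ ?n) * ?F" by (rule nn_integral_cmult) simp
    finally show ?thesis using True by simp
  next
    case False
    then have "(\<lambda>y. ennreal (f y) * indicator ?K y * indicator {0<..bary v y} s) = (\<lambda>_. 0)"
      using le1 that by (force simp: fun_eq_iff indicator_def)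
    moreover have "s \<notin> {0..1}" using False that by auto
    ultimately show ?thesis by simp
  qed
  have "?L = (\<integral>\<^sup>+y. \<integral>\<^sup>+s. ennreal (f y) * indicator ?K y * indicator {0<..bary v y} s \<partial>lborel \<partial>lborel)"
  proof (rule nn_integral_cong)
    fix y
    have "(\<integral>\<^sup>+s. ennreal (f y) * indicator ?K y * indicator {0<..bary v y} s \<partial>lborel) =
        ennreal (f y) * indicator ?K y * emeasure lborel {0<..bary v y}"
      by (subst nn_integral_cmult) auto
    also have "\<dots> = ennreal (bary v y * f y) * indicator ?K y"
      using v nonneg by (cases "y \<in> ?K") (auto simp: simplex_eq ennreal_mult' mult.commute)
    finally show "ennreal (bary v y * f y) * indicator ?K y =
        (\<integral>\<^sup>+s. ennreal (f y) * indicator ?K y * indicator {0<..bary v y} s \<partial>lborel)" ..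
  qed
  also have "\<dots> = (\<integral>\<^sup>+s. \<integral>\<^sup>+y. ennreal (f y) * indicator ?K y * indicator {0<..bary v y} s \<partial>lborel \<partial>lborel)"
  proof (rule lborel_pair.Fubini')
    have "(\<lambda>(s, y). ennreal (f y) * indicator ?K y * (if 0 < s \<and> s \<le> bary v y then 1 else 0))
       \<in> borel_measurable (lborel \<Otimes>\<^sub>M lborel)"
      by measurable
    then show "(\<lambda>(s, y). ennreal (f y) * indicator ?K y * indicator {0<..bary v y} s)
       \<in> borel_measurable (lborel \<Otimes>\<^sub>M lborel)"
      by (simp add: indicator_def of_bool_def)
  qed
  also have "\<dots> = (\<integral>\<^sup>+s. ennreal ((1 - s) ^ ?n) * indicator {0..1} s * ?F \<partial>lborel)"
  proof (rule nn_integral_cong_AE)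
    have "AE s in lborel. s \<noteq> 0 \<and> s \<noteq> (1::real)"
      using AE_lborel_singleton[of 0] AE_lborel_singleton[of 1] by eventually_elim auto
    then show "AE s in lborel. (\<integral>\<^sup>+y. ennreal (f y) * indicator ?K y * indicator {0<..bary v y} s \<partial>lborel)
       = ennreal ((1 - s) ^ ?n) * indicator {0..1} s * ?F"
      by eventually_elim (simp add: slice)
  qed
  also have "\<dots> = (\<integral>\<^sup>+s. ennreal ((1 - s) ^ ?n) * indicator {0..1} s \<partial>lborel) * ?F"
    by (rule nn_integral_multc) simp
  also have "(\<integral>\<^sup>+s. ennreal ((1 - s) ^ ?n) * indicator {0..1} s \<partial>lborel) =
      ennreal (- ((1 - 1) ^ Suc ?n / real (Suc ?n)) - (- ((1 - 0) ^ Suc ?n / real (Suc ?n))))"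
    by (rule nn_integral_FTC_Icc) (auto intro!: derivative_eq_intros simp: divide_simps simp del: power_Suc of_nat_Suc)
  also have "- ((1 - 1) ^ Suc ?n / real (Suc ?n)) - (- ((1 - 0) ^ Suc ?n / real (Suc ?n))) = 1 / real (DIM('a) + m + 1)"
    by simp
  finally show ?thesis .
qed

lemma ennreal_integral_simplex:
  fixes f :: "'a \<Rightarrow> real"
  assumes "\<And>y. y \<in> convex hull C \<Longrightarrow> 0 \<le> f y" "continuous_on UNIV f"
  shows "ennreal (integral (convex hull C) f) = (\<integral>\<^sup>+y. ennreal (f y) * indicator (convex hull C) y \<partial>lborel)"
proof -
  let ?f = "\<lambda>y. indicator (convex hull C) y *\<^sub>R f y"
  have int: "set_integrable lborel (convex hull C) f"
    by (intro set_integrable_continuous_compact compact_simplex continuous_on_subset[OF assms(2)]) simp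
  have "ennreal (integral (convex hull C) f) = ennreal (integral\<^sup>L lborel ?f)"
    using set_borel_integral_eq_integral(2)[OF int] by (simp add: set_lebesgue_integral_def)
  also have "\<dots> = (\<integral>\<^sup>+y. ennreal (?f y) \<partial>lborel)"
    using assms(1) int unfolding set_integrable_def
    by (intro nn_integral_eq_integral[symmetric]) (auto simp: indicator_def)
  also have "\<dots> = (\<integral>\<^sup>+y. ennreal (f y) * indicator (convex hull C) y \<partial>lborel)"
    by (intro nn_integral_cong) (auto simp: indicator_def)
  finally show ?thesis .
qed

lemma integral_bary_mult_homogeneous:
  fixes f :: "'a \<Rightarrow> real"
  assumes v: "v \<in> C" and f: "continuous_on UNIV f"
    and nonneg: "\<And>y. y \<in> convex hull C \<Longrightarrow> 0 \<le> f y"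
    and hom: "\<And>r y. 0 < r \<Longrightarrow> r \<le> 1 \<Longrightarrow> y \<in> convex hull C \<Longrightarrow> f (v + r *\<^sub>R (y - v)) = r ^ m * f y"
  shows "integral (convex hull C) (\<lambda>y. bary v y * f y) = integral (convex hull C) f / real (DIM('a) + m + 1)"
proof -
  let ?K = "convex hull C"
  have nonneg': "0 \<le> bary v y * f y" if "y \<in> ?K" for y using that nonneg v by (auto simp: simplex_eq)
  have cont: "continuous_on ?K f" "continuous_on ?K (\<lambda>y. bary v y * f y)"
    using f by (auto intro!: continuous_intros intro: continuous_on_subset)
  have pos: "0 \<le> integral ?K (\<lambda>y. bary v y * f y)" "0 \<le> integral ?K f"
    using nonneg nonneg'
    by (auto intro!: Henstock_Kurzweil_Integration.integral_nonneg integrable_on_continuous_compact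
      compact_simplex cont)
  have "ennreal (integral ?K (\<lambda>y. bary v y * f y)) = ennreal (1 / real (DIM('a) + m + 1)) * ennreal (integral ?K f)"
    using nn_integral_bary_mult_homogeneous[OF v _ nonneg hom] f nonneg nonneg'
    by (subst (1 2) ennreal_integral_simplex)
       (auto intro!: continuous_intros borel_measurable_continuous_onI)
  also have "\<dots> = ennreal (integral ?K f / real (DIM('a) + m + 1))"
    using pos(2) by (simp add: ennreal_mult[symmetric])
  finally show ?thesis using pos by (subst (asm) ennreal_inj) auto
qed

lemma integral_bary:
  assumes "v \<in> C"
  shows "integral (convex hull C) (bary v) = measure lebesgue (convex hull C) / (real DIM('a) + 1)"
  using integral_bary_mult_homogeneous[OF assms, of "\<lambda>_. 1" 0]
    lmeasurable_compact[OF compact_simplex] by (simp add: lmeasure_integral add.commute)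

text \<open>
  A second coordinate is homogeneous of degree 1 about the vertex where the first one equals 1.
\<close>

lemma integral_bary_mult_bary:
  assumes "v \<in> C" "w \<in> C" "v \<noteq> w"
  shows "integral (convex hull C) (\<lambda>y. bary v y * bary w y) =
    measure lebesgue (convex hull C) / ((real DIM('a) + 1) * (real DIM('a) + 2))"
proof -
  have "integral (convex hull C) (\<lambda>y. bary v y * bary w y) = integral (convex hull C) (bary w) / real (DIM('a) + 1 + 1)"
    using assms by (intro integral_bary_mult_homogeneous bary_continuous)
      (auto simp: simplex_eq bary_affine bary_nodal)
  then show ?thesis using assms by (simp add: integral_bary add.commute)
qed

end

section \<open>Symmetric positive definite matrices and element averages\<close>

lemma integral_pos_continuous_compact:
  fixes f :: "'a::euclidean_space \<Rightarrow> real"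
  assumes K: "compact K" "continuous_on K f" and "interior K \<noteq> {}"
    and nonneg: "\<And>y. y \<in> K \<Longrightarrow> 0 \<le> f y" and pos: "\<And>y. y \<in> interior K \<Longrightarrow> 0 < f y"
  shows "0 < integral K f"
proof -
  obtain x where "x \<in> interior K" using assms by blast
  then obtain e where e: "0 < e" "cball x e \<subseteq> interior K"
    by (metis open_contains_cball open_interior)
  have sub: "cball x e \<subseteq> K" using e interior_subset by blast
  have cont: "continuous_on (cball x e) f" by (rule continuous_on_subset[OF K(2) sub])
  obtain z where z: "z \<in> cball x e" "\<And>y. y \<in> cball x e \<Longrightarrow> f z \<le> f y"
    using continuous_attains_inf[OF compact_cball _ cont] e by auto
  have "0 < f z * measure lebesgue (cball x e)"
    using z(1) e pos content_cball_pos[OF e(1), of x] by (auto simp: measure_completion)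
  also have "\<dots> = integral (cball x e) (\<lambda>_. f z * 1)"
    unfolding integral_mult_right using lmeasure_integral[OF lmeasurable_cball, of x e] by simp
  also have "\<dots> \<le> integral (cball x e) f"
    using z(2) by (intro integral_le integrable_on_continuous_compact compact_cball cont)
      (auto intro!: continuous_intros)
  also have "\<dots> \<le> integral K f"
    by (intro integral_subset_le integrable_on_continuous_compact compact_cball cont K sub)
       (auto intro: nonneg)
  finally show ?thesis .
qed

lemma sym_inner_mult_vec:
  assumes "Finite_Cartesian_Product.transpose M = (M :: real^'d^'d)"
  shows "u \<bullet> (M *v w) = w \<bullet> (M *v u)"
  by (metis assms dot_lmul_matrix inner_commute transpose_matrix_vector)

lemma sym_pos_def_commute: "sym_pos_def M \<Longrightarrow> u \<bullet> (M *v w) = w \<bullet> (M *v u)"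
  by (simp add: sym_pos_def_def sym_inner_mult_vec)

lemma sym_pos_def_pos: "sym_pos_def M \<Longrightarrow> v \<noteq> 0 \<Longrightarrow> 0 < v \<bullet> (M *v v)"
  by (simp add: sym_pos_def_def)

lemma sym_pos_def_nonneg: "sym_pos_def M \<Longrightarrow> 0 \<le> v \<bullet> (M *v v)"
  by (cases "v = 0") (auto simp: sym_pos_def_def less_imp_le)

lemma sym_pos_def_Cauchy_Schwarz:
  assumes M: "sym_pos_def M"
  shows "(u \<bullet> (M *v w))\<^sup>2 \<le> (u \<bullet> (M *v u)) * (w \<bullet> (M *v w))"
proof (cases "w = 0")
  case False
  let ?n = "w \<bullet> (M *v w)" and ?s = "u \<bullet> (M *v w)"
  have n: "0 < ?n" using M False by (rule sym_pos_def_pos)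
  have "0 \<le> (?n *\<^sub>R u - ?s *\<^sub>R w) \<bullet> (M *v (?n *\<^sub>R u - ?s *\<^sub>R w))"
    by (rule sym_pos_def_nonneg[OF M])
  also have "\<dots> = ?n * (?n * (u \<bullet> (M *v u)) - ?s\<^sup>2)"
    using sym_pos_def_commute[OF M, of w u]
    by (simp add: matrix_vector_mult_diff_distrib matrix_vector_mult_scaleR inner_diff power2_eq_square algebra_simps)
  finally show ?thesis using n by (simp add: zero_le_mult_iff mult.commute)
qed (simp add: matrix_vector_mult_0_right)

text \<open>
  The minimum of the quadratic form on the unit sphere is attained, and a minimiser is an eigenvector by
  the first order condition.  The minimum over the eigenvalues is meaningful because there are finitely
  many: eigenvectors of different eigenvalues are orthogonal.
\<close>

lemma lambda_min_Rayleigh: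
  fixes M :: "real^'d^'d"
  assumes M: "sym_pos_def M"
  shows "0 < lambda_min M" "lambda_min M * (v \<bullet> v) \<le> v \<bullet> (M *v v)"
proof -
  let ?f = "\<lambda>v. v \<bullet> (M *v v)"
  define E where "E = {l. \<exists>v. v \<noteq> 0 \<and> M *v v = l *\<^sub>R v}"
  have cont: "continuous_on (sphere 0 1) ?f"
    by (intro continuous_intros linear_continuous_on linear_linear[THEN iffD2] matrix_vector_mul_linear)
  have "sphere (0::real^'d) 1 \<noteq> {}" by simp
  from continuous_attains_inf[OF compact_sphere this cont]
  obtain u where u: "u \<in> sphere 0 1" "\<And>v. v \<in> sphere 0 1 \<Longrightarrow> ?f u \<le> ?f v"
    by blast
  define m where "m = ?f u"
  have uu: "u \<bullet> u = 1" "u \<noteq> 0" using u(1) by (auto simp: dot_square_norm)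
  have m: "0 < m" unfolding m_def using M uu by (intro sym_pos_def_pos)
  have bound: "m * (w \<bullet> w) \<le> ?f w" for w
  proof (cases "w = 0")
    case False
    then have "m \<le> ?f ((1 / norm w) *\<^sub>R w)" unfolding m_def by (intro u) simp
    also have "\<dots> = ?f w / (w \<bullet> w)"
      by (simp add: matrix_vector_mult_scaleR dot_square_norm power2_eq_square)
    finally show ?thesis using False by (simp add: le_divide_eq)
  qed simp
  have "w \<bullet> (M *v u - m *\<^sub>R u) = 0" for w
  proof (rule ccontr)
    define a where "a = w \<bullet> (M *v u - m *\<^sub>R u)"
    define b where "b = ?f w - m * (w \<bullet> w)"
    assume "w \<bullet> (M *v u - m *\<^sub>R u) \<noteq> 0"
    then have "a \<noteq> 0" by (simp add: a_def)
    have "0 \<le> b" using bound[of w] by (simp add: b_def)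
    \<comment> \<open>A negative value of the parabola \<open>2 t a + t\<^sup>2 b\<close>; the \<open>+ 1\<close> covers \<open>b = 0\<close>.\<close>
    define t where "t = - a / (b + 1)"
    have t: "a = - (t * (b + 1))" "t \<noteq> 0" using \<open>a \<noteq> 0\<close> \<open>0 \<le> b\<close> by (auto simp: t_def)
    have "0 \<le> ?f (u + t *\<^sub>R w) - m * ((u + t *\<^sub>R w) \<bullet> (u + t *\<^sub>R w))" using bound by simp
    also have "\<dots> = 2 * t * a + t\<^sup>2 * b"
      using sym_pos_def_commute[OF M, of w u] uu
      by (simp add: a_def b_def matrix_vector_right_distrib matrix_vector_mult_scaleR inner_add
        inner_diff_right inner_commute[of u w] power2_eq_square m_def[symmetric] algebra_simps)
    also have "\<dots> = - (t\<^sup>2 * (b + 2))"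
      unfolding t(1) by (simp add: power2_eq_square algebra_simps)
    also have "\<dots> < 0" using t(2) \<open>0 \<le> b\<close> by simp
    finally show False by simp
  qed
  then have "(M *v u - m *\<^sub>R u) \<bullet> (M *v u - m *\<^sub>R u) = 0" .
  then have "m \<in> E" using uu unfolding E_def by auto
  have le: "m \<le> l" if "l \<in> E" for l
  proof -
    from that have "\<exists>w. w \<noteq> 0 \<and> M *v w = l *\<^sub>R w" unfolding E_def by (rule CollectD)
    then obtain w where w: "w \<noteq> 0" "M *v w = l *\<^sub>R w" by (elim exE conjE)
    have "m * (w \<bullet> w) \<le> l * (w \<bullet> w)" using bound[of w] unfolding w(2) inner_scaleR_right .
    then show ?thesis using w(1) by (simp only: mult_le_cancel_right inner_gt_zero_iff) auto
  qed
  define e where "e l = (SOME v. v \<noteq> 0 \<and> M *v v = l *\<^sub>R v)" for l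
  have e: "e l \<noteq> 0 \<and> M *v e l = l *\<^sub>R e l" if "l \<in> E" for l
    unfolding e_def by (rule someI_ex) (use that in \<open>simp add: E_def\<close>)
  have orth: "e k \<bullet> e l = 0" if "k \<in> E" "l \<in> E" "k \<noteq> l" for k l
  proof -
    have "l * (e k \<bullet> e l) = k * (e k \<bullet> e l)"
      using sym_pos_def_commute[OF M, of "e k" "e l"] e[OF that(1)] e[OF that(2)]
      by (simp add: inner_commute)
    then show ?thesis using that by simp
  qed
  have "independent (e ` E)"
  proof (rule pairwise_orthogonal_independent)
    show "pairwise real_inner_class.orthogonal (e ` E)"
      using orth by (auto simp: pairwise_def real_inner_class.orthogonal_def)
    show "0 \<notin> e ` E" using e by force
  qed
  then have "finite (e ` E)" by (rule independent_imp_finite)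
  moreover have "inj_on e E"
  proof (rule inj_onI)
    fix k l assume kl: "k \<in> E" "l \<in> E" "e k = e l"
    then have "e k \<bullet> e l \<noteq> 0" using e[OF kl(1)] by simp
    then show "k = l" using orth[OF kl(1,2)] by blast
  qed
  ultimately have "finite E" using finite_imageD by blast
  then have "lambda_min M = m"
    unfolding lambda_min_def E_def[symmetric] using \<open>m \<in> E\<close> le by (intro Min_eqI) auto
  then show "0 < lambda_min M" "lambda_min M * (v \<bullet> v) \<le> v \<bullet> (M *v v)" using m bound by auto
qed

lemma bounded_linear_quadratic: "bounded_linear (\<lambda>M :: real^'d^'d. u \<bullet> (M *v w))"
  by (intro bounded_linear_compose[OF bounded_linear_inner_right] linear_linear[THEN iffD2])
     (auto intro!: linearI simp: matrix_vector_mult_add_rdistrib scaleR_matrix_vector_assoc)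

lemma elt_mean_inner:
  assumes "compact K" "continuous_on K D"
  shows "u \<bullet> (elt_mean D K *v w) = integral K (\<lambda>y. u \<bullet> (D y *v w)) / measure lebesgue K"
proof -
  have "integral K (\<lambda>y. u \<bullet> (D y *v w)) = u \<bullet> (integral K D *v w)"
    using integral_linear[OF integrable_on_continuous_compact[OF assms] bounded_linear_quadratic, of u w]
    by (simp add: o_def)
  then show ?thesis
    by (simp add: elt_mean_def scaleR_matrix_vector_assoc[symmetric])
qed

lemma matrix_eq_inner:
  fixes A B :: "real^'d^'d"
  assumes "\<And>u w. u \<bullet> (A *v w) = u \<bullet> (B *v w)"
  shows "A = B"
proof -
  have "A *v w = B *v w" for w
    using assms[of _ w] vector_eq_ldot[of "A *v w" "B *v w"] by blast
  then show ?thesis by (simp add: matrix_eq)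
qed

text \<open>
  On the boundary of the element the matrices may degenerate, so both symmetry and positivity are taken
  from the interior, which carries the whole measure.
\<close>

lemma sym_pos_def_elt_mean:
  fixes K :: "(real^'d) set" and D :: "real^'d \<Rightarrow> real^'d^'d"
  assumes K: "compact K" "continuous_on K D" "interior K \<noteq> {}" "convex K" "0 < measure lebesgue K"
    and D: "\<And>y. y \<in> interior K \<Longrightarrow> sym_pos_def (D y)"
  shows "sym_pos_def (elt_mean D K)"
proof -
  have spike: "integral K f = integral K g" if "\<And>y. y \<in> interior K \<Longrightarrow> f y = g y" for f g :: "real^'d \<Rightarrow> real"
  proof (rule integral_spike[OF negligible_convex_frontier[OF K(4)]])
    show "\<And>y. y \<in> K - frontier K \<Longrightarrow> g y = f y"
      using that closure_subset[of K] by (auto simp: frontier_def)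
  qed
  let ?M = "elt_mean D K"
  have sym: "u \<bullet> (?M *v w) = w \<bullet> (?M *v u)" for u w
    unfolding elt_mean_inner[OF K(1,2)]
    by (intro arg_cong2[where f="(/)"] spike refl) (simp add: D sym_pos_def_commute)
  have "Finite_Cartesian_Product.transpose ?M = ?M"
    by (rule matrix_eq_inner)
       (metis sym dot_lmul_matrix inner_commute transpose_matrix_vector)
  moreover have "0 < v \<bullet> (?M *v v)" if "v \<noteq> 0" for v
  proof -
    let ?f = "\<lambda>y. v \<bullet> (D y *v v)"
    have cont: "continuous_on K ?f"
      by (intro bounded_linear.continuous_on[OF bounded_linear_quadratic] K)
    have "0 \<le> ?f y" if "y \<in> K" for y
    proof (rule continuous_ge_on_closure[of "interior K" ?f])
      have "closure (interior K) = K"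
        using convex_closure_interior[OF K(4,3)] K(1) by (simp add: compact_imp_closed)
      then show "continuous_on (closure (interior K)) ?f" "y \<in> closure (interior K)"
        using cont that by auto
    qed (use D sym_pos_def_nonneg in blast)
    then have "0 < integral K ?f"
      using D sym_pos_def_pos that by (intro integral_pos_continuous_compact K cont) auto
    then show ?thesis using K(5) by (simp add: elt_mean_inner[OF K(1,2)])
  qed
  ultimately show ?thesis by (simp add: sym_pos_def_def)
qed

text \<open>
  The essential supremum is a real number: a continuous function is bounded on a compact set, and the
  supremum is nonnegative because the set has positive measure.
\<close>

lemma Linf_norm_bound:
  fixes f :: "real^'d \<Rightarrow> 'b::{real_normed_vector, second_countable_topology}"
  assumes K: "compact K" "continuous_on K f" and "0 < measure lebesgue K"
  shows "0 \<le> Linf_norm K f" "\<exists>N. negligible N \<and> (\<forall>y\<in>K - N. norm (f y) \<le> Linf_norm K f)"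
proof -
  let ?M = "lebesgue_on K" and ?f = "\<lambda>y. ereal (norm (f y))"
  have Kl: "K \<in> sets lebesgue" using K(1) by (simp add: lmeasurable_compact fmeasurableD)
  have "continuous_on K (\<lambda>y. norm (f y))" using K by (intro continuous_intros)
  then have meas: "?f \<in> borel_measurable ?M"
    by (intro borel_measurable_ereal continuous_imp_measurable_on_sets_lebesgue Kl)
  obtain B where B: "\<And>y. y \<in> K \<Longrightarrow> norm (f y) \<le> B"
    using continuous_on_compact_norm_bound[OF K] by blast
  have ub: "esssup ?M ?f \<le> ereal B"
    using B by (intro esssup_I meas AE_I2) (simp add: space_restrict_space)
  have "emeasure ?M (space ?M) \<noteq> 0"
    using assms(3) Kl by (auto simp: emeasure_restrict_space space_restrict_space measure_def)
  then have "esssup ?M (\<lambda>_. 0 :: ereal) = 0" by (rule esssup_const)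
  then have lb: "0 \<le> esssup ?M ?f"
    using esssup_mono[of "\<lambda>_. 0 :: ereal" ?M ?f] by simp
  have eq: "ereal (Linf_norm K f) = esssup ?M ?f"
    unfolding Linf_norm_def using ub lb by (intro ereal_real') auto
  show "0 \<le> Linf_norm K f" using eq lb by (metis ereal_less_eq(5))
  have "AE y in ?M. ?f y \<le> esssup ?M ?f" by (rule esssup_AE)
  then have "AE y in ?M. norm (f y) \<le> Linf_norm K f" unfolding eq[symmetric] by simp
  then have "AE y in lebesgue. y \<in> K \<longrightarrow> norm (f y) \<le> Linf_norm K f"
    using Kl by (simp add: AE_restrict_space_iff)
  then obtain N where "{y. \<not> (y \<in> K \<longrightarrow> norm (f y) \<le> Linf_norm K f)} \<subseteq> N" "N \<in> null_sets lebesgue"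
    by (auto elim!: AE_E simp: null_sets_def)
  then show "\<exists>N. negligible N \<and> (\<forall>y\<in>K - N. norm (f y) \<le> Linf_norm K f)"
    by (intro exI[of _ N]) (auto simp: negligible_iff_null_sets)
qed

section \<open>Triangles in the plane\<close>

lemma prod_Basis_cart:
  fixes f :: "real^'n \<Rightarrow> 'a::comm_monoid_mult"
  shows "prod f Basis = (\<Prod>i\<in>UNIV. f (axis i 1))"
proof -
  have b: "(Basis :: (real^'n) set) = (\<lambda>i. axis i 1) ` UNIV" by (auto simp: Basis_vec_def)
  have inj: "inj (\<lambda>i::'n. axis i (1::real))" by (auto simp: inj_def axis_eq_axis)
  show ?thesis unfolding b by (subst prod.reindex[OF inj]) (simp add: o_def)
qed

locale plane =
  fixes i j :: "'d::finite"
  assumes univ: "UNIV = {i, j}" and ij: "i \<noteq> j"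
begin

lemma sum_univ: "(\<Sum>k\<in>UNIV. f k) = f i + (f j :: real)"
  unfolding univ using ij by simp

lemma inner_plane: "(u::real^'d) \<bullet> w = u $ i * w $ i + u $ j * w $ j"
  by (simp add: inner_vec_def sum_univ)

lemma mult_vec_plane: "((M::real^'d^'d) *v w) $ k = M $ k $ i * w $ i + M $ k $ j * w $ j"
  by (simp add: matrix_vector_mult_def sum_univ)

lemma det_plane: "Determinants.det (M::real^'d^'d) = M $ i $ i * M $ j $ j - M $ i $ j * M $ j $ i"
proof -
  have "{p. p permutes (UNIV :: 'd set)} = {id, Transposition.transpose i j}"
    unfolding univ by (auto simp: permutes_doubleton_iff)
  moreover have "id \<noteq> Transposition.transpose i j" using ij by (metis id_apply transpose_apply_first)
  ultimately show ?thesis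
    using ij by (simp add: Determinants.det_def sign_swap_id sign_id univ)
qed

definition cross :: "real^'d \<Rightarrow> real^'d \<Rightarrow> real" where
  "cross u w = u $ i * w $ j - u $ j * w $ i"

lemma Binet_Cauchy: "cross a b * cross c d = (a \<bullet> c) * (b \<bullet> d) - (a \<bullet> d) * (b \<bullet> c)"
  by (simp add: cross_def inner_plane algebra_simps)

lemma Lagrange_identity: "(cross a b)\<^sup>2 = (a \<bullet> a) * (b \<bullet> b) - (a \<bullet> b)\<^sup>2"
  using Binet_Cauchy[of a b a b] by (simp add: power2_eq_square inner_commute)

text \<open>
  The Gram determinant of two vectors in the metric of \<open>M\<close>; it turns the cosine of an angle in this
  metric into its sine.
\<close>

lemma gram_determinant:
  assumes "Finite_Cartesian_Product.transpose M = (M::real^'d^'d)"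
  shows "(p \<bullet> (M *v p)) * (q \<bullet> (M *v q)) - (p \<bullet> (M *v q))\<^sup>2 = Determinants.det M * (cross p q)\<^sup>2"
proof -
  have "M $ j $ i = Finite_Cartesian_Product.transpose M $ i $ j"
    by (simp add: Finite_Cartesian_Product.transpose_def)
  then have "M $ j $ i = M $ i $ j" by (simp only: assms)
  then show ?thesis
    by (simp add: inner_plane mult_vec_plane det_plane cross_def power2_eq_square algebra_simps)
qed

definition to_R2 :: "real^'d \<Rightarrow> real^2" where
  "to_R2 u = (\<chi> k. if k = 1 then u $ i else u $ j)"

definition from_R2 :: "real^2 \<Rightarrow> real^'d" where
  "from_R2 u = (\<chi> k. if k = i then u $ 1 else u $ 2)"

lemma linear_to_R2: "linear to_R2"
  by (rule linearI) (auto simp: to_R2_def Finite_Cartesian_Product.vec_eq_iff)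

lemma from_to_R2: "from_R2 (to_R2 u) = u"
proof -
  have "k = i \<or> k = j" for k using univ by blast
  then show ?thesis using ij by (auto simp: from_R2_def to_R2_def Finite_Cartesian_Product.vec_eq_iff)
qed

lemma inj_to_R2: "inj to_R2"
  using from_to_R2 by (metis injI)

lemma all_coords: "(\<forall>k. P k) \<longleftrightarrow> P i \<and> P j"
proof -
  have "k = i \<or> k = j" for k using univ by blast
  then show ?thesis by metis
qed

lemma to_R2_measurable: "to_R2 \<in> borel_measurable borel"
  using linear_to_R2 by (intro borel_measurable_continuous_onI linear_continuous_on) (simp add: linear_linear)

text \<open>
  The change of coordinates permutes axes, so it maps boxes to boxes of equal volume.  It makes the
  area formula for triangles in \<open>\<real>\<^sup>2\<close> available for any index type with two elements.
\<close>

lemma lborel_to_R2: "(lborel :: (real^2) measure) = distr lborel borel to_R2"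
proof (rule lborel_eqI)
  fix l u :: "real^2" assume le: "\<And>b. b \<in> Basis \<Longrightarrow> l \<bullet> b \<le> u \<bullet> b"
  have le': "l $ k \<le> u $ k" for k using le[of "axis k 1"] by (simp add: inner_axis)
  have "to_R2 -` box l u = box (from_R2 l) (from_R2 u)"
    using ij by (auto simp: mem_box_cart all_coords forall_2 to_R2_def from_R2_def)
  then have "emeasure (distr lborel borel to_R2) (box l u) = emeasure lborel (box (from_R2 l) (from_R2 u))"
    using to_R2_measurable by (simp add: emeasure_distr)
  also have "\<dots> = (\<Prod>b\<in>Basis. (from_R2 u - from_R2 l) \<bullet> b)"
    using le' by (intro emeasure_lborel_box) (auto simp: Basis_vec_def inner_axis from_R2_def)
  also have "(\<Prod>b\<in>Basis. (from_R2 u - from_R2 l) \<bullet> b) = (\<Prod>b\<in>Basis. (u - l) \<bullet> b)"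
    unfolding prod_Basis_cart univ using ij by (simp add: inner_axis from_R2_def UNIV_2)
  finally show "emeasure (distr lborel borel to_R2) (box l u) = (\<Prod>b\<in>Basis. (u - l) \<bullet> b)" .
qed simp

lemma measure_triangle:
  "measure lebesgue (convex hull {u, v, w}) = \<bar>cross (u - w) (v - w)\<bar> / 2"
proof -
  let ?S = "convex hull {u, v, w}"
  have S: "?S \<in> sets borel" "to_R2 ` ?S \<in> sets borel"
    using compact_convex_hull[of "{u, v, w}"] compact_continuous_image[of ?S to_R2]
      linear_continuous_on[of to_R2 ?S] linear_to_R2
    by (auto simp: linear_linear intro: borel_compact)
  have "measure lebesgue ?S = measure lborel ?S" using S by (simp add: measure_completion)
  also have "\<dots> = measure lborel (to_R2 -` (to_R2 ` ?S) \<inter> space lborel)"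
    using inj_to_R2 by (simp add: inj_vimage_image_eq)
  also have "\<dots> = measure (distr lborel borel to_R2) (to_R2 ` ?S)"
    using S to_R2_measurable by (subst measure_distr) auto
  also have "\<dots> = measure lborel (to_R2 ` ?S)" using lborel_to_R2 by simp
  also have "to_R2 ` ?S = convex hull {to_R2 u, to_R2 v, to_R2 w}"
    using convex_hull_linear_image[OF linear_to_R2, of "{u, v, w}"] by simp
  also have "measure lborel \<dots> = \<bar>cross (u - w) (v - w)\<bar> / 2"
    unfolding content_triangle by (simp add: to_R2_def cross_def abs_if algebra_simps)
  finally show ?thesis .
qed

text \<open>
  Here \<open>g\<close>, \<open>h\<close> are the gradients of the barycentric coordinates at \<open>u\<close>, \<open>v\<close>.  They form the basis dual to the
  edge vectors, so that their cross product is the inverse of twice the area.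
\<close>

lemma triangle_nodal_gradients:
  assumes g: "g \<bullet> (u - w) = 1" "g \<bullet> (v - w) = 0" "h \<bullet> (u - w) = 0" "h \<bullet> (v - w) = 1"
  defines "area \<equiv> measure lebesgue (convex hull {u, v, w})"
  shows "2 * area * \<bar>cross g h\<bar> = 1" "2 * area * norm h = norm (u - w)" "2 * area \<le> norm (u - w) * norm (v - w)"
proof -
  have area: "2 * area = \<bar>cross (u - w) (v - w)\<bar>" unfolding area_def measure_triangle by simp
  have "cross g h * cross (u - w) (v - w) = 1" using g by (simp add: Binet_Cauchy)
  then show 1: "2 * area * \<bar>cross g h\<bar> = 1"
    unfolding area abs_mult[symmetric] by (simp add: mult.commute)
  have "(cross g h * cross h (u - w)) = - (h \<bullet> h)" using g by (simp add: Binet_Cauchy inner_commute)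
  then have "\<bar>cross g h\<bar> * \<bar>cross h (u - w)\<bar> = (norm h)\<^sup>2"
    unfolding abs_mult[symmetric] by (simp add: dot_square_norm)
  moreover have "\<bar>cross h (u - w)\<bar> = norm h * norm (u - w)"
  proof -
    have "(cross h (u - w))\<^sup>2 = (norm h * norm (u - w))\<^sup>2"
      unfolding Lagrange_identity g(3) by (simp add: dot_square_norm power_mult_distrib)
    then have "\<bar>cross h (u - w)\<bar>\<^sup>2 = (norm h * norm (u - w))\<^sup>2" by simp
    then show ?thesis by (rule power2_eq_imp_eq) simp_all
  qed
  moreover have "norm h \<noteq> 0" using g(4) by auto
  ultimately have h: "norm h = \<bar>cross g h\<bar> * norm (u - w)" by (simp add: power2_eq_square)
  then show "2 * area * norm h = norm (u - w)"
    unfolding h mult.assoc[symmetric] 1 by simp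
  have "\<bar>cross (u - w) (v - w)\<bar>\<^sup>2 \<le> (norm (u - w) * norm (v - w))\<^sup>2"
    unfolding power2_abs Lagrange_identity by (simp add: dot_square_norm power_mult_distrib)
  then have "\<bar>cross (u - w) (v - w)\<bar> \<le> norm (u - w) * norm (v - w)" by (rule power2_le_imp_le) simp
  then show "2 * area \<le> norm (u - w) * norm (v - w)" by (simp add: area)
qed

end

lemma (in plane) det_pos:
  assumes M: "sym_pos_def (M::real^'d^'d)"
  shows "0 < Determinants.det M"
proof -
  have "M $ j $ i = Finite_Cartesian_Product.transpose M $ i $ j"
    by (simp add: Finite_Cartesian_Product.transpose_def)
  then have sym: "M $ j $ i = M $ i $ j" using M by (simp only: sym_pos_def_def)
  have "0 < axis i 1 \<bullet> (M *v axis i 1)" using M by (rule sym_pos_def_pos) (simp add: axis_eq_0_iff)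
  then have pos: "0 < M $ i $ i" using ij by (simp add: inner_plane mult_vec_plane axis_def)
  \<comment> \<open>The form takes the value \<open>M $ i $ i * det M\<close> at this vector.\<close>
  define z :: "real^'d" where "z = (\<chi> k. if k = i then M $ i $ j else - M $ i $ i)"
  have z: "z $ i = M $ i $ j" "z $ j = - M $ i $ i" using ij by (auto simp: z_def)
  then have "z \<noteq> 0" using pos by (metis less_irrefl neg_equal_0_iff_equal zero_index)
  then have "0 < z \<bullet> (M *v z)" by (rule sym_pos_def_pos[OF M])
  also have "z \<bullet> (M *v z) = M $ i $ i * Determinants.det M"
    by (simp add: inner_plane mult_vec_plane det_plane z sym algebra_simps)
  finally show ?thesis using pos by (simp add: zero_less_mult_iff)
qed

section \<open>The inverse cotangent\<close>

lemma cot_strict_antimono: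
  assumes "0 < s" "s < t" "t < pi"
  shows "cot t < cot s"
proof -
  have "0 < sin s" "0 < sin t" "0 < sin (t - s)" using assms by (auto intro: sin_gt_zero)
  moreover have "cot s - cot t = sin (t - s) / (sin s * sin t)"
    using calculation by (simp add: cot_def sin_diff diff_frac_eq mult.commute)
  ultimately have "0 < cot s - cot t" by simp
  then show ?thesis by simp
qed

lemma arccot:
  shows "0 < arccot y" "arccot y < pi" "cot (arccot y) = y"
proof -
  have ex: "0 < pi / 2 - arctan y \<and> pi / 2 - arctan y < pi \<and> cot (pi / 2 - arctan y) = y"
  proof -
    have "cot (pi / 2 - arctan y) = tan (arctan y)" by (simp add: cot_def tan_def sin_diff cos_diff)
    moreover have "- (pi / 2) < arctan y \<and> arctan y < pi / 2" using arctan_bounded by blast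
    ultimately show ?thesis by (simp add: tan_arctan)
  qed
  have "0 < arccot y \<and> arccot y < pi \<and> cot (arccot y) = y"
    unfolding arccot_def
  proof (rule theI[where a="pi / 2 - arctan y"])
    show "0 < pi / 2 - arctan y \<and> pi / 2 - arctan y < pi \<and> cot (pi / 2 - arctan y) = y" by (rule ex)
    fix t assume t: "0 < t \<and> t < pi \<and> cot t = y"
    show "t = pi / 2 - arctan y"
      using t ex cot_strict_antimono[of t "pi / 2 - arctan y"] cot_strict_antimono[of "pi / 2 - arctan y" t]
      by (metis less_irrefl linorder_neqE_linordered_idom)
  qed
  then show "0 < arccot y" "arccot y < pi" "cot (arccot y) = y" by auto
qed

text \<open>
  Because \<open>arccot (- cot \<alpha>) = pi - \<alpha>\<close> and \<open>arccot\<close> is decreasing.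
\<close>

lemma arccot_ge_of_cot:
  assumes "0 < \<alpha>" "\<alpha> < pi" "y \<le> - cot \<alpha>"
  shows "pi - \<alpha> \<le> arccot y"
proof (rule ccontr)
  assume "\<not> pi - \<alpha> \<le> arccot y"
  then have "cot (pi - \<alpha>) < cot (arccot y)" using arccot[of y] assms by (intro cot_strict_antimono) auto
  moreover have "cot (pi - \<alpha>) = - cot \<alpha>" by (simp add: cot_def sin_diff cos_diff)
  ultimately show False using assms(3) by (simp add: arccot)
qed

text \<open>
  If the weighted cotangents had a sum of at most \<open>2 \<theta>\<close>, the two arguments of \<open>arccot\<close> would be at
  most \<open>- cot \<alpha>\<close> and \<open>- cot \<alpha>'\<close>, and the four angles would add up to at least \<open>2 pi\<close>.
\<close>

lemma delaunay_angles_imp_cot_bound: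
  assumes \<delta>: "0 < \<delta>" "0 < \<delta>'" and \<alpha>: "0 < \<alpha>" "\<alpha> < pi" "0 < \<alpha>'" "\<alpha>' < pi" and "0 \<le> \<theta>"
    and "\<alpha> + \<alpha>' + arccot (sqrt (\<delta>' / \<delta>) * cot \<alpha>' - 2 * \<theta> / sqrt \<delta>)
      + arccot (sqrt (\<delta> / \<delta>') * cot \<alpha> - 2 * \<theta> / sqrt \<delta>') < 2 * pi"
  shows "\<theta> < sqrt \<delta> * cot \<alpha> + sqrt \<delta>' * cot \<alpha>'"
proof (rule ccontr)
  assume "\<not> \<theta> < sqrt \<delta> * cot \<alpha> + sqrt \<delta>' * cot \<alpha>'"
  then have le: "sqrt \<delta> * cot \<alpha> + sqrt \<delta>' * cot \<alpha>' \<le> 2 * \<theta>" using \<open>0 \<le> \<theta>\<close> by simp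
  have s: "0 < sqrt \<delta>" "0 < sqrt \<delta>'" using \<delta> by auto
  have "sqrt (\<delta>' / \<delta>) * cot \<alpha>' - 2 * \<theta> / sqrt \<delta> \<le> - cot \<alpha>"
    using le s by (simp add: real_sqrt_divide field_simps)
  then have "pi - \<alpha> \<le> arccot (sqrt (\<delta>' / \<delta>) * cot \<alpha>' - 2 * \<theta> / sqrt \<delta>)" using \<alpha> by (intro arccot_ge_of_cot)
  moreover have "sqrt (\<delta> / \<delta>') * cot \<alpha> - 2 * \<theta> / sqrt \<delta>' \<le> - cot \<alpha>'"
    using le s by (simp add: real_sqrt_divide field_simps)
  then have "pi - \<alpha>' \<le> arccot (sqrt (\<delta> / \<delta>') * cot \<alpha> - 2 * \<theta> / sqrt \<delta>')" using \<alpha> by (intro arccot_ge_of_cot)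
  ultimately show False using assms(8) by simp
qed

section \<open>P1 basis functions on a conforming mesh\<close>

locale p1_mesh =
  fixes \<Omega> :: "(real^'d) set" and \<T> :: "(real^'d) set set"
    and N Nv :: nat and x :: "nat \<Rightarrow> real^'d" and \<phi> :: "nat \<Rightarrow> real^'d \<Rightarrow> real"
  assumes domain: "polyhedral_domain \<Omega>" and mesh: "simplicial_mesh \<Omega> \<T>"
    and ordering: "vertex_ordering \<Omega> \<T> N Nv x"
    and basis: "\<And>k. k < N \<Longrightarrow> P1_basis_function \<T> (x k) (\<phi> k)"
begin

lemma finite_mesh: "finite \<T>"
  using mesh by (simp add: simplicial_mesh_def triangulation_def)

lemma Union_mesh: "\<Union>\<T> = closure \<Omega>"
  using mesh by (simp add: simplicial_mesh_def)

lemma interior_closure_domain: "interior (closure \<Omega>) = \<Omega>"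
  using domain by (simp_all add: polyhedral_domain_def)

lemma open_domain: "open \<Omega>"
  using interior_closure_domain open_interior by metis

lemma frontier_domain: "frontier \<Omega> = closure \<Omega> - \<Omega>"
  using open_domain by (simp add: frontier_def interior_open)

lemma element_simplex:
  assumes "K \<in> \<T>"
  shows "\<not> affine_dependent (vertices_of K)" "card (vertices_of K) = Suc (CARD('d))"
    "K = convex hull (vertices_of K)"
proof -
  obtain C where C: "\<not> affine_dependent C" "int (card C) = int CARD('d) + 1" "K = convex hull C"
    using assms mesh unfolding simplicial_mesh_def simplex_def by blast
  have "vertices_of K = C"
    unfolding vertices_of_def C(3) using extreme_point_of_convex_hull_affine_independent[OF C(1)] by auto
  then show "\<not> affine_dependent (vertices_of K)" "card (vertices_of K) = Suc (CARD('d))"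
    "K = convex hull (vertices_of K)" using C by auto
qed

lemma finite_vertices: "K \<in> \<T> \<Longrightarrow> finite (vertices_of K)"
  using element_simplex(2) card.infinite by fastforce

lemma element_face: "K \<in> \<T> \<Longrightarrow> K' \<in> \<T> \<Longrightarrow> K \<inter> K' face_of K"
  using mesh by (simp add: simplicial_mesh_def triangulation_def)

lemma element_convex: "K \<in> \<T> \<Longrightarrow> convex K"
  using element_simplex(3) convex_convex_hull by metis

lemma element_compact: "K \<in> \<T> \<Longrightarrow> compact K"
  using element_simplex(3) finite_vertices finite_imp_compact_convex_hull by metis

lemma element_subset: "K \<in> \<T> \<Longrightarrow> K \<subseteq> closure \<Omega>"
  using Union_mesh by blast

lemma interior_element_subset: "K \<in> \<T> \<Longrightarrow> interior K \<subseteq> \<Omega>"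
  using interior_mono[OF element_subset] interior_closure_domain by blast

lemma compact_closure_domain: "compact (closure \<Omega>)"
  unfolding Union_mesh[symmetric] using finite_mesh element_compact by (intro compact_Union) auto

lemma vertex_in_element: "K \<in> \<T> \<Longrightarrow> v \<in> vertices_of K \<Longrightarrow> v \<in> K"
  by (simp add: vertices_of_def extreme_point_of_def)

text \<open>
  Conformity excludes hanging nodes: the intersection of two elements is a face of both, and extreme
  points pass from an element to its faces and back.
\<close>

lemma mesh_vertex_in_element:
  assumes "v \<in> mesh_vertices \<T>" "K \<in> \<T>" "v \<in> K"
  shows "v \<in> vertices_of K"
proof -
  obtain K' where K': "K' \<in> \<T>" "v \<in> vertices_of K'" using assms(1) by (auto simp: mesh_vertices_def)
  have "v extreme_point_of (K' \<inter> K)"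
    using K' assms(3) extreme_point_of_face[OF element_face[OF K'(1) assms(2)]]
    by (auto simp: vertices_of_def extreme_point_of_def)
  then show ?thesis
    using extreme_point_of_face[OF element_face[OF assms(2) K'(1)]]
    by (simp add: vertices_of_def Int_commute)
qed

text \<open>Barycentric coordinates are indexed by vertices, basis functions by their numbers.\<close>

definition idx :: "real^'d \<Rightarrow> nat" where "idx = inv_into {..<N} x"

text \<open>For an element of the mesh the coefficients are unique, since it has full dimension.\<close>

definition affine_coeffs :: "(real^'d) set \<Rightarrow> nat \<Rightarrow> (real^'d) \<times> real" where
  "affine_coeffs K k = (SOME p. \<forall>y\<in>K. \<phi> k y = fst p \<bullet> y + snd p)"

abbreviation G :: "(real^'d) set \<Rightarrow> nat \<Rightarrow> real^'d" where "G K k \<equiv> fst (affine_coeffs K k)"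
abbreviation B :: "(real^'d) set \<Rightarrow> nat \<Rightarrow> real" where "B K k \<equiv> snd (affine_coeffs K k)"

lemma phi_affine:
  assumes "K \<in> \<T>" "k < N" "y \<in> K"
  shows "\<phi> k y = G K k \<bullet> y + B K k"
proof -
  obtain a b where "\<forall>y\<in>K. \<phi> k y = a \<bullet> y + b"
    using basis[OF assms(2)] assms(1) unfolding P1_basis_function_def by blast
  then have "\<forall>y\<in>K. \<phi> k y = fst (a, b) \<bullet> y + snd (a, b)" by simp
  then have "\<forall>y\<in>K. \<phi> k y = fst (affine_coeffs K k) \<bullet> y + snd (affine_coeffs K k)"
    unfolding affine_coeffs_def by (rule someI)
  then show ?thesis using assms(3) by blast
qed

lemma vertices_bij: "bij_betw x {..<N} (mesh_vertices \<T>)"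
  using ordering by (simp add: vertex_ordering_def)

lemma Nv_le: "Nv \<le> N"
  using ordering by (simp add: vertex_ordering_def)

lemma idx: assumes "v \<in> mesh_vertices \<T>" shows "idx v < N" "x (idx v) = v"
proof -
  have "v \<in> x ` {..<N}" using assms vertices_bij by (simp add: bij_betw_def)
  then show "idx v < N" "x (idx v) = v"
    unfolding idx_def by (metis inv_into_into lessThan_iff, metis f_inv_into_f)
qed

lemma idx_x: "k < N \<Longrightarrow> idx (x k) = k"
  unfolding idx_def using vertices_bij by (simp add: bij_betw_def inv_into_f_f)

lemma x_vertex: "k < N \<Longrightarrow> x k \<in> mesh_vertices \<T>"
  using vertices_bij bij_betwE by blast

lemma x_inj: "j < N \<Longrightarrow> k < N \<Longrightarrow> x j = x k \<longleftrightarrow> j = k"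
  using idx_x by metis

lemma vertices_subset: "K \<in> \<T> \<Longrightarrow> v \<in> vertices_of K \<Longrightarrow> v \<in> mesh_vertices \<T>"
  by (auto simp: mesh_vertices_def)

lemma phi_nodal: "k < N \<Longrightarrow> w \<in> mesh_vertices \<T> \<Longrightarrow> \<phi> k w = (if w = x k then 1 else 0)"
  using basis by (simp add: P1_basis_function_def)

lemma phi_continuous: "k < N \<Longrightarrow> continuous_on (closure \<Omega>) (\<phi> k)"
  using basis Union_mesh by (simp add: P1_basis_function_def)

lemma barycentric_element:
  assumes K: "K \<in> \<T>"
  shows "barycentric (vertices_of K) (\<lambda>v. G K (idx v)) (\<lambda>v. B K (idx v))"
proof
  show "\<not> affine_dependent (vertices_of K)" "card (vertices_of K) = Suc DIM(real^'d)"
    using element_simplex[OF K] by simp_all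
  show "G K (idx v) \<bullet> w + B K (idx v) = (if w = v then 1 else 0)"
    if "v \<in> vertices_of K" "w \<in> vertices_of K" for v w
    using that phi_affine[OF K idx(1) vertex_in_element[OF K]] phi_nodal[OF idx(1)] vertices_subset[OF K] idx
    by metis
qed

text \<open>Named so that the coordinates of two different elements can be compared.\<close>

definition elt_bary :: "(real^'d) set \<Rightarrow> real^'d \<Rightarrow> real^'d \<Rightarrow> real" where
  "elt_bary K = barycentric.bary (\<lambda>v. G K (idx v)) (\<lambda>v. B K (idx v))"

lemma elt_bary_eq: "K \<in> \<T> \<Longrightarrow> elt_bary K v y = G K (idx v) \<bullet> y + B K (idx v)"
  unfolding elt_bary_def by (rule barycentric.bary_def[OF barycentric_element])

lemma phi_eq_elt_bary: "K \<in> \<T> \<Longrightarrow> k < N \<Longrightarrow> y \<in> K \<Longrightarrow> \<phi> k y = elt_bary K (x k) y"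
  by (simp add: elt_bary_eq idx_x phi_affine)

text \<open>
  An affine function that vanishes at all vertices of a simplex of full dimension vanishes identically.
\<close>

lemma phi_off_element:
  assumes K: "K \<in> \<T>" and k: "k < N" and "x k \<notin> vertices_of K"
  shows "G K k = 0" "y \<in> K \<Longrightarrow> \<phi> k y = 0"
proof -
  interpret barycentric "vertices_of K" "\<lambda>v. G K (idx v)" "\<lambda>v. B K (idx v)"
    by (rule barycentric_element[OF K])
  have "G K k \<bullet> v + B K k = 0" if "v \<in> vertices_of K" for v
    using phi_affine[OF K k vertex_in_element[OF K that]] phi_nodal[OF k vertices_subset[OF K that]] assms(3) that
    by metis
  then have zero: "G K k \<bullet> y + B K k = 0" for y
    using affine_function_expansion[of "G K k" y "B K k"] by simp
  from zero[of 0] zero[of "G K k"] show "G K k = 0" by simp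
  show "y \<in> K \<Longrightarrow> \<phi> k y = 0" using phi_affine[OF K k] zero by simp
qed

lemma phi_nonneg: assumes "k < N" "y \<in> closure \<Omega>" shows "0 \<le> \<phi> k y"
proof -
  obtain K where K: "K \<in> \<T>" "y \<in> K" using assms(2) Union_mesh by blast
  interpret barycentric "vertices_of K" "\<lambda>v. G K (idx v)" "\<lambda>v. B K (idx v)"
    by (rule barycentric_element[OF K(1)])
  show ?thesis
  proof (cases "x k \<in> vertices_of K")
    case True
    then show ?thesis using K simplex_eq element_simplex(3)[OF K(1)]
      by (simp add: phi_eq_elt_bary[OF K(1) assms(1) K(2)] elt_bary_def) blast
  qed (use phi_off_element(2)[OF K(1) assms(1) _ K(2)] in simp)
qed

lemma interior_vertex: assumes "k < Nv" shows "x k \<in> \<Omega>"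
proof -
  have k: "k < N" "x k \<notin> frontier \<Omega>" using assms ordering Nv_le unfolding vertex_ordering_def by (auto dest: less_le_trans)
  obtain K where "K \<in> \<T>" "x k \<in> vertices_of K" using x_vertex[OF k(1)] by (auto simp: mesh_vertices_def)
  then have "x k \<in> closure \<Omega>" using vertex_in_element element_subset by blast
  then show ?thesis using k(2) frontier_domain by simp
qed

text \<open>
  Let \<open>v\<close> be the interior vertex.  Contract a neighbourhood of \<open>y\<close> towards \<open>v\<close> until it lies in a small ball
  around \<open>v\<close> that is covered by elements containing \<open>v\<close>.  The contraction \<open>p z\<close> of a point \<open>z\<close> near \<open>y\<close>
  lies in such an element, in the part cut off near \<open>v\<close> because the basis function is continuous and
  large at \<open>p y\<close>.  Dilating back, \<open>z\<close> belongs to the same element.  So \<open>y\<close> is interior to the closure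
  of the domain, which is to say that it is in the domain.
\<close>

lemma basis_support_interior:
  assumes k: "k < Nv" and y: "y \<in> closure \<Omega>" "0 < \<phi> k y"
  shows "y \<in> \<Omega>"
proof -
  have kN: "k < N" using k Nv_le by simp
  define v where "v = x k"
  obtain K0 where K0: "K0 \<in> \<T>" "y \<in> K0" using y(1) Union_mesh by blast
  have v0: "v \<in> vertices_of K0" using phi_off_element(2)[OF K0(1) kN _ K0(2)] y(2) v_def by force
  have vm: "v \<in> mesh_vertices \<T>" using x_vertex[OF kN] by (simp add: v_def)
  have "open (\<Omega> - \<Union>{K\<in>\<T>. v \<notin> K})"
    using finite_mesh element_compact by (intro open_Diff open_domain closed_Union) (auto intro: compact_imp_closed)
  moreover have "v \<in> \<Omega> - \<Union>{K\<in>\<T>. v \<notin> K}" using interior_vertex[OF k] by (auto simp: v_def)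
  ultimately obtain r where r: "0 < r" "ball v r \<subseteq> \<Omega> - \<Union>{K\<in>\<T>. v \<notin> K}"
    by (rule openE)
  define R where "R = norm (y - v) + 1"
  \<comment> \<open>The contraction factor: it moves the unit ball around \<open>y\<close> into the ball of radius \<open>r\<close>.\<close>
  define e where "e = min (1/2) (r / (2 * R))"
  have R: "0 < R" unfolding R_def by (simp add: add_nonneg_pos)
  have e: "0 < e" "e \<le> 1" "e < 1" "e * R < r"
  proof -
    show "0 < e" "e \<le> 1" "e < 1" using r(1) R by (auto simp: e_def)
    have "e * R \<le> r / (2 * R) * R" using R by (intro mult_right_mono) (auto simp: e_def)
    then show "e * R < r" using R r(1) by simp
  qed
  define p where "p z = v + e *\<^sub>R (z - v)" for z
  have pball: "p z \<in> ball v r" if "z \<in> ball y 1" for z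
  proof -
    have "norm (z - v) \<le> R"
      using that norm_triangle_ineq[of "z - y" "y - v"] by (simp add: R_def dist_norm norm_minus_commute)
    then have "e * norm (z - v) \<le> e * R" using e(1) by simp
    then have "e * norm (z - v) < r" using e(4) by linarith
    then show ?thesis using e(1) by (simp add: p_def dist_norm)
  qed
  have py: "p y = (1 - e) *\<^sub>R v + e *\<^sub>R y" by (simp add: p_def algebra_simps)
  have pyK0: "p y \<in> K0"
    unfolding py using e K0 vertex_in_element[OF K0(1) v0] by (intro convexD element_convex) auto
  have "\<phi> k (p y) = 1 - e + e * \<phi> k y"
  proof -
    have "\<phi> k (p y) = (1 - e) * \<phi> k v + e * \<phi> k y"
      unfolding phi_affine[OF K0(1) kN pyK0] phi_affine[OF K0(1) kN K0(2)]
        phi_affine[OF K0(1) kN vertex_in_element[OF K0(1) v0]]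
      by (simp add: p_def algebra_simps)
    then show ?thesis using phi_nodal[OF kN vm] by (simp add: v_def)
  qed
  then have big: "1 - e < \<phi> k (p y)" using e y(2) by simp
  define W where "W = ball y 1 \<inter> p -` {q\<in>\<Omega>. 1 - e < \<phi> k q}"
  have "open {q\<in>\<Omega>. 1 - e < \<phi> k q}"
  proof -
    have "continuous_on \<Omega> (\<phi> k)" by (rule continuous_on_subset[OF phi_continuous[OF kN] closure_subset])
    then have "open (\<phi> k -` {1 - e<..} \<inter> \<Omega>)" using open_domain by (intro continuous_on_open_vimage[THEN iffD1, rule_format]) auto
    moreover have "\<phi> k -` {1 - e<..} \<inter> \<Omega> = {q\<in>\<Omega>. 1 - e < \<phi> k q}" by auto
    ultimately show ?thesis by simp
  qed
  then have "open W"
    unfolding W_def p_def by (intro open_Int open_ball open_vimage) (auto intro!: continuous_intros)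
  moreover have "y \<in> W" using big pball[of y] r(2) by (auto simp: W_def)
  moreover have "W \<subseteq> closure \<Omega>"
  proof
    fix z assume "z \<in> W"
    then have z: "z \<in> ball y 1" "p z \<in> \<Omega>" "1 - e < \<phi> k (p z)" by (auto simp: W_def)
    then obtain K where K: "K \<in> \<T>" "p z \<in> K" using Union_mesh closure_subset by blast
    have "v \<in> K" using pball[OF z(1)] r(2) K by blast
    then have vK: "v \<in> vertices_of K" using mesh_vertex_in_element vm K by blast
    interpret barycentric "vertices_of K" "\<lambda>v. G K (idx v)" "\<lambda>v. B K (idx v)"
      by (rule barycentric_element[OF K(1)])
    have "1 - e \<le> bary v (p z)"
      using z(3) phi_eq_elt_bary[OF K(1) kN K(2)] by (simp add: elt_bary_def v_def)
    then have "z \<in> K"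
      using homothety_in_simplex[OF vK e(1,2), of z] K(2) element_simplex(3)[OF K(1)] by (simp add: p_def)
    then show "z \<in> closure \<Omega>" using element_subset[OF K(1)] by blast
  qed
  ultimately have "y \<in> interior (closure \<Omega>)" by (rule interiorI)
  then show ?thesis using interior_closure_domain by simp
qed

lemma phi_frontier: "k < Nv \<Longrightarrow> y \<in> frontier \<Omega> \<Longrightarrow> \<phi> k y = 0"
  using basis_support_interior[of k y] phi_nonneg[of k y] Nv_le frontier_domain by force

lemma interior_element_nonempty: "K \<in> \<T> \<Longrightarrow> interior K \<noteq> {}"
  using barycentric.interior_simplex_nonempty[OF barycentric_element] element_simplex(3) by metis

lemma measure_element_pos: "K \<in> \<T> \<Longrightarrow> 0 < measure lebesgue K"
  using barycentric.measure_simplex_pos[OF barycentric_element] element_simplex(3) by metis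

text \<open>
  A face that contains a relative interior point is the whole element.
\<close>

lemma interior_elements_disjoint:
  assumes "K \<in> \<T>" "K' \<in> \<T>" "z \<in> interior K" "z \<in> interior K'"
  shows "K = K'"
proof -
  have "K \<subseteq> K'" if "K \<in> \<T>" "K' \<in> \<T>" "z \<in> interior K" "z \<in> interior K'" for K K'
  proof -
    have "z \<in> rel_interior K"
      using that by (metis rel_interior_interior interior_rel_interior_gen empty_iff)
    moreover have "z \<in> K \<inter> K'" using that interior_subset by blast
    ultimately have "K \<inter> K' = K"
      using face_of_disjoint_rel_interior[OF element_face[OF that(1,2)]] by blast
    then show ?thesis by blast
  qed
  then show ?thesis using assms by blast
qed

lemma gradient_phi:
  assumes K: "K \<in> \<T>" and k: "k < N" and y: "y \<in> interior K"
  shows "gradient (\<phi> k) y = G K k"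
proof -
  have "((\<lambda>y. G K k \<bullet> y + B K k) has_derivative (\<lambda>h. G K k \<bullet> h)) (at y)"
    by (auto intro!: derivative_eq_intros)
  then have "(\<phi> k has_derivative (\<lambda>h. G K k \<bullet> h)) (at y)"
  proof (rule has_derivative_transform_within_open[OF _ open_interior y])
    show "\<And>z. z \<in> interior K \<Longrightarrow> G K k \<bullet> z + B K k = \<phi> k z"
      using phi_affine[OF K k] interior_subset by fastforce
  qed
  then have *: "GDERIV (\<phi> k) y :> G K k"
    by (simp add: gderiv_def inner_commute)
  show ?thesis unfolding gradient_def
  proof (rule the_equality)
    show "GDERIV (\<phi> k) y :> G K k" by (rule *)
  next
    fix g assume "GDERIV (\<phi> k) y :> g"
    then have "(\<lambda>h. h \<bullet> g) = (\<lambda>h. h \<bullet> G K k)"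
      using * unfolding gderiv_def by (rule has_derivative_unique)
    then show "g = G K k" by (metis vector_eq_ldot)
  qed
qed

end

section \<open>Entries and quadratic form of the stiffness matrix\<close>

lemma divergence_trace:
  assumes "(f has_derivative blinfun_apply F) (at y)"
  shows "divergence f y = (\<Sum>i\<in>UNIV. blinfun_apply F (axis i 1) $ i)"
proof -
  have "frechet_derivative f (at y) = blinfun_apply F"
    using frechet_derivative_at[OF assms] by simp
  then show ?thesis
    by (simp add: divergence_def jacobian_def Determinants.trace_def matrix_def)
qed

lemma integral_le_off_negligible:
  fixes f h :: "'a::euclidean_space \<Rightarrow> real"
  assumes "negligible N" "f integrable_on S" "h integrable_on S"
    and le: "\<And>y. y \<in> S - N \<Longrightarrow> f y \<le> h y"
  shows "integral S f \<le> integral S h"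
proof -
  let ?h = "\<lambda>y. if y \<in> N then f y else h y"
  have "integral S f \<le> integral S ?h"
    using assms integrable_spike[OF assms(3,1), of ?h] by (intro integral_le) auto
  also have "\<dots> = integral S h" by (rule integral_spike[OF assms(1)]) simp
  finally show ?thesis .
qed

locale p1_problem = p1_mesh \<Omega> \<T> N Nv x \<phi>
  for \<Omega> :: "(real^'d) set" and \<T> N Nv x \<phi> +
  fixes D :: "real^'d \<Rightarrow> real^'d^'d" and b :: "real^'d \<Rightarrow> real^'d" and c :: "real^'d \<Rightarrow> real"
  assumes D_continuous: "continuous_on (closure \<Omega>) D" and b_C1: "C1_upto_boundary \<Omega> b"
    and c_continuous: "continuous_on (closure \<Omega>) c"
    and D_pos: "\<And>y. y \<in> \<Omega> \<Longrightarrow> sym_pos_def (D y)"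
    and coercive: "\<And>y. y \<in> \<Omega> \<Longrightarrow> 0 \<le> c y - 1 / 2 * divergence b y"
begin

lemma b_continuous: "continuous_on (closure \<Omega>) b"
  using b_C1 unfolding C1_upto_boundary_def by (rule conjunct1)

lemma elt_mean_pos: assumes K: "K \<in> \<T>" shows "sym_pos_def (elt_mean D K)"
  using interior_element_subset[OF K] D_pos
  by (intro sym_pos_def_elt_mean element_compact interior_element_nonempty element_convex measure_element_pos
      continuous_on_subset[OF D_continuous element_subset] K) auto

text \<open>
  The integrand of the stiffness matrix, with the gradients replaced by their constant values in the
  interior of the element.
\<close>

definition integrand :: "(real^'d) set \<Rightarrow> nat \<Rightarrow> nat \<Rightarrow> real^'d \<Rightarrow> real" where
  "integrand K j k y = G K j \<bullet> (elt_mean D K *v G K k) + \<phi> j y * (b y \<bullet> G K k) + c y * \<phi> j y * \<phi> k y"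

lemma element_continuous:
  assumes "K \<in> \<T>"
  shows "continuous_on K b" "continuous_on K c" "k < N \<Longrightarrow> continuous_on K (\<phi> k)"
  using continuous_on_subset[OF _ element_subset[OF assms]] b_continuous c_continuous phi_continuous by auto

lemma stiffness_entry:
  assumes "j < Nv" "k < Nv"
  shows "stiffness_matrix \<T> D b c Nv \<phi> $$ (j, k) = (\<Sum>K\<in>\<T>. integral K (integrand K j k))"
proof -
  have jk: "j < N" "k < N" using assms Nv_le by auto
  have "integral K (\<lambda>y. gradient (\<phi> j) y \<bullet> (elt_mean D K *v gradient (\<phi> k) y) +
         \<phi> j y * (b y \<bullet> gradient (\<phi> k) y) + c y * \<phi> j y * \<phi> k y) = integral K (integrand K j k)"
    if K: "K \<in> \<T>" for K
  proof (rule integral_spike[OF negligible_convex_frontier[OF element_convex[OF K]]])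
    fix y assume "y \<in> K - frontier K"
    then have y: "y \<in> interior K" using closure_subset[of K] by (auto simp: frontier_def)
    show "integrand K j k y = gradient (\<phi> j) y \<bullet> (elt_mean D K *v gradient (\<phi> k) y) +
         \<phi> j y * (b y \<bullet> gradient (\<phi> k) y) + c y * \<phi> j y * \<phi> k y"
      by (simp add: integrand_def gradient_phi[OF K jk(1) y] gradient_phi[OF K jk(2) y])
  qed
  then show ?thesis using assms by (simp add: stiffness_matrix_def)
qed

lemma integrand_off_element:
  assumes "K \<in> \<T>" "j < N" "k < N" "x j \<notin> vertices_of K \<or> x k \<notin> vertices_of K"
  shows "integral K (integrand K j k) = 0"
proof -
  have "integrand K j k y = 0" if "y \<in> K" for y
    using assms phi_off_element[OF assms(1)] that by (auto simp: integrand_def)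
  then have "integral K (integrand K j k) = integral K (\<lambda>_. 0)" by (rule Henstock_Kurzweil_Integration.integral_cong)
  then show ?thesis by simp
qed

text \<open>
  Pointwise bounds on \<open>b\<close> and \<open>c\<close> off a null set, and the exact integrals of the nonnegative functions
  \<open>\<phi> j\<close> and \<open>\<phi> j * \<phi> k\<close>.
\<close>

lemma element_contribution_bound:
  assumes K: "K \<in> \<T>" and jk: "j < N" "k < N" "j \<noteq> k" and verts: "x j \<in> vertices_of K" "x k \<in> vertices_of K"
  shows "integral K (integrand K j k) \<le> measure lebesgue K *
     (G K j \<bullet> (elt_mean D K *v G K k) + Linf_norm K b * norm (G K k) / (real CARD('d) + 1)
      + Linf_norm K c / ((real CARD('d) + 1) * (real CARD('d) + 2)))"
proof -
  interpret barycentric "vertices_of K" "\<lambda>v. G K (idx v)" "\<lambda>v. B K (idx v)"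
    by (rule barycentric_element[OF K])
  let ?a = "G K j \<bullet> (elt_mean D K *v G K k)"
  let ?n = "norm (G K k)"
  have phi: "\<phi> i y = bary (x i) y" if "y \<in> K" "i < N" for y i
    using phi_eq_elt_bary[OF K that(2,1)] by (simp add: elt_bary_def)
  have hull: "convex hull (vertices_of K) = K" using element_simplex(3)[OF K] by simp
  have nonneg: "0 \<le> \<phi> i y" if "y \<in> K" "i < N" for y i
    using phi_nonneg[OF that(2)] element_subset[OF K] that(1) by blast
  obtain N1 where N1: "negligible N1" "\<And>y. y \<in> K - N1 \<Longrightarrow> norm (b y) \<le> Linf_norm K b"
    using Linf_norm_bound(2)[OF element_compact[OF K] element_continuous(1)[OF K] measure_element_pos[OF K]] by blast
  obtain N2 where N2: "negligible N2" "\<And>y. y \<in> K - N2 \<Longrightarrow> norm (c y) \<le> Linf_norm K c"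
    using Linf_norm_bound(2)[OF element_compact[OF K] element_continuous(2)[OF K] measure_element_pos[OF K]] by blast
  let ?h = "\<lambda>y. ?a + (Linf_norm K b * ?n) * \<phi> j y + Linf_norm K c * (\<phi> j y * \<phi> k y)"
  have "integral K (integrand K j k) \<le> integral K ?h"
  proof (rule integral_le_off_negligible)
    show "integrand K j k integrable_on K" "?h integrable_on K"
      unfolding integrand_def
      by (intro integrable_on_continuous_compact element_compact K continuous_intros element_continuous jk)+
    show "negligible (N1 \<union> N2)" using N1 N2 by simp
    fix y assume y: "y \<in> K - (N1 \<union> N2)"
    have "\<bar>b y \<bullet> G K k\<bar> \<le> Linf_norm K b * ?n"
      using Cauchy_Schwarz_ineq2[of "b y" "G K k"] N1(2)[of y] y mult_right_mono[of "norm (b y)" "Linf_norm K b" ?n]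
      by auto
    then have "\<phi> j y * (b y \<bullet> G K k) \<le> \<phi> j y * (Linf_norm K b * ?n)"
      using nonneg[of y j] y jk by (intro mult_left_mono) auto
    moreover have "c y * (\<phi> j y * \<phi> k y) \<le> Linf_norm K c * (\<phi> j y * \<phi> k y)"
      using nonneg[of y j] nonneg[of y k] N2(2)[of y] y jk by (intro mult_right_mono) auto
    ultimately show "integrand K j k y \<le> ?h y" by (simp add: integrand_def mult.commute mult.left_commute)
  qed
  also have "integral K ?h = ?a * measure lebesgue K + (Linf_norm K b * ?n) * integral K (\<phi> j)
      + Linf_norm K c * integral K (\<lambda>y. \<phi> j y * \<phi> k y)"
  proof -
    have i: "(\<lambda>y. ?a * 1) integrable_on K" "(\<lambda>y. (Linf_norm K b * ?n) * \<phi> j y) integrable_on K"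
      "(\<lambda>y. Linf_norm K c * (\<phi> j y * \<phi> k y)) integrable_on K"
      by (intro integrable_on_continuous_compact element_compact K continuous_intros element_continuous jk)+
    have "integral K ?h = integral K (\<lambda>y. ?a * 1) + integral K (\<lambda>y. (Linf_norm K b * ?n) * \<phi> j y)
       + integral K (\<lambda>y. Linf_norm K c * (\<phi> j y * \<phi> k y))"
      using Henstock_Kurzweil_Integration.integral_add[OF i(1,2)]
        Henstock_Kurzweil_Integration.integral_add[OF integrable_add[OF i(1,2)] i(3)] by simp
    then show ?thesis
      unfolding integral_mult_right
      by (simp add: lmeasure_integral[OF lmeasurable_compact[OF element_compact[OF K]], symmetric])
  qed
  also have "integral K (\<phi> j) = measure lebesgue K / (real CARD('d) + 1)"
  proof -
    have "integral K (\<phi> j) = integral K (bary (x j))"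
      by (intro Henstock_Kurzweil_Integration.integral_cong phi jk)
    then show ?thesis using integral_bary[OF verts(1)] by (simp add: hull)
  qed
  also have "integral K (\<lambda>y. \<phi> j y * \<phi> k y) = measure lebesgue K / ((real CARD('d) + 1) * (real CARD('d) + 2))"
  proof -
    have "integral K (\<lambda>y. \<phi> j y * \<phi> k y) = integral K (\<lambda>y. bary (x j) y * bary (x k) y)"
      by (intro Henstock_Kurzweil_Integration.integral_cong) (simp add: phi jk)
    moreover have "x j \<noteq> x k" using x_inj[OF jk(1,2)] jk(3) by simp
    ultimately show ?thesis using integral_bary_mult_bary[OF verts] hull by (simp add: add.commute mult.commute)
  qed
  finally show ?thesis by (simp add: algebra_simps)
qed

text \<open>
  A general function of the finite element space, extended by zero to the whole space so that it can be
  translated.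
\<close>

definition combination :: "(nat \<Rightarrow> real) \<Rightarrow> real^'d \<Rightarrow> real" where
  "combination v y = (if y \<in> closure \<Omega> then \<Sum>k<Nv. v k * \<phi> k y else 0)"

definition combination_grad :: "(nat \<Rightarrow> real) \<Rightarrow> (real^'d) set \<Rightarrow> real^'d" where
  "combination_grad v K = (\<Sum>k<Nv. v k *\<^sub>R G K k)"

definition combination_const :: "(nat \<Rightarrow> real) \<Rightarrow> (real^'d) set \<Rightarrow> real" where
  "combination_const v K = (\<Sum>k<Nv. v k * B K k)"

lemma combination_affine:
  assumes "K \<in> \<T>" "y \<in> K"
  shows "combination v y = combination_grad v K \<bullet> y + combination_const v K"
proof -
  have "y \<in> closure \<Omega>" using element_subset assms by blast
  moreover have "v k * \<phi> k y = v k *\<^sub>R G K k \<bullet> y + v k * B K k" if "k < Nv" for k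
    using phi_affine[OF assms(1) _ assms(2), of k] that Nv_le by (simp add: distrib_left)
  ultimately show ?thesis
    by (simp add: combination_def combination_grad_def combination_const_def inner_sum_left sum.distrib)
qed

lemma combination_outside: "y \<notin> \<Omega> \<Longrightarrow> combination v y = 0"
  using phi_frontier[of _ y] by (auto simp: combination_def frontier_domain)

lemma combination_continuous: "K \<in> \<T> \<Longrightarrow> continuous_on K (combination v)"
  by (subst continuous_on_cong[OF refl combination_affine[of K]]) (auto intro!: continuous_intros)

text \<open>
  With vanishing gradients the extension by zero is 0-Lipschitz on every element and on the complement
  of the domain, hence constant on the whole space, and it is zero outside.
\<close>

lemma combination_zero_of_zero_gradients:
  assumes "\<And>K. K \<in> \<T> \<Longrightarrow> combination_grad v K = 0" and "k < Nv"
  shows "v k = 0"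
proof -
  have "0-lipschitz_on UNIV (combination v)"
  proof (rule lipschitz_on_closed_pieces[of "insert (- \<Omega>) \<T>"])
    fix S assume "S \<in> insert (- \<Omega>) \<T>"
    then show "0-lipschitz_on S (combination v)"
      by (intro lipschitz_onI) (auto simp: combination_outside combination_affine assms(1))
    show "closed S" using \<open>S \<in> _\<close> open_domain element_compact compact_imp_closed by auto
  next
    show "\<Union> (insert (- \<Omega>) \<T>) = UNIV" using Union_mesh closure_subset by auto
  qed (use finite_mesh in auto)
  moreover obtain z where "z \<notin> \<Omega>"
    using compact_imp_bounded[OF compact_closure_domain] closure_subset not_bounded_UNIV bounded_subset
    by (metis UNIV_eq_I)
  ultimately have "combination v (x k) = 0"
    using lipschitz_onD[of 0 UNIV "combination v" "x k" z] combination_outside[of z] by simp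
  moreover have "combination v (x k) = v k"
  proof -
    have "(\<Sum>l<Nv. v l * \<phi> l (x k)) = (\<Sum>l<Nv. if l = k then v l else 0)"
      using phi_nodal[OF _ x_vertex] x_inj assms(2) Nv_le by (intro sum.cong) auto
    then show ?thesis
      using interior_vertex[OF assms(2)] closure_subset assms(2) by (auto simp: combination_def)
  qed
  ultimately show ?thesis by simp
qed

definition form_integrand :: "(nat \<Rightarrow> real) \<Rightarrow> (real^'d) set \<Rightarrow> real^'d \<Rightarrow> real" where
  "form_integrand v K y = combination_grad v K \<bullet> (elt_mean D K *v combination_grad v K) +
     combination v y * (b y \<bullet> combination_grad v K) + c y * (combination v y)\<^sup>2"

lemma quadratic_form:
  "(\<Sum>j<Nv. \<Sum>k<Nv. v j * stiffness_matrix \<T> D b c Nv \<phi> $$ (j, k) * v k) =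
     (\<Sum>K\<in>\<T>. integral K (form_integrand v K))"
proof -
  have elt: "(\<Sum>j<Nv. \<Sum>k<Nv. (v j * v k) * integral K (integrand K j k)) = integral K (form_integrand v K)"
    if K: "K \<in> \<T>" for K
  proof -
    have int: "(\<lambda>y. (v j * v k) * integrand K j k y) integrable_on K" if "j < Nv" "k < Nv" for j k
      unfolding integrand_def using that Nv_le
      by (intro integrable_on_continuous_compact element_compact K continuous_intros element_continuous) auto
    have "(\<Sum>j<Nv. \<Sum>k<Nv. (v j * v k) * integral K (integrand K j k)) =
        integral K (\<lambda>y. \<Sum>j<Nv. \<Sum>k<Nv. (v j * v k) * integrand K j k y)"
    proof -
      have "(\<Sum>k<Nv. (v j * v k) * integral K (integrand K j k)) =
          integral K (\<lambda>y. \<Sum>k<Nv. (v j * v k) * integrand K j k y)" if "j < Nv" for j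
        using int[OF that] by (subst integral_sum) auto
      moreover have "(\<Sum>j<Nv. integral K (\<lambda>y. \<Sum>k<Nv. (v j * v k) * integrand K j k y)) =
          integral K (\<lambda>y. \<Sum>j<Nv. \<Sum>k<Nv. (v j * v k) * integrand K j k y)"
        using int by (intro integral_sum[symmetric] integrable_sum) auto
      ultimately show ?thesis by simp
    qed
    also have "\<dots> = integral K (form_integrand v K)"
    proof (rule Henstock_Kurzweil_Integration.integral_cong)
      fix y assume "y \<in> K"
      then have y: "combination v y = (\<Sum>k<Nv. v k * \<phi> k y)"
        using element_subset[OF K] by (auto simp: combination_def)
      show "(\<Sum>j<Nv. \<Sum>k<Nv. (v j * v k) * integrand K j k y) = form_integrand v K y"
      proof -
        have 1: "combination_grad v K \<bullet> (elt_mean D K *v combination_grad v K) =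
            (\<Sum>j<Nv. \<Sum>k<Nv. (v j * v k) * (G K j \<bullet> (elt_mean D K *v G K k)))"
        proof -
          have "w \<bullet> (elt_mean D K *v combination_grad v K) = (\<Sum>k<Nv. v k * (w \<bullet> (elt_mean D K *v G K k)))" for w
            by (simp add: combination_grad_def linear_sum[OF matrix_vector_mul_linear] inner_sum_right
                matrix_vector_mult_scaleR)
          then have "combination_grad v K \<bullet> (elt_mean D K *v combination_grad v K) =
              (\<Sum>k<Nv. v k * (\<Sum>j<Nv. v j * (G K j \<bullet> (elt_mean D K *v G K k))))"
            by (simp add: combination_grad_def inner_sum_left)
          also have "\<dots> = (\<Sum>k<Nv. \<Sum>j<Nv. (v j * v k) * (G K j \<bullet> (elt_mean D K *v G K k)))"
            by (simp add: sum_distrib_left mult_ac)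
          also have "\<dots> = (\<Sum>j<Nv. \<Sum>k<Nv. (v j * v k) * (G K j \<bullet> (elt_mean D K *v G K k)))"
            by (rule sum.swap)
          finally show ?thesis .
        qed
        have 2: "combination v y * (b y \<bullet> combination_grad v K) =
            (\<Sum>j<Nv. \<Sum>k<Nv. (v j * v k) * (\<phi> j y * (b y \<bullet> G K k)))"
          by (simp add: y combination_grad_def inner_sum_right sum_product mult_ac)
        have 3: "c y * (combination v y)\<^sup>2 = (\<Sum>j<Nv. \<Sum>k<Nv. (v j * v k) * (c y * \<phi> j y * \<phi> k y))"
          by (simp add: y power2_eq_square sum_product sum_distrib_left mult_ac)
        show ?thesis
          unfolding form_integrand_def integrand_def 1 2 3 by (simp add: distrib_left sum.distrib)
      qed
    qed
    finally show ?thesis .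
  qed
  have "(\<Sum>j<Nv. \<Sum>k<Nv. v j * stiffness_matrix \<T> D b c Nv \<phi> $$ (j, k) * v k) =
      (\<Sum>j<Nv. \<Sum>k<Nv. \<Sum>K\<in>\<T>. (v j * v k) * integral K (integrand K j k))"
    by (intro sum.cong refl) (simp add: stiffness_entry sum_distrib_left sum_distrib_right mult_ac)
  also have "\<dots> = (\<Sum>j<Nv. \<Sum>K\<in>\<T>. \<Sum>k<Nv. (v j * v k) * integral K (integrand K j k))"
    by (intro sum.cong refl sum.swap)
  also have "\<dots> = (\<Sum>K\<in>\<T>. \<Sum>j<Nv. \<Sum>k<Nv. (v j * v k) * integral K (integrand K j k))"
    by (rule sum.swap)
  finally show ?thesis using elt by simp
qed

end

section \<open>Integration by parts and positive definiteness\<close>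

context p1_problem
begin

lemma off_skeleton_cases:
  assumes "y \<notin> (\<Union>K\<in>\<T>. frontier K)"
  shows "(\<exists>K\<in>\<T>. y \<in> interior K) \<or> y \<in> - closure \<Omega>"
proof (cases "y \<in> closure \<Omega>")
  case True
  then obtain K where K: "K \<in> \<T>" "y \<in> K" using Union_mesh by blast
  then have "y \<in> interior K" using assms closure_subset[of K] unfolding frontier_def by blast
  then show ?thesis using K(1) by blast
qed simp

lemma negligible_skeleton: "negligible (\<Union>K\<in>\<T>. frontier K)"
  using finite_mesh element_convex by (intro negligible_Union) (auto intro: negligible_convex_frontier)

lemma integral_interior_element:
  fixes f :: "real^'d \<Rightarrow> real"
  assumes "K \<in> \<T>"
  shows "(f has_integral I) K \<longleftrightarrow> ((\<lambda>y. if y \<in> interior K then f y else 0) has_integral I) UNIV"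
proof -
  have "(f has_integral I) K \<longleftrightarrow> (f has_integral I) (interior K)"
  proof (rule has_integral_spike_set_eq)
    show "negligible {y \<in> K - interior K. f y \<noteq> 0}"
      using negligible_convex_frontier[OF element_convex[OF assms]] closure_subset[of K]
      by (elim negligible_subset) (auto simp: frontier_def)
    show "negligible {y \<in> interior K - K. f y \<noteq> 0}"
      using interior_subset[of K] by (simp add: Diff_eq_empty_iff[THEN iffD2])
  qed
  then show ?thesis using has_integral_restrict_UNIV[of "interior K" f I] by blast
qed

text \<open>
  Apply the vanishing of integrals of directional derivatives to the \<open>i\<close>-th component of \<open>u\<^sup>2 b\<close>,
  extended by zero.  On each element it has bounded derivative, hence is Lipschitz there, since elements are
  convex even where the domain is not; off the element boundaries it is differentiable.
\<close>

lemma integral_flux_component: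
  fixes F :: "real^'d \<Rightarrow> (real^'d) \<Rightarrow>\<^sub>L (real^'d)"
  assumes F: "continuous_on (closure \<Omega>) F"
    and deriv: "\<And>y. y \<in> \<Omega> \<Longrightarrow> (b has_derivative blinfun_apply (F y)) (at y)"
  shows "(\<Sum>K\<in>\<T>. integral K (\<lambda>y. 2 * combination v y * (combination_grad v K $ i) * b y $ i
             + (combination v y)\<^sup>2 * (blinfun_apply (F y) (axis i 1) $ i))) = 0"
proof -
  define w where "w y = (if y \<in> closure \<Omega> then (combination v y)\<^sup>2 * b y $ i else 0)" for y
  define w' where "w' K y h = 2 * combination v y * (combination_grad v K \<bullet> h) * b y $ i
    + (combination v y)\<^sup>2 * (blinfun_apply (F y) h $ i)" for K y h
  have deriv_w: "(w has_derivative w' K y) (at y)" if K: "K \<in> \<T>" and y: "y \<in> interior K" for K y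
  proof -
    let ?u = "\<lambda>z. combination_grad v K \<bullet> z + combination_const v K"
    have yK: "y \<in> K" "y \<in> \<Omega>" using y interior_subset interior_element_subset[OF K] by blast+
    have "((\<lambda>z. b z $ i) has_derivative (\<lambda>h. blinfun_apply (F y) h $ i)) (at y)"
      by (rule bounded_linear.has_derivative[OF bounded_linear_vec_nth deriv[OF yK(2)]])
    then have "((\<lambda>z. (?u z)\<^sup>2 * b z $ i) has_derivative w' K y) (at y)"
      unfolding w'_def combination_affine[OF K yK(1)]
      by (auto intro!: derivative_eq_intros simp: algebra_simps)
    then show ?thesis
    proof (rule has_derivative_transform_within_open[OF _ open_interior y])
      fix z assume "z \<in> interior K"
      then have z: "z \<in> K" "z \<in> closure \<Omega>" using interior_subset element_subset[OF K] by blast+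
      show "(?u z)\<^sup>2 * b z $ i = w z" using z combination_affine[OF K z(1)] by (simp add: w_def)
    qed
  qed
  have "\<exists>L\<ge>0. L-lipschitz_on K w" if K: "K \<in> \<T>" for K
  proof -
    let ?g = "\<lambda>y. 2 * \<bar>combination v y\<bar> * norm (combination_grad v K) * \<bar>b y $ i\<bar> + (combination v y)\<^sup>2 * norm (F y)"
    have cont: "continuous_on K ?g"
      by (intro continuous_intros combination_continuous K element_continuous continuous_on_subset[OF F element_subset])
    obtain L where L: "\<And>y. y \<in> K \<Longrightarrow> norm (?g y) \<le> L"
      using continuous_on_compact_norm_bound[OF element_compact[OF K] cont] by blast
    have "\<bar>L\<bar>-lipschitz_on (interior K) w"
    proof (rule bounded_derivative_imp_lipschitz)
      show "(w has_derivative w' K y) (at y within interior K)" if "y \<in> interior K" for y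
        using deriv_w[OF K that] has_derivative_at_withinI by blast
      show "convex (interior K)" using element_convex[OF K] by (rule convex_interior)
      show "onorm (w' K y) \<le> \<bar>L\<bar>" if y: "y \<in> interior K" for y
      proof (rule onorm_le)
        fix h
        have "norm (w' K y h) \<le> \<bar>2 * combination v y * (combination_grad v K \<bullet> h) * b y $ i\<bar>
            + \<bar>(combination v y)\<^sup>2 * (blinfun_apply (F y) h $ i)\<bar>"
          unfolding w'_def real_norm_def by (rule abs_triangle_ineq)
        also have "\<dots> \<le> 2 * \<bar>combination v y\<bar> * (norm (combination_grad v K) * norm h) * \<bar>b y $ i\<bar>
            + (combination v y)\<^sup>2 * (norm (F y) * norm h)"
          unfolding abs_mult
          by (intro add_mono mult_mono Cauchy_Schwarz_ineq2 order.trans[OF component_le_norm_cart norm_blinfun]) auto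
        also have "\<dots> = ?g y * norm h" by (simp add: algebra_simps)
        also have "\<dots> \<le> \<bar>L\<bar> * norm h"
          using L[of y] y interior_subset[of K] by (intro mult_right_mono) (auto simp: subset_iff)
        finally show "norm (w' K y h) \<le> \<bar>L\<bar> * norm h" .
      qed
    qed simp
    moreover have clos: "closure (interior K) = K"
      using convex_closure_interior[OF element_convex[OF K] interior_element_nonempty[OF K]]
        element_compact[OF K] by (simp add: compact_imp_closed)
    moreover have "continuous_on K w"
    proof (rule continuous_on_eq)
      show "continuous_on K (\<lambda>y. (combination v y)\<^sup>2 * b y $ i)"
        by (intro continuous_intros combination_continuous K element_continuous)
      show "(combination v y)\<^sup>2 * b y $ i = w y" if "y \<in> K" for y
        using that element_subset[OF K] by (auto simp: w_def)
    qed
    ultimately have "\<bar>L\<bar>-lipschitz_on K w" using lipschitz_on_closure[of "\<bar>L\<bar>" "interior K" w] by simp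
    then show ?thesis by (intro exI[of _ "\<bar>L\<bar>"]) simp
  qed
  then obtain L where L: "\<And>K. K \<in> \<T> \<Longrightarrow> 0 \<le> L K" "\<And>K. K \<in> \<T> \<Longrightarrow> (L K)-lipschitz_on K w" by metis
  have lip: "(\<Sum>K\<in>\<T>. L K)-lipschitz_on UNIV w"
  proof (rule lipschitz_on_closed_pieces[of "insert (- \<Omega>) \<T>"])
    show "0 \<le> (\<Sum>K\<in>\<T>. L K)" using L(1) by (rule sum_nonneg)
    fix S assume S: "S \<in> insert (- \<Omega>) \<T>"
    then show "closed S" using open_domain element_compact compact_imp_closed by auto
    show "(\<Sum>K\<in>\<T>. L K)-lipschitz_on S w"
    proof (cases "S \<in> \<T>")
      case True
      then have "L S \<le> (\<Sum>K\<in>\<T>. L K)" using finite_mesh L(1) by (intro member_le_sum) auto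
      then show ?thesis using L(2)[OF True] by (rule lipschitz_on_le[rotated])
    next
      case False
      then have "w y = 0" if "y \<in> S" for y using S that combination_outside[of y v] by (auto simp: w_def)
      then show ?thesis using sum_nonneg[of \<T> L, OF L(1)]
        by (intro lipschitz_onI) auto
    qed
  next
    show "\<Union> (insert (- \<Omega>) \<T>) = UNIV" using Union_mesh closure_subset by auto
  qed (use finite_mesh in auto)
  \<comment> \<open>Off the element boundaries at most one summand is nonzero, so this is the derivative of \<open>w\<close>.\<close>
  define f where "f y = (\<Sum>K\<in>\<T>. if y \<in> interior K then w' K y (axis i 1) else 0)" for y
  have f_eq: "f y = w' K y (axis i 1)" if "K \<in> \<T>" "y \<in> interior K" for K y
  proof -
    have "f y = (\<Sum>K'\<in>\<T>. if K' = K then w' K y (axis i 1) else 0)"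
      unfolding f_def
    proof (rule sum.cong[OF refl])
      fix K' assume "K' \<in> \<T>"
      then have "y \<in> interior K' \<longleftrightarrow> K' = K"
        using interior_elements_disjoint[OF that(1) _ that(2)] that(2) by blast
      then show "(if y \<in> interior K' then w' K' y (axis i 1) else 0) = (if K' = K then w' K y (axis i 1) else 0)"
        by simp
    qed
    then show ?thesis using that(1) finite_mesh by simp
  qed
  obtain R where R: "\<And>y. y \<in> closure \<Omega> \<Longrightarrow> norm y \<le> R"
    using compact_imp_bounded[OF compact_closure_domain] by (auto simp: bounded_iff)
  have "(f has_integral 0) UNIV"
  proof (rule integral_directional_derivative_compact_support[OF lip _ negligible_skeleton])
    show "w y = 0" if "R < norm y" for y using R[of y] that by (auto simp: w_def)
    fix y assume y: "y \<notin> (\<Union>K\<in>\<T>. frontier K)"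
    have "(w has_derivative (\<lambda>h. w'' h)) (at y) \<Longrightarrow> w'' (axis i 1) = f y \<Longrightarrow>
       ((\<lambda>t. (w (y + t *\<^sub>R axis i 1) - w y) / t) \<longlongrightarrow> f y) (at 0)" for w''
    proof -
      assume d: "(w has_derivative (\<lambda>h. w'' h)) (at y)" and e: "w'' (axis i 1) = f y"
      have "((\<lambda>t. y + t *\<^sub>R axis i 1) has_derivative (\<lambda>t. t *\<^sub>R axis i 1)) (at (0::real))"
        by (auto intro!: derivative_eq_intros)
      then have "((\<lambda>t. w (y + t *\<^sub>R axis i 1)) has_derivative (\<lambda>t. w'' (t *\<^sub>R axis i 1))) (at 0)"
        using has_derivative_compose[of "\<lambda>t. y + t *\<^sub>R axis i 1" "\<lambda>t. t *\<^sub>R axis i 1" 0 UNIV w w''] d by simp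
      moreover have "(\<lambda>t. w'' (t *\<^sub>R axis i 1)) = (\<lambda>t. t * f y)"
        using linear_scale[OF has_derivative_linear[OF d]] e by simp
      ultimately have "DERIV (\<lambda>t. w (y + t *\<^sub>R axis i 1)) 0 :> f y"
        by (simp add: has_field_derivative_def mult.commute[of _ "f y"])
      then show ?thesis by (simp add: DERIV_def)
    qed
    note lim = this
    from off_skeleton_cases[OF y] show "((\<lambda>t. (w (y + t *\<^sub>R axis i 1) - w y) / t) \<longlongrightarrow> f y) (at 0)"
    proof
      assume "\<exists>K\<in>\<T>. y \<in> interior K"
      then obtain K where K: "K \<in> \<T>" "y \<in> interior K" by blast
      show ?thesis by (rule lim[OF deriv_w[OF K]]) (simp add: f_eq[OF K])
    next
      assume out: "y \<in> - closure \<Omega>"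
      have "(w has_derivative (\<lambda>h. 0)) (at y)"
        by (rule has_derivative_transform_within_open[OF has_derivative_const _ out, of 0]) (auto simp: w_def)
      moreover have "f y = 0"
        unfolding f_def using out interior_element_subset closure_subset by (intro sum.neutral) auto
      ultimately show ?thesis using lim by simp
    qed
  qed
  moreover have "(f has_integral (\<Sum>K\<in>\<T>. integral K (\<lambda>y. w' K y (axis i 1)))) UNIV"
    unfolding f_def
  proof (intro has_integral_sum finite_mesh)
    fix K assume K: "K \<in> \<T>"
    have int: "(\<lambda>y. w' K y (axis i 1)) integrable_on K"
      unfolding w'_def
      by (intro integrable_on_continuous_compact element_compact K continuous_intros element_continuous
        combination_continuous continuous_on_subset[OF F element_subset])
    show "((\<lambda>y. if y \<in> interior K then w' K y (axis i 1) else 0) has_integral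
        integral K (\<lambda>y. w' K y (axis i 1))) UNIV"
      by (rule integral_interior_element[OF K, THEN iffD1, OF integrable_integral[OF int]])
  qed
  ultimately have "(\<Sum>K\<in>\<T>. integral K (\<lambda>y. w' K y (axis i 1))) = 0"
    by (rule has_integral_unique[symmetric])
  then show ?thesis by (simp add: w'_def inner_axis)
qed

text \<open>
  Sum of the components of the flux \<open>u\<^sup>2 b\<close>.  The function \<open>d\<close> extends the divergence of \<open>b\<close> continuously to
  the closed domain, so that integrals over closed elements make sense.
\<close>

lemma integration_by_parts:
  obtains d where "continuous_on (closure \<Omega>) d" "\<And>y. y \<in> \<Omega> \<Longrightarrow> d y = divergence b y"
    "\<And>v. (\<Sum>K\<in>\<T>. integral K (\<lambda>y. combination v y * (b y \<bullet> combination_grad v K))) =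
          - (\<Sum>K\<in>\<T>. integral K (\<lambda>y. 1 / 2 * d y * (combination v y)\<^sup>2))"
proof -
  obtain F where F: "continuous_on (closure \<Omega>) F"
    "\<And>y. y \<in> \<Omega> \<Longrightarrow> (b has_derivative blinfun_apply (F y)) (at y)"
    using b_C1 unfolding C1_upto_boundary_def by blast
  define d where "d y = (\<Sum>i\<in>UNIV. blinfun_apply (F y) (axis i 1) $ i)" for y
  have cont: "continuous_on (closure \<Omega>) d"
    unfolding d_def by (intro continuous_intros F)
  have "(\<Sum>K\<in>\<T>. integral K (\<lambda>y. combination v y * (b y \<bullet> combination_grad v K))) =
          - (\<Sum>K\<in>\<T>. integral K (\<lambda>y. 1 / 2 * d y * (combination v y)\<^sup>2))" for v
  proof -
    let ?f = "\<lambda>K i y. 2 * combination v y * (combination_grad v K $ i) * b y $ i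
             + (combination v y)\<^sup>2 * (blinfun_apply (F y) (axis i 1) $ i)"
    have "integral K (\<lambda>y. combination v y * (b y \<bullet> combination_grad v K)) +
        integral K (\<lambda>y. 1 / 2 * d y * (combination v y)\<^sup>2) = 1 / 2 * (\<Sum>i\<in>UNIV. integral K (?f K i))"
      if K: "K \<in> \<T>" for K
    proof -
      have int: "?f K i integrable_on K" for i
        by (intro integrable_on_continuous_compact element_compact K continuous_intros element_continuous
          combination_continuous continuous_on_subset[OF F(1) element_subset])
      have int2: "(\<lambda>y. combination v y * (b y \<bullet> combination_grad v K)) integrable_on K"
         "(\<lambda>y. 1 / 2 * d y * (combination v y)\<^sup>2) integrable_on K"
        by (intro integrable_on_continuous_compact element_compact K continuous_intros element_continuous
          combination_continuous continuous_on_subset[OF cont element_subset])+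
      have "(\<Sum>i\<in>UNIV. integral K (?f K i)) = integral K (\<lambda>y. \<Sum>i\<in>UNIV. ?f K i y)"
        using int by (intro integral_sum[symmetric]) auto
      then have "1 / 2 * (\<Sum>i\<in>UNIV. integral K (?f K i)) = integral K (\<lambda>y. 1 / 2 * (\<Sum>i\<in>UNIV. ?f K i y))"
        by simp
      also have "(\<lambda>y. 1 / 2 * (\<Sum>i\<in>UNIV. ?f K i y)) =
         (\<lambda>y. combination v y * (b y \<bullet> combination_grad v K) + 1 / 2 * d y * (combination v y)\<^sup>2)"
        by (simp add: fun_eq_iff d_def inner_vec_def sum.distrib sum_distrib_left sum_divide_distrib mult_ac)
      finally show ?thesis using Henstock_Kurzweil_Integration.integral_add[OF int2] by simp
    qed
    then have "(\<Sum>K\<in>\<T>. integral K (\<lambda>y. combination v y * (b y \<bullet> combination_grad v K))) +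
        (\<Sum>K\<in>\<T>. integral K (\<lambda>y. 1 / 2 * d y * (combination v y)\<^sup>2)) =
        (\<Sum>K\<in>\<T>. 1 / 2 * (\<Sum>i\<in>UNIV. integral K (?f K i)))"
      unfolding sum.distrib[symmetric] by (rule sum.cong[OF refl])
    also have "\<dots> = 1 / 2 * (\<Sum>i\<in>UNIV. \<Sum>K\<in>\<T>. integral K (?f K i))"
      unfolding sum_distrib_left[symmetric] by (subst sum.swap) simp
    also have "\<dots> = 0" by (subst integral_flux_component[OF F]) simp_all
    finally show ?thesis by simp
  qed
  then show ?thesis using that[of d] cont divergence_trace[OF F(2)] by (auto simp: d_def)
qed

text \<open>
  After integration by parts the quadratic form is the sum of a positive diffusion part and the
  integral of \<open>(c - 1/2 div b) u\<^sup>2\<close>.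
\<close>

lemma quadratic_form_pos:
  assumes "\<exists>k<Nv. v k \<noteq> 0"
  shows "0 < (\<Sum>j<Nv. \<Sum>k<Nv. v j * stiffness_matrix \<T> D b c Nv \<phi> $$ (j, k) * v k)"
proof -
  obtain d where d: "continuous_on (closure \<Omega>) d" "\<And>y. y \<in> \<Omega> \<Longrightarrow> d y = divergence b y"
    and parts: "(\<Sum>K\<in>\<T>. integral K (\<lambda>y. combination v y * (b y \<bullet> combination_grad v K))) =
          - (\<Sum>K\<in>\<T>. integral K (\<lambda>y. 1 / 2 * d y * (combination v y)\<^sup>2))"
    by (rule integration_by_parts) blast
  let ?e = "\<lambda>K. combination_grad v K \<bullet> (elt_mean D K *v combination_grad v K)"
  have split: "integral K (form_integrand v K) = measure lebesgue K * ?e K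
      + integral K (\<lambda>y. combination v y * (b y \<bullet> combination_grad v K))
      + integral K (\<lambda>y. 1 / 2 * d y * (combination v y)\<^sup>2)
      + integral K (\<lambda>y. (c y - 1 / 2 * d y) * (combination v y)\<^sup>2)" if K: "K \<in> \<T>" for K
  proof -
    have int: "(\<lambda>y. ?e K * 1) integrable_on K"
      "(\<lambda>y. combination v y * (b y \<bullet> combination_grad v K)) integrable_on K"
      "(\<lambda>y. 1 / 2 * d y * (combination v y)\<^sup>2) integrable_on K"
      "(\<lambda>y. (c y - 1 / 2 * d y) * (combination v y)\<^sup>2) integrable_on K"
      by (intro integrable_on_continuous_compact element_compact K continuous_intros element_continuous
          combination_continuous continuous_on_subset[OF d(1) element_subset])+
    have "form_integrand v K = (\<lambda>y. ?e K * 1 + combination v y * (b y \<bullet> combination_grad v K)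
        + 1 / 2 * d y * (combination v y)\<^sup>2 + (c y - 1 / 2 * d y) * (combination v y)\<^sup>2)"
      by (simp add: form_integrand_def fun_eq_iff algebra_simps)
    then have "integral K (form_integrand v K) = integral K (\<lambda>y. ?e K * 1)
        + integral K (\<lambda>y. combination v y * (b y \<bullet> combination_grad v K))
        + integral K (\<lambda>y. 1 / 2 * d y * (combination v y)\<^sup>2)
        + integral K (\<lambda>y. (c y - 1 / 2 * d y) * (combination v y)\<^sup>2)"
      using int by (simp add: Henstock_Kurzweil_Integration.integral_add integrable_add)
    then show ?thesis unfolding integral_mult_right
      by (simp add: lmeasure_integral[OF lmeasurable_compact[OF element_compact[OF K]], symmetric])
  qed
  have react: "0 \<le> integral K (\<lambda>y. (c y - 1 / 2 * d y) * (combination v y)\<^sup>2)" if K: "K \<in> \<T>" for K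
  proof -
    have "integral K (\<lambda>_. 0) \<le> integral K (\<lambda>y. (c y - 1 / 2 * d y) * (combination v y)\<^sup>2)"
    proof (rule integral_le_off_negligible[OF negligible_convex_frontier[OF element_convex[OF K]]])
      show "(\<lambda>y. (c y - 1 / 2 * d y) * (combination v y)\<^sup>2) integrable_on K"
        by (intro integrable_on_continuous_compact element_compact K continuous_intros element_continuous
          combination_continuous continuous_on_subset[OF d(1) element_subset])
      fix y assume "y \<in> K - frontier K"
      then have "y \<in> \<Omega>" using interior_element_subset[OF K] closure_subset[of K] by (auto simp: frontier_def)
      then show "0 \<le> (c y - 1 / 2 * d y) * (combination v y)\<^sup>2"
        using coercive[of y] d(2)[of y] by simp
    qed (rule integrable_0)
    then show ?thesis by simp
  qed
  have nonneg: "0 \<le> measure lebesgue K * ?e K" if "K \<in> \<T>" for K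
    using sym_pos_def_nonneg[OF elt_mean_pos[OF that]] by simp
  have "(\<Sum>K\<in>\<T>. integral K (form_integrand v K)) =
      (\<Sum>K\<in>\<T>. measure lebesgue K * ?e K) + (\<Sum>K\<in>\<T>. integral K (\<lambda>y. (c y - 1 / 2 * d y) * (combination v y)\<^sup>2))"
    using parts by (simp add: split sum.distrib)
  moreover have "0 \<le> (\<Sum>K\<in>\<T>. integral K (\<lambda>y. (c y - 1 / 2 * d y) * (combination v y)\<^sup>2))"
    using react by (rule sum_nonneg)
  moreover have "0 < (\<Sum>K\<in>\<T>. measure lebesgue K * ?e K)"
  proof -
    obtain K where K: "K \<in> \<T>" "combination_grad v K \<noteq> 0"
      using combination_zero_of_zero_gradients assms by blast
    then have "0 < measure lebesgue K * ?e K"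
      using measure_element_pos sym_pos_def_pos[OF elt_mean_pos] by simp
    then show ?thesis using K(1) nonneg finite_mesh by (intro sum_pos2) auto
  qed
  ultimately show ?thesis by (simp add: quadratic_form)
qed

end

section \<open>Dihedral angles and the nonobtuse angle condition\<close>

context p1_mesh
begin

text \<open>
  Barycentric coordinates vanish on the opposite face and increase towards the vertex.  Conversely any
  normal with these properties is a multiple of the gradient, as its values on the vectors from a point
  of the face to the vertices determine it.
\<close>

lemma inner_normal_eq:
  assumes K: "K \<in> \<T>" and v: "v \<in> vertices_of K"
  shows "inner_normal K v = (1 / norm (G K (idx v))) *\<^sub>R G K (idx v)"
proof -
  interpret barycentric "vertices_of K" "\<lambda>v. G K (idx v)" "\<lambda>v. B K (idx v)"
    by (rule barycentric_element[OF K])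
  let ?g = "G K (idx v)" and ?F = "opposite_face K v"
  have g: "0 < norm ?g" using g_nonzero[OF v] by simp
  have "?F \<subseteq> {y. ?g \<bullet> y = - B K (idx v)}"
    unfolding opposite_face_def
  proof (rule hull_minimal)
    show "vertices_of K - {v} \<subseteq> {y. ?g \<bullet> y = - B K (idx v)}"
      using nodal[OF v] by (auto simp: eq_neg_iff_add_eq_0)
  qed (rule convex_hyperplane)
  then have zero: "bary v y = 0" if "y \<in> ?F" for y using that by (auto simp: bary_def)
  have face: "w \<in> ?F" if "w \<in> vertices_of K" "w \<noteq> v" for w
    using that unfolding opposite_face_def by (intro hull_inc) simp
  obtain w0 where w0: "w0 \<in> vertices_of K" "w0 \<noteq> v"
  proof -
    have "card (vertices_of K - {v}) \<noteq> 0" using card_C v by (simp add: card_Diff_singleton)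
    then show ?thesis using that by (metis card.empty DiffE all_not_in_conv insertI1)
  qed
  show ?thesis unfolding inner_normal_def
  proof (rule the_equality)
    let ?q = "(1 / norm ?g) *\<^sub>R ?g"
    have "?q \<bullet> (y - z) = 0" if "y \<in> ?F" "z \<in> ?F" for y z
      using bary_diff[of v y z] zero that by simp
    moreover have "0 < ?q \<bullet> (v - y)" if "y \<in> ?F" for y
      using bary_diff[of v v y] zero[OF that] bary_nodal[OF v v] g by simp
    ultimately show "norm ?q = 1 \<and> (\<forall>y\<in>?F. \<forall>z\<in>?F. ?q \<bullet> (y - z) = 0) \<and> (\<forall>y\<in>?F. 0 < ?q \<bullet> (v - y))"
      using g by simp
  next
    fix q assume q: "norm q = 1 \<and> (\<forall>y\<in>?F. \<forall>z\<in>?F. q \<bullet> (y - z) = 0) \<and> (\<forall>y\<in>?F. 0 < q \<bullet> (v - y))"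
    define s where "s = q \<bullet> (v - w0)"
    have s: "0 < s" using q face[OF w0] by (simp add: s_def)
    have "q \<bullet> (y - w0) = s * (?g \<bullet> (y - w0))" for y
    proof -
      have "q \<bullet> y + - (q \<bullet> w0) = (\<Sum>w\<in>vertices_of K. bary w y * (q \<bullet> w + - (q \<bullet> w0)))"
        by (rule affine_function_expansion)
      also have "\<dots> = (\<Sum>w\<in>vertices_of K. if w = v then bary v y * s else 0)"
      proof (rule sum.cong[OF refl])
        fix w assume w: "w \<in> vertices_of K"
        show "bary w y * (q \<bullet> w + - (q \<bullet> w0)) = (if w = v then bary v y * s else 0)"
        proof (cases "w = v")
          case True
          then show ?thesis by (simp add: s_def inner_diff_right)
        next
          case False
          then have "q \<bullet> (w - w0) = 0" using q face w w0 by blast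
          then show ?thesis using False by (simp add: inner_diff_right)
        qed
      qed
      also have "\<dots> = bary v y * s" using v finite_C by simp
      also have "bary v y = ?g \<bullet> (y - w0)"
        using bary_diff[of v y w0] zero[OF face[OF w0]] by simp
      finally show ?thesis by (simp add: inner_diff_right)
    qed
    from this[of "_ + w0"] have "q \<bullet> y = (s *\<^sub>R ?g) \<bullet> y" for y by simp
    then have eq: "q = s *\<^sub>R ?g" using vector_eq_rdot by blast
    then have "s * norm ?g = 1" using q s by simp
    then have "s = 1 / norm ?g" using g by (simp add: eq_divide_eq)
    then show "q = (1 / norm ?g) *\<^sub>R ?g" using eq by simp
  qed
qed

text \<open>
  A barycentric coordinate falls from 1 to 0 along an edge, so its gradient is at least the inverse of
  the edge length.
\<close>

lemma diameter_bounds: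
  assumes K: "K \<in> \<T>" and jk: "j < N" "k < N" "j \<noteq> k" "x j \<in> vertices_of K" "x k \<in> vertices_of K"
  shows "norm (x j - x k) \<le> diameter K" "1 \<le> diameter K * norm (G K j)"
proof -
  show d: "norm (x j - x k) \<le> diameter K"
    using diameter_bounded_bound[OF compact_imp_bounded[OF element_compact[OF K]]
      vertex_in_element[OF K jk(4)] vertex_in_element[OF K jk(5)]] by (simp add: dist_norm)
  have "1 = G K j \<bullet> (x j - x k)"
    using phi_affine[OF K jk(1) vertex_in_element[OF K jk(4)]] phi_affine[OF K jk(1) vertex_in_element[OF K jk(5)]]
      phi_nodal[OF jk(1) x_vertex[OF jk(1)]] phi_nodal[OF jk(1) x_vertex[OF jk(2)]] x_inj[OF jk(1,2)] jk(3)
    by (simp add: inner_diff_right)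
  also have "\<dots> \<le> norm (G K j) * norm (x j - x k)" by (rule norm_cauchy_schwarz)
  also have "\<dots> \<le> norm (G K j) * diameter K" using d by (intro mult_left_mono) auto
  finally show "1 \<le> diameter K * norm (G K j)" by (simp add: mult.commute)
qed

end

context p1_problem
begin

text \<open>The Gram matrix of the gradients in the metric of the averaged diffusion matrix.\<close>

definition gram :: "(real^'d) set \<Rightarrow> nat \<Rightarrow> nat \<Rightarrow> real" where
  "gram K j k = G K j \<bullet> (elt_mean D K *v G K k)"

lemma gram_pos:
  assumes "K \<in> \<T>" "j < N" "x j \<in> vertices_of K"
  shows "0 < gram K j j"
proof -
  have "G K j \<noteq> 0"
    using barycentric.g_nonzero[OF barycentric_element[OF assms(1)] assms(3)] assms(2) by (simp add: idx_x)
  then show ?thesis unfolding gram_def by (rule sym_pos_def_pos[OF elt_mean_pos[OF assms(1)]])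
qed

text \<open>
  Normals may be replaced by the gradients, which are positive multiples of them, and the Cauchy-Schwarz
  inequality in the metric puts the argument of \<open>arccos\<close> into \<open>[-1, 1]\<close>.
\<close>

lemma cos_dihedral_angle:
  assumes K: "K \<in> \<T>" and jk: "j < N" "k < N" "x j \<in> vertices_of K" "x k \<in> vertices_of K"
  defines "\<alpha> \<equiv> dihedral_angle D K (x j) (x k)"
  shows "0 \<le> \<alpha>" "\<alpha> \<le> pi" "cos \<alpha> * sqrt (gram K j j * gram K k k) = - gram K j k"
proof -
  let ?n = "1 / norm (G K j)" and ?m = "1 / norm (G K k)"
  let ?M = "elt_mean D K"
  define t where "t = - gram K j k / sqrt (gram K j j * gram K k k)"
  have gp: "0 < gram K j j" "0 < gram K k k" using gram_pos K jk by auto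
  have nm: "0 < ?n" "0 < ?m"
    using gp by (auto simp: gram_def)
  have pq: "inner_normal K (x j) = ?n *\<^sub>R G K j" "inner_normal K (x k) = ?m *\<^sub>R G K k"
    using inner_normal_eq[OF K jk(3)] inner_normal_eq[OF K jk(4)] jk(1,2) by (simp_all add: idx_x)
  have "sqrt ((?n * (?n * gram K j j)) * (?m * (?m * gram K k k))) = (?n * ?m) * sqrt (gram K j j * gram K k k)"
  proof -
    have "(?n * (?n * gram K j j)) * (?m * (?m * gram K k k)) = (?n * ?m)\<^sup>2 * (gram K j j * gram K k k)"
      by (simp add: power2_eq_square)
    then show ?thesis using nm by (simp add: real_sqrt_mult)
  qed
  moreover have "- (?n * (?m * gram K j k)) / ((?n * ?m) * sqrt (gram K j j * gram K k k)) = t"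
    using nm by (simp add: t_def)
  ultimately have \<alpha>: "\<alpha> = arccos t"
    unfolding \<alpha>_def dihedral_angle_def Let_def pq
    by (simp add: matrix_vector_mult_scaleR gram_def[symmetric])
  have "\<bar>t\<bar> \<le> 1"
  proof -
    have "(gram K j k)\<^sup>2 \<le> gram K j j * gram K k k"
      unfolding gram_def by (rule sym_pos_def_Cauchy_Schwarz[OF elt_mean_pos[OF K]])
    then have "\<bar>gram K j k\<bar> \<le> sqrt (gram K j j * gram K k k)"
      using real_sqrt_le_mono by fastforce
    then show ?thesis using gp by (simp add: t_def abs_divide)
  qed
  then have t: "-1 \<le> t" "t \<le> 1" by auto
  show "0 \<le> \<alpha>" "\<alpha> \<le> pi" unfolding \<alpha> using t by (auto intro: arccos_lbound arccos_ubound)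
  have "cos \<alpha> = t" unfolding \<alpha> using t by (rule cos_arccos)
  then show "cos \<alpha> * sqrt (gram K j j * gram K k k) = - gram K j k"
    using gp by (simp add: t_def)
qed

text \<open>
  The two gradients have lengths at least \<open>1 / h\<close>; multiplying the lower order terms by \<open>h |g\<^sub>j| \<ge> 1\<close> and
  \<open>h |g\<^sub>k| \<ge> 1\<close> makes them comparable with \<open>\<lambda>\<^sub>m\<^sub>i\<^sub>n |g\<^sub>j| |g\<^sub>k|\<close> times the argument of \<open>arccos\<close>, which is less
  than the cosine of the angle.
\<close>

lemma nonobtuse_contribution_neg:
  assumes mesh: "aniso_nonobtuse_mesh \<T> D b c"
    and K: "K \<in> \<T>" and jk: "j < N" "k < N" "j \<noteq> k" "x j \<in> vertices_of K" "x k \<in> vertices_of K"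
  shows "integral K (integrand K j k) < 0"
proof -
  let ?Lb = "Linf_norm K b" and ?Lc = "Linf_norm K c" and ?h = "diameter K" and ?d = "real CARD('d)"
  let ?M = "elt_mean D K"
  let ?l = "lambda_min ?M" and ?nj = "norm (G K j)" and ?nk = "norm (G K k)"
  let ?\<alpha> = "dihedral_angle D K (x j) (x k)" and ?X = "aniso_angle_bound D b c K"
  have L: "0 \<le> ?Lb" "0 \<le> ?Lc"
    using Linf_norm_bound(1)[OF element_compact[OF K] _ measure_element_pos[OF K]] element_continuous[OF K] by auto
  have l: "0 < ?l" "?l * (v \<bullet> v) \<le> v \<bullet> (?M *v v)" for v
    using lambda_min_Rayleigh[OF elt_mean_pos[OF K]] by auto
  have hj: "1 \<le> ?h * ?nj" using diameter_bounds(2)[OF K jk] .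
  have hk: "1 \<le> ?h * ?nk" using diameter_bounds(2)[OF K jk(2,1) _ jk(5,4)] jk(3) by simp
  have h: "0 \<le> ?h" using diameter_bounds(1)[OF K jk] norm_ge_zero order.trans by blast
  have X: "?X \<in> {-1..1}" "max_dihedral_angle D K < arccos ?X"
    using mesh K by (auto simp: aniso_nonobtuse_mesh_def)
  have "finite {dihedral_angle D K u v |u v. u \<in> vertices_of K \<and> v \<in> vertices_of K \<and> u \<noteq> v}"
  proof (rule finite_subset)
    show "{dihedral_angle D K u v |u v. u \<in> vertices_of K \<and> v \<in> vertices_of K \<and> u \<noteq> v}
       \<subseteq> (\<lambda>(u, v). dihedral_angle D K u v) ` (vertices_of K \<times> vertices_of K)" by auto
    show "finite ((\<lambda>(u, v). dihedral_angle D K u v) ` (vertices_of K \<times> vertices_of K))"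
      using finite_vertices[OF K] by simp
  qed
  moreover have "x j \<noteq> x k" using x_inj[OF jk(1,2)] jk(3) by simp
  ultimately have "?\<alpha> \<le> max_dihedral_angle D K"
    unfolding max_dihedral_angle_def using jk by (intro Max_ge) auto
  then have "?\<alpha> < arccos ?X" using X(2) by simp
  moreover have "arccos ?X \<le> pi" using X(1) by (intro arccos_ubound) auto
  ultimately have "cos (arccos ?X) < cos ?\<alpha>"
    using cos_dihedral_angle(1)[OF K jk(1,2,4,5)] by (intro cos_monotone_0_pi) auto
  then have cosX: "?X < cos ?\<alpha>" using X(1) by (simp add: cos_arccos)
  let ?s = "sqrt (gram K j j * gram K k k)"
  have s: "?l * (?nj * ?nk) \<le> ?s"
  proof -
    have "(?l * (?nj * ?nk))\<^sup>2 = (?l * (G K j \<bullet> G K j)) * (?l * (G K k \<bullet> G K k))"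
      by (simp add: dot_square_norm power2_eq_square)
    also have "\<dots> \<le> gram K j j * gram K k k"
      unfolding gram_def using l by (intro mult_mono mult_nonneg_nonneg sym_pos_def_nonneg elt_mean_pos K) (auto simp: less_imp_le)
    finally show ?thesis by (rule real_le_rsqrt)
  qed
  have Xeq: "?X * ?l = ?h * ?Lb / (?d + 1) + ?h\<^sup>2 * ?Lc / ((?d + 1) * (?d + 2))"
    using l(1) by (simp add: aniso_angle_bound_def Let_def distrib_right)
  have "0 \<le> ?X * ?l" unfolding Xeq using L h by simp
  then have X0: "0 \<le> ?X" using l(1) by (simp add: zero_le_mult_iff)
  have "?nk * ?Lb / (?d + 1) + ?Lc / ((?d + 1) * (?d + 2)) \<le> (?X * ?l) * (?nj * ?nk)"
  proof -
    have "1 * (?nk * ?Lb / (?d + 1)) \<le> (?h * ?nj) * (?nk * ?Lb / (?d + 1))"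
      using hj L by (intro mult_right_mono) auto
    moreover have "1 * (?Lc / ((?d + 1) * (?d + 2))) \<le> ((?h * ?nj) * (?h * ?nk)) * (?Lc / ((?d + 1) * (?d + 2)))"
      using mult_mono[OF hj hk] hj L h by (intro mult_right_mono) auto
    ultimately have "?nk * ?Lb / (?d + 1) + ?Lc / ((?d + 1) * (?d + 2)) \<le>
        (?h * ?nj) * (?nk * ?Lb / (?d + 1)) + ((?h * ?nj) * (?h * ?nk)) * (?Lc / ((?d + 1) * (?d + 2)))" by simp
    also have "\<dots> = (?X * ?l) * (?nj * ?nk)"
      unfolding Xeq distrib_right by (simp add: power2_eq_square mult_ac)
    finally show ?thesis .
  qed
  also have "\<dots> \<le> ?X * ?s" using mult_left_mono[OF s X0] by (simp add: mult.assoc)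
  also have "\<dots> < cos ?\<alpha> * ?s" using cosX gram_pos[OF K] jk by (intro mult_strict_right_mono) auto
  also have "\<dots> = - gram K j k" by (rule cos_dihedral_angle(3)[OF K jk(1,2,4,5)])
  finally have "gram K j k + ?Lb * ?nk / (?d + 1) + ?Lc / ((?d + 1) * (?d + 2)) < 0"
    by (simp add: mult.commute)
  then have "measure lebesgue K * (gram K j k + ?Lb * ?nk / (?d + 1) + ?Lc / ((?d + 1) * (?d + 2))) < 0"
    using measure_element_pos[OF K] by (simp add: mult_less_0_iff)
  then show ?thesis
    using element_contribution_bound[OF K jk] by (simp add: gram_def)
qed

end

section \<open>Interior edges of planar meshes and the Delaunay-type condition\<close>

context p1_mesh
begin

definition is_edge :: "nat \<Rightarrow> nat \<Rightarrow> (real^'d) set \<Rightarrow> bool" where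
  "is_edge j k K \<longleftrightarrow> K \<in> \<T> \<and> x j \<in> vertices_of K \<and> x k \<in> vertices_of K"

lemma apex:
  assumes "CARD('d) = 2" "is_edge j k K" "x j \<noteq> x k"
  obtains w where "vertices_of K = {x j, x k, w}" "w \<noteq> x j" "w \<noteq> x k"
proof -
  have K: "K \<in> \<T>" "x j \<in> vertices_of K" "x k \<in> vertices_of K" using assms by (auto simp: is_edge_def)
  have "card (vertices_of K - {x j, x k}) = 1"
    using element_simplex(2)[OF K(1)] assms(1,3) K finite_vertices[OF K(1)] by (subst card_Diff_subset) auto
  then obtain w where "vertices_of K - {x j, x k} = {w}" by (auto simp: card_1_singleton_iff)
  then show ?thesis using that[of w] K by blast
qed

lemma elt_bary_nodal:
  "K \<in> \<T> \<Longrightarrow> v \<in> vertices_of K \<Longrightarrow> w \<in> vertices_of K \<Longrightarrow> elt_bary K v w = (if w = v then 1 else 0)"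
  unfolding elt_bary_def by (rule barycentric.bary_nodal[OF barycentric_element])

lemma elt_bary_affine: "K \<in> \<T> \<Longrightarrow> elt_bary K v (y + t *\<^sub>R (z - y)) = elt_bary K v y + t * (elt_bary K v z - elt_bary K v y)"
  unfolding elt_bary_def by (rule barycentric.bary_affine[OF barycentric_element])

lemma element_eq:
  assumes "K \<in> \<T>"
  shows "K = {y. \<forall>v\<in>vertices_of K. 0 \<le> elt_bary K v y}"
proof -
  note element_simplex(3)[OF assms]
  also have "convex hull (vertices_of K) = {y. \<forall>v\<in>vertices_of K. 0 \<le> elt_bary K v y}"
    unfolding elt_bary_def by (rule barycentric.simplex_eq[OF barycentric_element[OF assms]])
  finally show ?thesis .
qed

lemma interior_element:
  assumes "K \<in> \<T>"
  shows "{y. \<forall>v\<in>vertices_of K. 0 < elt_bary K v y} \<subseteq> interior K"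
proof -
  have "{y. \<forall>v\<in>vertices_of K. 0 < elt_bary K v y} \<subseteq> interior (convex hull (vertices_of K))"
    unfolding elt_bary_def by (rule barycentric.interior_simplex[OF barycentric_element[OF assms]])
  also have "convex hull (vertices_of K) = K" by (rule element_simplex(3)[OF assms, symmetric])
  finally show ?thesis .
qed

lemma elt_bary_midpoint:
  assumes "K \<in> \<T>"
  shows "elt_bary K w (midpoint u v) = (elt_bary K w u + elt_bary K w v) / 2"
proof -
  have "midpoint u v = u + (1/2) *\<^sub>R (v - u)" by (simp add: midpoint_def Finite_Cartesian_Product.vec_eq_iff field_simps)
  then show ?thesis unfolding \<open>midpoint u v = _\<close> elt_bary_affine[OF assms] by (simp add: field_simps)
qed

text \<open>
  Moving from the midpoint of the edge a little towards the apex \<open>w'\<close> of \<open>K'\<close> leads to an interior point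
  of both triangles.
\<close>

lemma same_side_imp_same_element:
  assumes d: "CARD('d) = 2" and uv: "x j \<noteq> x k" and K: "is_edge j k K" "is_edge j k K'"
    and w: "vertices_of K = {x j, x k, w}" "w \<noteq> x j" "w \<noteq> x k"
    and w': "vertices_of K' = {x j, x k, w'}" "w' \<noteq> x j" "w' \<noteq> x k"
    and pos: "0 < elt_bary K w w'"
  shows "K = K'"
proof -
  have T: "K \<in> \<T>" "K' \<in> \<T>" using K by (auto simp: is_edge_def)
  define m where "m = midpoint (x j) (x k)"
  define c1 c2 where "c1 = elt_bary K (x j) w'" and "c2 = elt_bary K (x k) w'"
  \<comment> \<open>So small that the coordinates of the edge points in \<open>K\<close>, which are \<open>1/2\<close> at \<open>m\<close>, remain positive.\<close>
  define t where "t = 1 / (2 * (1 + \<bar>c1\<bar> + \<bar>c2\<bar>))"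
  have t: "0 < t" "t \<le> 1 / 2" "t * (1 + \<bar>c1\<bar> + \<bar>c2\<bar>) = 1 / 2"
    by (auto simp: t_def field_simps add_nonneg_nonneg add_pos_nonneg)
  define z where "z = m + t *\<^sub>R (w' - m)"
  note nodal = elt_bary_nodal[OF T(1)] elt_bary_nodal[OF T(2)]
  have small: "0 < 1 / 2 + t * (c - 1 / 2)" if "\<bar>c\<bar> \<le> \<bar>c1\<bar> + \<bar>c2\<bar>" for c
  proof -
    have "t * \<bar>c - 1 / 2\<bar> \<le> t * (\<bar>c1\<bar> + \<bar>c2\<bar> + 1 / 2)" using that t(1) by (intro mult_left_mono) auto
    also have "\<dots> < 1 / 2" using t by (simp add: algebra_simps)
    finally have "t * \<bar>c - 1 / 2\<bar> < 1 / 2" .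
    moreover have "- (t * \<bar>c - 1 / 2\<bar>) \<le> t * (c - 1 / 2)"
      using t(1) by (metis abs_ge_minus_self abs_mult abs_of_pos minus_le_iff)
    ultimately show ?thesis by linarith
  qed
  have "z \<in> interior K"
  proof (rule subsetD[OF interior_element[OF T(1)]])
    have "elt_bary K (x j) z = 1 / 2 + t * (c1 - 1 / 2)" "elt_bary K (x k) z = 1 / 2 + t * (c2 - 1 / 2)"
      "elt_bary K w z = t * elt_bary K w w'"
      using uv w by (simp_all add: z_def elt_bary_affine[OF T(1)] m_def elt_bary_midpoint[OF T(1)] nodal c1_def c2_def)
    then show "z \<in> {y. \<forall>v\<in>vertices_of K. 0 < elt_bary K v y}"
      using small[of c1] small[of c2] pos t(1) by (simp add: w(1))
  qed
  moreover have "z \<in> interior K'"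
  proof (rule subsetD[OF interior_element[OF T(2)]])
    have "elt_bary K' (x j) z = 1 / 2 - t / 2" "elt_bary K' (x k) z = 1 / 2 - t / 2" "elt_bary K' w' z = t"
      using uv w' by (simp_all add: z_def elt_bary_affine[OF T(2)] m_def elt_bary_midpoint[OF T(2)] nodal)
    then show "z \<in> {y. \<forall>v\<in>vertices_of K'. 0 < elt_bary K' v y}" using t by (simp add: w'(1))
  qed
  ultimately show ?thesis using interior_elements_disjoint T by blast
qed

text \<open>
  The coordinates of the two apexes are affine functions vanishing on the line through the common edge.
  The factor compares the sides of this line on which the apexes lie.
\<close>

lemma apex_coordinate_proportional:
  assumes K: "is_edge j k K" "is_edge j k K'" and uv: "x j \<noteq> x k"
    and w: "vertices_of K = {x j, x k, w}" "w \<noteq> x j" "w \<noteq> x k"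
    and w': "vertices_of K' = {x j, x k, w'}" "w' \<noteq> x j" "w' \<noteq> x k"
  shows "elt_bary K w y = elt_bary K' w' y * elt_bary K w w'"
proof -
  have T: "K \<in> \<T>" "K' \<in> \<T>" using K by (auto simp: is_edge_def)
  have "elt_bary K w y = (\<Sum>v\<in>vertices_of K'. elt_bary K' v y * elt_bary K w v)"
    unfolding elt_bary_eq[OF T(1)] unfolding elt_bary_def
    by (rule barycentric.affine_function_expansion[OF barycentric_element[OF T(2)]])
  also have "\<dots> = elt_bary K' w' y * elt_bary K w w'"
    using uv w w' elt_bary_nodal[OF T(1)] by (simp add: w'(1))
  finally show ?thesis .
qed

text \<open>
  The midpoint of an edge with an interior end point is in the domain, so the mesh covers points beyond
  the edge, and conformity makes the element found there share the edge.  A third element would have its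
  apex on the same side as one of the first two.
\<close>

lemma interior_edge_two_elements:
  assumes d: "CARD('d) = 2" and jk: "j < Nv" "k < Nv" "j \<noteq> k" and K: "is_edge j k K"
  obtains K' where "is_edge j k K'" "K' \<noteq> K" "\<And>K''. is_edge j k K'' \<Longrightarrow> K'' = K \<or> K'' = K'"
proof -
  have jkN: "j < N" "k < N" using jk Nv_le by auto
  have uv: "x j \<noteq> x k" using x_inj[OF jkN] jk(3) by simp
  have T: "K \<in> \<T>" "x j \<in> vertices_of K" "x k \<in> vertices_of K" using K by (auto simp: is_edge_def)
  obtain w where w: "vertices_of K = {x j, x k, w}" "w \<noteq> x j" "w \<noteq> x k" by (rule apex[OF d K uv])
  have wK: "w \<in> vertices_of K" using w(1) by simp
  define m where "m = midpoint (x j) (x k)"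
  have mK: "m \<in> K"
    unfolding m_def using element_convex[OF T(1)] vertex_in_element[OF T(1)] T(2,3)
    by (meson closed_segment_subset midpoint_in_closed_segment subsetD)
  have "\<phi> j m = 1 / 2"
    using phi_eq_elt_bary[OF T(1) jkN(1) mK] elt_bary_nodal[OF T(1)] T(2,3) uv
    by (simp add: m_def elt_bary_midpoint[OF T(1)])
  then have m\<Omega>: "m \<in> \<Omega>" using element_subset[OF T(1)] mK by (intro basis_support_interior[OF jk(1)]) auto
  have "open (\<Omega> - \<Union>{K\<in>\<T>. m \<notin> K})"
    using finite_mesh element_compact by (intro open_Diff open_domain closed_Union) (auto intro: compact_imp_closed)
  moreover have "m \<in> \<Omega> - \<Union>{K\<in>\<T>. m \<notin> K}" using m\<Omega> by auto
  ultimately obtain r where r: "0 < r" "ball m r \<subseteq> \<Omega> - \<Union>{K\<in>\<T>. m \<notin> K}" by (rule openE)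
  \<comment> \<open>A point slightly beyond the edge, seen from the apex \<open>w\<close>.\<close>
  define t where "t = r / (2 * (norm (w - m) + 1))"
  have t: "0 < t" using r(1) by (simp add: t_def add_nonneg_pos)
  have "t * norm (w - m) < r"
  proof -
    have "t * norm (w - m) \<le> t * (norm (w - m) + 1)" using t by simp
    also have "\<dots> = r / 2" by (simp add: t_def field_simps add_nonneg_eq_0_iff)
    finally show ?thesis using r(1) by simp
  qed
  define z where "z = m + (- t) *\<^sub>R (w - m)"
  have "z \<in> ball m r" using \<open>t * norm (w - m) < r\<close> t by (simp add: z_def dist_norm)
  then have z: "z \<in> \<Omega>" "\<And>K. K \<in> \<T> \<Longrightarrow> z \<in> K \<Longrightarrow> m \<in> K" using r(2) by blast+
  obtain K' where K': "K' \<in> \<T>" "z \<in> K'" using z(1) closure_subset Union_mesh by blast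
  have "m \<in> open_segment (x j) (x k)" using uv by (simp add: m_def midpoint_in_open_segment)
  moreover have "m \<in> K \<inter> K'" using mK z(2)[OF K'] by simp
  ultimately have "x j \<in> K \<inter> K' \<and> x k \<in> K \<inter> K'"
    using face_ofD[OF element_face[OF T(1) K'(1)]] vertex_in_element[OF T(1)] T(2,3) by blast
  then have edge': "is_edge j k K'"
    using mesh_vertex_in_element K'(1) x_vertex jkN by (auto simp: is_edge_def)
  obtain w' where w': "vertices_of K' = {x j, x k, w'}" "w' \<noteq> x j" "w' \<noteq> x k" by (rule apex[OF d edge' uv])
  have "elt_bary K w m = 0"
    using elt_bary_nodal[OF T(1) wK] T(2,3) w by (simp add: m_def elt_bary_midpoint[OF T(1)])
  then have "elt_bary K w z = - t"
    using elt_bary_affine[OF T(1), of w m "- t" w] elt_bary_nodal[OF T(1) wK wK] by (simp add: z_def)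
  then have "z \<notin> K" using element_eq[OF T(1)] wK t by force
  then have ne: "K' \<noteq> K" using K'(2) by blast
  have apex_sign: "elt_bary K w w'' < 0" if "is_edge j k K''" "K'' \<noteq> K"
    "vertices_of K'' = {x j, x k, w''}" "w'' \<noteq> x j" "w'' \<noteq> x k" for K'' w''
  proof -
    have "elt_bary K w w'' \<noteq> 0"
      using apex_coordinate_proportional[OF K that(1) uv w that(3-5), of w] elt_bary_nodal[OF T(1) wK wK] by auto
    moreover have "\<not> 0 < elt_bary K w w''"
      using same_side_imp_same_element[OF d uv K that(1) w that(3-5)] that(2) by blast
    ultimately show ?thesis by simp
  qed
  have "K'' = K \<or> K'' = K'" if K'': "is_edge j k K''" for K''
  proof (rule ccontr)
    assume neq: "\<not> (K'' = K \<or> K'' = K')"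
    obtain w'' where w'': "vertices_of K'' = {x j, x k, w''}" "w'' \<noteq> x j" "w'' \<noteq> x k" by (rule apex[OF d K'' uv])
    have "elt_bary K w w'' = elt_bary K' w' w'' * elt_bary K w w'"
      by (rule apex_coordinate_proportional[OF K edge' uv w w'])
    moreover have "elt_bary K w w'' < 0" "elt_bary K w w' < 0"
      using apex_sign[OF K'' _ w''] apex_sign[OF edge' ne w'] neq by auto
    ultimately have "0 < elt_bary K' w' w''" by (simp add: mult_less_0_iff)
    then show False using same_side_imp_same_element[OF d uv edge' K'' w' w''] neq by blast
  qed
  then show ?thesis using that edge' ne by blast
qed

end

context p1_problem
begin

text \<open>
  By the Gram determinant, \<open>sin \<alpha>\<close> times the metric lengths of the gradients is \<open>sqrt \<delta>\<close> times their cross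
  product, which is the inverse of twice the area; this gives the cotangent formula for the diffusion
  term.  The lower order terms use \<open>2 |K| |g\<^sub>k| \<le> h\<close> and \<open>2 |K| \<le> h\<^sup>2\<close>.
\<close>

lemma planar_contribution_bound:
  assumes d: "CARD('d) = 2" and jk: "j < N" "k < N" "j \<noteq> k" and K: "is_edge j k K"
  defines "\<alpha> \<equiv> dihedral_angle D K (x j) (x k)" and "\<delta> \<equiv> Determinants.det (elt_mean D K)"
    and "h \<equiv> diameter K"
  shows "0 < \<alpha>" "\<alpha> < pi" "0 < \<delta>"
    "integral K (integrand K j k) \<le> 1 / 2 * (h * Linf_norm K b / 3 + h\<^sup>2 * Linf_norm K c / 12 - sqrt \<delta> * cot \<alpha>)"
proof -
  have T: "K \<in> \<T>" "x j \<in> vertices_of K" "x k \<in> vertices_of K" using K by (auto simp: is_edge_def)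
  have uv: "x j \<noteq> x k" using x_inj[OF jk(1,2)] jk(3) by simp
  obtain w where w: "vertices_of K = {x j, x k, w}" "w \<noteq> x j" "w \<noteq> x k" by (rule apex[OF d K uv])
  have wK: "w \<in> vertices_of K" using w(1) by simp
  define l where "l = idx w"
  have l: "l < N" "x l = w" using idx[OF vertices_subset[OF T(1) wK]] by (auto simp: l_def)
  obtain p q :: 'd where pq: "UNIV = {p, q}" "p \<noteq> q" using d by (auto simp: card_2_iff)
  interpret plane p q using pq by unfold_locales
  let ?u = "x j" and ?v = "x k"
  let ?A = "measure lebesgue K"
  have hull: "K = convex hull {?u, ?v, w}" using element_simplex(3)[OF T(1)] w(1) by simp
  have grad: "G K i \<bullet> (y - z) = (if y = x i then 1 else 0) - (if z = x i then 1 else 0)"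
    if "i < N" "y \<in> vertices_of K" "z \<in> vertices_of K" for i y z
    using phi_affine[OF T(1) that(1) vertex_in_element[OF T(1) that(2)]]
      phi_affine[OF T(1) that(1) vertex_in_element[OF T(1) that(3)]]
      phi_nodal[OF that(1) vertices_subset[OF T(1) that(2)]] phi_nodal[OF that(1) vertices_subset[OF T(1) that(3)]]
    unfolding inner_diff_right by linarith
  have g: "G K j \<bullet> (?u - w) = 1" "G K j \<bullet> (?v - w) = 0" "G K k \<bullet> (?u - w) = 0" "G K k \<bullet> (?v - w) = 1"
    using grad[OF jk(1)] grad[OF jk(2)] T(2,3) wK uv w(2,3) by auto
  let ?\<tau> = "\<bar>cross (G K j) (G K k)\<bar>"
  have area: "2 * ?A * ?\<tau> = 1" "2 * ?A * norm (G K k) = norm (?u - w)" "2 * ?A \<le> norm (?u - w) * norm (?v - w)"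
    using triangle_nodal_gradients[OF g] hull by simp_all
  have A: "0 < ?A" by (rule measure_element_pos[OF T(1)])
  have \<tau>: "0 < ?\<tau>" using area(1) by (metis abs_ge_zero less_eq_real_def mult_zero_right zero_neq_one)
  show \<delta>: "0 < \<delta>" unfolding \<delta>_def by (rule det_pos[OF elt_mean_pos[OF T(1)]])
  let ?s = "sqrt (gram K j j * gram K k k)"
  have s: "0 < ?s" using gram_pos[OF T(1)] jk T by simp
  have \<alpha>: "0 \<le> \<alpha>" "\<alpha> \<le> pi" "cos \<alpha> * ?s = - gram K j k"
    unfolding \<alpha>_def using cos_dihedral_angle[OF T(1) jk(1,2) T(2,3)] by auto
  have sin0: "0 \<le> sin \<alpha>" using \<alpha> by (intro sin_ge_zero) auto
  have sin: "sin \<alpha> * ?s = sqrt \<delta> * ?\<tau>"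
  proof (rule power2_eq_imp_eq)
    have "?s\<^sup>2 = gram K j j * gram K k k" using s by simp
    moreover have "(sin \<alpha> * ?s)\<^sup>2 = ?s\<^sup>2 - (cos \<alpha> * ?s)\<^sup>2"
      by (simp add: power_mult_distrib sin_squared_eq left_diff_distrib)
    ultimately have "(sin \<alpha> * ?s)\<^sup>2 = gram K j j * gram K k k - (gram K j k)\<^sup>2" unfolding \<alpha>(3) by simp
    also have "\<dots> = \<delta> * (cross (G K j) (G K k))\<^sup>2"
      unfolding gram_def \<delta>_def using elt_mean_pos[OF T(1)] by (intro gram_determinant) (simp add: sym_pos_def_def)
    also have "\<dots> = (sqrt \<delta> * ?\<tau>)\<^sup>2" using \<delta> by (simp add: power_mult_distrib)
    finally show "(sin \<alpha> * ?s)\<^sup>2 = (sqrt \<delta> * ?\<tau>)\<^sup>2" .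
  qed (use sin0 s \<delta> in auto)
  have "0 < sqrt \<delta> * ?\<tau>" using \<delta> \<tau> by (intro mult_pos_pos) auto
  then have sin_pos: "0 < sin \<alpha>" using sin s by (metis zero_less_mult_pos2)
  show "0 < \<alpha>" "\<alpha> < pi" using \<alpha> sin_pos by (auto simp: less_le)
  have "gram K j k = - (cot \<alpha> * (sin \<alpha> * ?s))" using \<alpha>(3) sin_pos by (simp add: cot_def)
  then have "2 * ?A * gram K j k = - (cot \<alpha> * sqrt \<delta>) * (2 * ?A * ?\<tau>)" unfolding sin by (simp add: mult_ac)
  then have "2 * ?A * gram K j k = - (cot \<alpha> * sqrt \<delta>)" unfolding area(1) by simp
  then have main: "?A * gram K j k = - 1 / 2 * (sqrt \<delta> * cot \<alpha>)" by (simp add: mult_ac)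
  have L: "0 \<le> Linf_norm K b" "0 \<le> Linf_norm K c"
    using Linf_norm_bound(1)[OF element_compact[OF T(1)] _ measure_element_pos[OF T(1)]] element_continuous[OF T(1)] by auto
  have dist: "norm (?u - w) \<le> h" "norm (?v - w) \<le> h"
    unfolding h_def l(2)[symmetric]
    using diameter_bounds(1)[OF T(1) jk(1) l(1)] diameter_bounds(1)[OF T(1) jk(2) l(1)] T(2,3) l(2) wK w(2,3) by auto
  have "?A * norm (G K k) \<le> h / 2" using area(2) dist(1) by simp
  then have conv: "Linf_norm K b * (?A * norm (G K k)) \<le> Linf_norm K b * (h / 2)" using L by (intro mult_left_mono)
  have "norm (?u - w) * norm (?v - w) \<le> h * h" using dist by (intro mult_mono) (auto intro: order.trans[OF norm_ge_zero])
  then have "?A \<le> h\<^sup>2 / 2" using area(3) by (simp add: power2_eq_square)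
  then have react: "Linf_norm K c * ?A \<le> Linf_norm K c * (h\<^sup>2 / 2)" using L by (intro mult_left_mono)
  have "integral K (integrand K j k) \<le> ?A * (gram K j k + Linf_norm K b * norm (G K k) / 3 + Linf_norm K c / 12)"
    using element_contribution_bound[OF T(1) jk T(2,3)] d by (simp add: gram_def)
  also have "\<dots> = ?A * gram K j k + Linf_norm K b * (?A * norm (G K k)) / 3 + Linf_norm K c * ?A / 12"
    by (simp add: algebra_simps)
  also have "\<dots> \<le> - 1 / 2 * (sqrt \<delta> * cot \<alpha>) + Linf_norm K b * (h / 2) / 3 + Linf_norm K c * (h\<^sup>2 / 2) / 12"
    unfolding main using conv react by simp
  finally show "integral K (integrand K j k) \<le>
      1 / 2 * (h * Linf_norm K b / 3 + h\<^sup>2 * Linf_norm K c / 12 - sqrt \<delta> * cot \<alpha>)"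
    by (simp add: algebra_simps)
qed

lemma delaunay_edge_neg:
  assumes d: "CARD('d) = 2" and mesh: "aniso_delaunay_mesh \<T> D b c"
    and jk: "j < Nv" "k < Nv" "j \<noteq> k" and K: "is_edge j k K"
  shows "(\<Sum>K\<in>\<T>. integral K (integrand K j k)) < 0"
proof -
  have jkN: "j < N" "k < N" using jk Nv_le by auto
  have uv: "x j \<noteq> x k" using x_inj[OF jkN] jk(3) by simp
  obtain K' where K': "is_edge j k K'" "K' \<noteq> K" and only: "\<And>K''. is_edge j k K'' \<Longrightarrow> K'' = K \<or> K'' = K'"
    using interior_edge_two_elements[OF d jk K] by blast
  have T: "K \<in> \<T>" "K' \<in> \<T>" using K K' by (auto simp: is_edge_def)
  have "(\<Sum>K\<in>\<T>. integral K (integrand K j k)) = (\<Sum>K\<in>{K, K'}. integral K (integrand K j k))"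
  proof (rule sum.mono_neutral_right[OF finite_mesh])
    show "\<forall>L\<in>\<T> - {K, K'}. integral L (integrand L j k) = 0"
      using only jkN by (auto simp: is_edge_def intro!: integrand_off_element)
  qed (use T in auto)
  then have sum: "(\<Sum>K\<in>\<T>. integral K (integrand K j k)) = integral K (integrand K j k) + integral K' (integrand K' j k)"
    using K'(2) by simp
  note bound = planar_contribution_bound[OF d jkN jk(3) K] and bound' = planar_contribution_bound[OF d jkN jk(3) K'(1)]
  have q: "delaunay_quantity D b c K K' (x j) (x k) < pi"
    using mesh T K K' uv unfolding aniso_delaunay_mesh_def is_edge_def by blast
  have Linf: "0 \<le> Linf_norm L b" "0 \<le> Linf_norm L c" if "L \<in> \<T>" for L
    using Linf_norm_bound(1)[OF element_compact[OF that] _ measure_element_pos[OF that]] element_continuous[OF that] by auto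
  have diam: "0 \<le> diameter L" if "L \<in> \<T>" for L
    by (rule diameter_ge_0[OF compact_imp_bounded[OF element_compact[OF that]]])
  have Theta: "Theta b c K K' = diameter K * Linf_norm K b / 3 + (diameter K)\<^sup>2 * Linf_norm K c / 12
      + diameter K' * Linf_norm K' b / 3 + (diameter K')\<^sup>2 * Linf_norm K' c / 12"
    using d by (simp add: Theta_def Let_def)
  have "0 \<le> Theta b c K K'"
    unfolding Theta using Linf diam T by (intro add_nonneg_nonneg divide_nonneg_nonneg mult_nonneg_nonneg) auto
  then have "Theta b c K K' < sqrt (Determinants.det (elt_mean D K)) * cot (dihedral_angle D K (x j) (x k))
      + sqrt (Determinants.det (elt_mean D K')) * cot (dihedral_angle D K' (x j) (x k))"
    using q bound(1-3) bound'(1-3)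
    by (intro delaunay_angles_imp_cot_bound) (auto simp: delaunay_quantity_def Let_def)
  then show ?thesis unfolding sum using bound(4) bound'(4) Theta by (simp add: algebra_simps)
qed

end

section \<open>Irreducible M-matrices\<close>

context p1_problem
begin

text \<open>
  A zero block with row indices \<open>S\<close> would confine every path of interior edges that starts in \<open>S\<close>, against
  interior connectedness.
\<close>

lemma irreducible_M_matrix_if_edges_negative:
  assumes conn: "interiorly_connected \<Omega> \<T>"
    and edge: "\<And>j k K. j < Nv \<Longrightarrow> k < Nv \<Longrightarrow> j \<noteq> k \<Longrightarrow> K \<in> \<T> \<Longrightarrow>
      x j \<in> vertices_of K \<Longrightarrow> x k \<in> vertices_of K \<Longrightarrow> (\<Sum>K\<in>\<T>. integral K (integrand K j k)) < 0"
  defines "A \<equiv> stiffness_matrix \<T> D b c Nv \<phi>"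
  shows "M_matrix A \<and> irreducible_matrix A"
proof
  have A: "A \<in> carrier_mat Nv Nv" by (simp add: A_def stiffness_matrix_def)
  have entry: "A $$ (j, k) = (\<Sum>K\<in>\<T>. integral K (integrand K j k))" if "j < Nv" "k < Nv" for j k
    unfolding A_def using that by (rule stiffness_entry)
  show "M_matrix A"
  proof (rule Z_matrix_pos_def_imp_M_matrix[OF A])
    fix j k assume jk: "j < Nv" "k < Nv" "j \<noteq> k"
    show "A $$ (j, k) \<le> 0"
    proof (cases "\<exists>K\<in>\<T>. x j \<in> vertices_of K \<and> x k \<in> vertices_of K")
      case True
      then show ?thesis using edge[OF jk] entry[OF jk(1,2)] by force
    next
      case False
      then have "(\<Sum>K\<in>\<T>. integral K (integrand K j k)) = 0"
        using jk Nv_le by (intro sum.neutral ballI integrand_off_element) auto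
      then show ?thesis using entry[OF jk(1,2)] by simp
    qed
  next
    fix v :: "nat \<Rightarrow> real" assume "\<exists>i<Nv. v i \<noteq> 0"
    then show "0 < (\<Sum>i<Nv. \<Sum>j<Nv. v i * A $$ (i, j) * v j)" unfolding A_def by (rule quadratic_form_pos)
  qed
  show "irreducible_matrix A"
    unfolding irreducible_matrix_def
  proof (intro conjI notI)
    show "square_mat A" using A by simp
    assume "\<exists>S. S \<noteq> {} \<and> S \<subset> {..<dim_row A} \<and> (\<forall>i\<in>S. \<forall>j\<in>{..<dim_row A} - S. A $$ (i, j) = 0)"
    then obtain S where S: "S \<noteq> {}" "S \<subset> {..<Nv}" "\<And>i j. i \<in> S \<Longrightarrow> j < Nv \<Longrightarrow> j \<notin> S \<Longrightarrow> A $$ (i, j) = 0"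
      using A by auto
    then obtain i j where ij: "i \<in> S" "j < Nv" "j \<notin> S" by blast
    have i: "i < Nv" using ij(1) S(2) by auto
    have mv: "x k \<in> mesh_vertices \<T> - frontier \<Omega>" if "k < Nv" for k
      using that ordering Nv_le x_vertex[of k] unfolding vertex_ordering_def by (auto dest: less_le_trans)
    have "w \<in> x ` S" if "(x i, w) \<in> (interior_edges \<Omega> \<T>)\<^sup>*" for w
      using that
    proof (induction rule: rtrancl_induct)
      case base
      then show ?case using ij(1) by blast
    next
      case (step u w)
      then obtain k where k: "k \<in> S" "u = x k" by blast
      then have kN: "k < Nv" using S(2) by auto
      obtain K where K: "K \<in> \<T>" "u \<in> vertices_of K" "w \<in> vertices_of K" "u \<noteq> w" "w \<notin> frontier \<Omega>"
        using step.hyps(2) by (auto simp: interior_edges_def)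
      have wm: "w \<in> mesh_vertices \<T>" using vertices_subset K by blast
      have l: "idx w < Nv"
        using idx[OF wm] K(5) ordering unfolding vertex_ordering_def by metis
      have "A $$ (k, idx w) < 0"
        unfolding entry[OF kN l] using K k idx[OF wm] by (intro edge[OF kN l _ K(1)]) auto
      then have "idx w \<in> S" using S(3)[OF k(1) l] by force
      then show ?case using idx(2)[OF wm] by force
    qed
    then have "x j \<in> x ` S" using conn mv[OF i] mv[OF ij(2)] unfolding interiorly_connected_def by blast
    then obtain k where "k \<in> S" "x j = x k" by blast
    then have "j = k" using x_inj[of j k] S(2) ij(2) Nv_le by auto
    then show False using \<open>k \<in> S\<close> ij(3) by simp
  qed
qed

end

theorem theorem4p1:
  fixes \<Omega> :: "(real^'d) set"
    and D :: "real^'d \<Rightarrow> real^'d^'d"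
    and b :: "real^'d \<Rightarrow> real^'d"
    and c :: "real^'d \<Rightarrow> real"
    and \<T> :: "(real^'d) set set"
    and N Nv :: nat
    and x :: "nat \<Rightarrow> real^'d"
    and \<phi> :: "nat \<Rightarrow> real^'d \<Rightarrow> real"
  assumes "polyhedral_domain \<Omega>"
    and "continuous_on (closure \<Omega>) D" and "C1_upto_boundary \<Omega> b" and "continuous_on (closure \<Omega>) c"
    and "\<forall>y\<in>\<Omega>. sym_pos_def (D y)"
    and "\<forall>y\<in>\<Omega>. c y - 1 / 2 * divergence b y \<ge> 0"
    and "simplicial_mesh \<Omega> \<T>"
    and "vertex_ordering \<Omega> \<T> N Nv x"
    and "\<forall>k<N. P1_basis_function \<T> (x k) (\<phi> k)"
    and "interiorly_connected \<Omega> \<T>"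
  defines "A \<equiv> stiffness_matrix \<T> D b c Nv \<phi>"
  shows "(aniso_nonobtuse_mesh \<T> D b c \<longrightarrow> M_matrix A \<and> irreducible_matrix A) \<and>
         (CARD('d) = 2 \<and> aniso_delaunay_mesh \<T> D b c \<longrightarrow> M_matrix A \<and> irreducible_matrix A)"
proof -
  interpret p1_problem \<Omega> \<T> N Nv x \<phi> D b c
    by unfold_locales (use assms in auto)
  have "M_matrix A \<and> irreducible_matrix A" if mesh: "aniso_nonobtuse_mesh \<T> D b c"
    unfolding A_def
  proof (rule irreducible_M_matrix_if_edges_negative)
    fix j k K
    assume jk: "j < Nv" "k < Nv" "j \<noteq> k" and K: "K \<in> \<T>" "x j \<in> vertices_of K" "x k \<in> vertices_of K"
    have jkN: "j < N" "k < N" using jk Nv_le by auto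
    have le: "integral L (integrand L j k) \<le> 0" if "L \<in> \<T>" for L
    proof (cases "x j \<in> vertices_of L \<and> x k \<in> vertices_of L")
      case True
      then show ?thesis using nonobtuse_contribution_neg[OF mesh that jkN jk(3)] by (simp add: less_imp_le)
    next
      case False
      then show ?thesis using integrand_off_element[OF that jkN] by simp
    qed
    have "0 < (\<Sum>L\<in>\<T>. - integral L (integrand L j k))"
      using nonobtuse_contribution_neg[OF mesh K(1) jkN jk(3) K(2,3)] le
      by (intro sum_pos2[OF finite_mesh K(1)]) auto
    then show "(\<Sum>L\<in>\<T>. integral L (integrand L j k)) < 0" by (simp add: sum_negf)
  qed fact
  moreover have "M_matrix A \<and> irreducible_matrix A"
    if d: "CARD('d) = 2" and mesh: "aniso_delaunay_mesh \<T> D b c"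
    unfolding A_def
    by (rule irreducible_M_matrix_if_edges_negative[OF assms(10)])
       (rule delaunay_edge_neg[OF d mesh]; simp add: is_edge_def)
  ultimately show ?thesis by blast
qed

end
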